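(* Let $\mathfrak{V}=(\mathbf{V},R)$ and $\mathfrak{W}=(\mathbf{W},S)$ be objects of $\mathrm{EQA}$. Then $\underline{hom}[\mathfrak{W},\mathfrak{V}]:=\mathfrak{W}^{\dagger}\boxtimes\mathfrak{V}$, together with the arrow $\delta_{\mathfrak{V},\mathfrak{W}}:\mathfrak{V}\to\underline{hom}[\mathfrak{W},\mathfrak{V}]\boxtimes\mathfrak{W}$ given by $v_i\mapsto\sum_j(w^{j}\otimes v_i)\otimes w_j$ for bases $\{v_i\}$ of $\mathbf{V}$ and $\{w_j\}$ of $\mathbf{W}$ with dual basis $\{w^j\}$, is an internal coHom object of $(\mathrm{EQA},\boxtimes,\mathfrak{K})$: for every $\mathfrak{H}\in\mathrm{EQA}$ and every arrow $\varphi:\mathfrak{V}\to\mathfrak{H}\boxtimes\mathfrak{W}$ there exists a unique arrow $\alpha:\underline{hom}[\mathfrak{W},\mathfrak{V}]\to\mathfrak{H}$ such that $\varphi=(\alpha\boxtimes\mathrm{id})\,\delta_{\mathfrak{V},\mathfrak{W}}$. Moreover $$\mathsf{U}\,\underline{hom}[\mathfrak{W},\mathfrak{V}]=A(R:S),$$ and in particular $\mathsf{U}\,\underline{hom}[\mathfrak{V},\mathfrak{V}]=A(R)$.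
   Context: $\Bbbk$ is $\mathbb{R}$ or $\mathbb{C}$. For a finite dimensional $\Bbbk$-vector space $\mathbf{V}$, $\mathbf{V}^{\otimes}$ is its tensor algebra and $I[\mathbf{X}]$ the two-sided ideal generated by $\mathbf{X}\subset\mathbf{V}^{\otimes}$. A quadratic algebra is a pair $(\mathbf{A}_1,\mathbf{A})$ with $\mathbf{A}$ a unital associative algebra generated by a finite dimensional subspace $\mathbf{A}_1$ such that the kernel of $\mathbf{A}_1^{\otimes}\twoheadrightarrow\mathbf{A}$ is generated by a subspace of $\mathbf{A}_1^{\otimes 2}$; these form a category $\mathrm{QA}$ whose arrows are algebra homomorphisms preserving the generating subspaces. The category $\mathrm{EQA}$ of equipped quantum spaces is described (up to equivalence) as follows: objects are pairs $\mathfrak{V}=(\mathbf{V},R)$ with $\mathbf{V}$ a finite dimensional $\Bbbk$-vector space and $R:\mathbf{V}^{\otimes 2}\to\mathbf{V}^{\otimes 2}$ linear; arrows $(\mathbf{V},R)\to(\mathbf{W},S)$ are linear maps $l:\mathbf{V}\to\mathbf{W}$ with $l^{\otimes 2}R=S\,l^{\otimes 2}$. Monoidal structure: $(\mathbf{V},R)\boxtimes(\mathbf{W},S)=(\mathbf{V}\otimes\mathbf{W},R\boxtimes S)$, where $R\boxtimes S=\varphi_{\mathbf{V},\mathbf{W}}^{-1}(R\otimes\mathrm{id}+\mathrm{id}\otimes S)\varphi_{\mathbf{V},\mathbf{W}}$ and $\varphi_{\mathbf{V},\mathbf{W}}:(\mathbf{V}\otimes\mathbf{W})^{\otimes 2}\to\mathbf{V}^{\otimes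 2}\otimes\mathbf{W}^{\otimes 2}$ is $v\otimes w\otimes v'\otimes w'\mapsto v\otimes v'\otimes w\otimes w'$; on arrows $k\boxtimes l=k\otimes l$. The unit object is $\mathfrak{K}=(\Bbbk,0)$. The contravariant functor $\dagger$ is $(\mathbf{V},R)\mapsto(\mathbf{V}^{*},-R^{*})$, $l\mapsto l^{*}$, with $R^{*}$ the transpose of $R$ with respect to the factor-by-factor pairing of $(\mathbf{V}^{*})^{\otimes 2}$ with $\mathbf{V}^{\otimes 2}$. The functor $\mathsf{U}:\mathrm{EQA}\to\mathrm{QA}$ sends $(\mathbf{V},R)$ to the quadratic algebra $(\mathbf{V},\mathbf{V}^{\otimes}/I[\operatorname{Im}R])$, and an arrow to its extension to an algebra homomorphism. Rectangular quantum matrix algebra: for linear maps $R$ on $\mathbf{V}^{\otimes 2}$ and $S$ on $\mathbf{W}^{\otimes 2}$, with coefficients given by $R(v_i\otimes v_j)=\sum_{k,l}R_{ij}^{kl}\,v_k\otimes v_l$ and $S(w_k\otimes w_l)=\sum_{n,m}S_{kl}^{nm}\,w_n\otimes w_m$, $A(R:S)$ is the quadratic algebra generated by $\mathbf{W}^{*}\otimes\mathbf{V}$, with basis $t_i^{j}=w^{j}\otimes v_i$, subject to the relations $$\sum_{k,l}R_{ij}^{kl}\,t_k^{n}t_l^{m}-\sum_{k,l}t_i^{k}t_j^{l}\,S_{kl}^{nm}=0,\qquad i,j=1,\dots,\dim\mathbf{V},\; n,m=1,\dots,\dim\mathbf{W}.$$ The FRT algebra is $A(R)=A(R:R)$. 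*)

theory Defs
  imports
    Complex_Main
    "HOL-Library.Function_Algebras"
    "HOL-Algebra.Module"
    "HOL-Algebra.QuotRing"
begin

section \<open>The ground field\<close>

class real_or_complex = field +
  assumes real_or_complex:
    "(\<exists>h :: 'a \<Rightarrow> real. bij h \<and> (\<forall>x y. h (x + y) = h x + h y \<and> h (x * y) = h x * h y)) \<or>
     (\<exists>h :: 'a \<Rightarrow> complex. bij h \<and> (\<forall>x y. h (x + y) = h x + h y \<and> h (x * y) = h x * h y))"

instance real :: real_or_complex
  by standard (rule disjI1, rule exI[of _ "\<lambda>x. x"], simp add: bij_betw_def)

instance complex :: real_or_complex
  by standard (rule disjI2, rule exI[of _ "\<lambda>x. x"], simp add: bij_betw_def)

section \<open>Vector spaces and linear maps\<close>

text \<open>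
  A vector space is a subspace \<open>vecs V\<close> of an ambient type on which \<open>scl V\<close> is a vector space
  structure in the sense of the locale \<^locale>\<open>vector_space\<close>.
\<close>

record ('k, 'v) vspace =
  scl :: "'k \<Rightarrow> 'v \<Rightarrow> 'v"
  vecs :: "'v set"

definition is_vspace :: "('k::field, 'v::ab_group_add) vspace \<Rightarrow> bool" where
  "is_vspace V \<longleftrightarrow> vector_space (scl V) \<and> Modules.module.subspace (scl V) (vecs V)"

definition fin_dim :: "('k::field, 'v::ab_group_add) vspace \<Rightarrow> bool" where
  "fin_dim V \<longleftrightarrow>
     is_vspace V \<and> (\<exists>B. finite B \<and> Modules.module.span (scl V) B = vecs V)"

text \<open>
  Linear maps between subspaces are normalised to be \<open>0\<close> outside their domain, so that equality
  of linear maps is equality of functions and composition is \<^const>\<open>comp\<close>.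
\<close>

definition lin :: "('k::field, 'v::ab_group_add) vspace \<Rightarrow> ('k, 'w::ab_group_add) vspace
    \<Rightarrow> ('v \<Rightarrow> 'w) set" where
  "lin V W = {f. (\<forall>x. x \<notin> vecs V \<longrightarrow> f x = 0) \<and>
     (\<forall>x\<in>vecs V. f x \<in> vecs W) \<and>
     (\<forall>x\<in>vecs V. \<forall>y\<in>vecs V. f (x + y) = f x + f y) \<and>
     (\<forall>c. \<forall>x\<in>vecs V. f (scl V c x) = scl W c (f x))}"

definition lid :: "('k, 'v::ab_group_add) vspace \<Rightarrow> 'v \<Rightarrow> 'v" where
  "lid V x = (if x \<in> vecs V then x else 0)"

definition bilin :: "('k::field, 'v::ab_group_add) vspace \<Rightarrow> ('k, 'w::ab_group_add) vspace
    \<Rightarrow> ('k, 'u::ab_group_add) vspace \<Rightarrow> ('v \<Rightarrow> 'w \<Rightarrow> 'u) \<Rightarrow> bool" where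
  "bilin V W U \<beta> \<longleftrightarrow>
     (\<forall>v\<in>vecs V. \<forall>w\<in>vecs W. \<beta> v w \<in> vecs U) \<and>
     (\<forall>v\<in>vecs V. \<forall>v'\<in>vecs V. \<forall>w\<in>vecs W. \<beta> (v + v') w = \<beta> v w + \<beta> v' w) \<and>
     (\<forall>v\<in>vecs V. \<forall>w\<in>vecs W. \<forall>w'\<in>vecs W. \<beta> v (w + w') = \<beta> v w + \<beta> v w') \<and>
     (\<forall>c. \<forall>v\<in>vecs V. \<forall>w\<in>vecs W. \<beta> (scl V c v) w = scl U c (\<beta> v w)) \<and>
     (\<forall>c. \<forall>v\<in>vecs V. \<forall>w\<in>vecs W. \<beta> v (scl W c w) = scl U c (\<beta> v w))"

definition field_space :: "('k::field, 'k) vspace" where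
  "field_space = \<lparr>scl = (*), vecs = UNIV\<rparr>"

definition ptw :: "'k::field \<Rightarrow> ('a \<Rightarrow> 'k) \<Rightarrow> 'a \<Rightarrow> 'k" where
  "ptw c f = (\<lambda>x. c * f x)"

definition dual :: "('k::field, 'v::ab_group_add) vspace \<Rightarrow> ('k, 'v \<Rightarrow> 'k) vspace" where
  "dual V = \<lparr>scl = ptw, vecs = lin V field_space\<rparr>"

definition is_basis :: "('k::field, 'v::ab_group_add) vspace \<Rightarrow> nat \<Rightarrow> (nat \<Rightarrow> 'v) \<Rightarrow> bool" where
  "is_basis V n v \<longleftrightarrow>
     inj_on v {1..n} \<and> \<not> Modules.module.dependent (scl V) (v ` {1..n}) \<and>
     Modules.module.span (scl V) (v ` {1..n}) = vecs V"

definition dual_basis :: "('k::field, 'v::ab_group_add) vspace \<Rightarrow> nat \<Rightarrow> (nat \<Rightarrow> 'v)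
    \<Rightarrow> nat \<Rightarrow> 'v \<Rightarrow> 'k" where
  "dual_basis V n v j = (\<lambda>x. Modules.module.representation (scl V) (v ` {1..n}) x (v j))"

section \<open>Tensor products\<close>

text \<open>
  \<open>V \<otimes> W\<close> is realised as the span of the evaluations \<open>b \<mapsto> b v w\<close>, viewed as functions on the
  bilinear forms \<open>b\<close> on \<open>V \<times> W\<close>.  Theorem \<open>tensor_universal\<close> below is its universal property.
\<close>

type_synonym ('k, 'v, 'w) tens = "('v \<Rightarrow> 'w \<Rightarrow> 'k) \<Rightarrow> 'k"

definition tens :: "('k::field, 'v::ab_group_add) vspace \<Rightarrow> ('k, 'w::ab_group_add) vspace
    \<Rightarrow> 'v \<Rightarrow> 'w \<Rightarrow> ('k, 'v, 'w) tens" where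
  "tens V W v w = (\<lambda>b. if bilin V W field_space b then b v w else 0)"

definition tensor :: "('k::field, 'v::ab_group_add) vspace \<Rightarrow> ('k, 'w::ab_group_add) vspace
    \<Rightarrow> ('k, ('k, 'v, 'w) tens) vspace" where
  "tensor V W =
     \<lparr>scl = ptw, vecs = Modules.module.span ptw {tens V W v w | v w. v \<in> vecs V \<and> w \<in> vecs W}\<rparr>"

definition tlift :: "('k::field, 'v::ab_group_add) vspace \<Rightarrow> ('k, 'w::ab_group_add) vspace
    \<Rightarrow> ('k, 'u::ab_group_add) vspace \<Rightarrow> ('v \<Rightarrow> 'w \<Rightarrow> 'u) \<Rightarrow> ('k, 'v, 'w) tens \<Rightarrow> 'u" where
  "tlift V W U \<beta> =
     (THE f. f \<in> lin (tensor V W) U \<and> (\<forall>v\<in>vecs V. \<forall>w\<in>vecs W. f (tens V W v w) = \<beta> v w))"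

definition tmap :: "('k::field, 'v::ab_group_add) vspace \<Rightarrow> ('k, 'w::ab_group_add) vspace
    \<Rightarrow> ('k, 'v'::ab_group_add) vspace \<Rightarrow> ('k, 'w'::ab_group_add) vspace
    \<Rightarrow> ('v \<Rightarrow> 'v') \<Rightarrow> ('w \<Rightarrow> 'w') \<Rightarrow> ('k, 'v, 'w) tens \<Rightarrow> ('k, 'v', 'w') tens" where
  "tmap V W V' W' f g = tlift V W (tensor V' W') (\<lambda>v w. tens V' W' (f v) (g w))"

text \<open>\<open>shuffle V W\<close> is the map \<open>\<phi>\<close> from \<open>(V \<otimes> W) \<otimes> (V \<otimes> W)\<close> to \<open>(V \<otimes> V) \<otimes> (W \<otimes> W)\<close>.\<close>

definition shuffle :: "('k::field, 'v::ab_group_add) vspace \<Rightarrow> ('k, 'w::ab_group_add) vspace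
    \<Rightarrow> ('k, ('k, 'v, 'w) tens, ('k, 'v, 'w) tens) tens
    \<Rightarrow> ('k, ('k, 'v, 'v) tens, ('k, 'w, 'w) tens) tens" where
  "shuffle V W =
     (THE f. f \<in> lin (tensor (tensor V W) (tensor V W)) (tensor (tensor V V) (tensor W W)) \<and>
        (\<forall>v\<in>vecs V. \<forall>w\<in>vecs W. \<forall>v'\<in>vecs V. \<forall>w'\<in>vecs W.
           f (tens (tensor V W) (tensor V W) (tens V W v w) (tens V W v' w')) =
             tens (tensor V V) (tensor W W) (tens V V v v') (tens W W w w')))"

text \<open>The factor-by-factor pairing; see lemma \<open>pairing_tens\<close> for its value on simple tensors.\<close>

definition pairing :: "('k::field, 'v \<Rightarrow> 'k, 'v \<Rightarrow> 'k) tens \<Rightarrow> ('k, 'v, 'v) tens \<Rightarrow> 'k" where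
  "pairing \<xi> x = \<xi> (\<lambda>f g. x (\<lambda>v w. f v * g w))"

definition transpose_map :: "('k::field, 'v::ab_group_add) vspace
    \<Rightarrow> (('k, 'v, 'v) tens \<Rightarrow> ('k, 'v, 'v) tens)
    \<Rightarrow> ('k, 'v \<Rightarrow> 'k, 'v \<Rightarrow> 'k) tens \<Rightarrow> ('k, 'v \<Rightarrow> 'k, 'v \<Rightarrow> 'k) tens" where
  "transpose_map V R =
     (THE R'. R' \<in> lin (tensor (dual V) (dual V)) (tensor (dual V) (dual V)) \<and>
        (\<forall>\<xi>\<in>vecs (tensor (dual V) (dual V)). \<forall>x\<in>vecs (tensor V V).
           pairing (R' \<xi>) x = pairing \<xi> (R x)))"

section \<open>Equipped quantum spaces\<close>

type_synonym ('k, 'v) eqs = "('k, 'v) vspace \<times> (('k, 'v, 'v) tens \<Rightarrow> ('k, 'v, 'v) tens)"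

definition EQA_obj :: "('k::field, 'v::ab_group_add) eqs \<Rightarrow> bool" where
  "EQA_obj = (\<lambda>(V, R). fin_dim V \<and> R \<in> lin (tensor V V) (tensor V V))"

definition EQA_arr :: "('k::field, 'v::ab_group_add) eqs \<Rightarrow> ('k, 'w::ab_group_add) eqs
    \<Rightarrow> ('v \<Rightarrow> 'w) \<Rightarrow> bool" where
  "EQA_arr = (\<lambda>(V, R) (W, S) l. l \<in> lin V W \<and> tmap V V W W l l \<circ> R = S \<circ> tmap V V W W l l)"

definition EQA_id :: "('k, 'v::ab_group_add) eqs \<Rightarrow> 'v \<Rightarrow> 'v" where
  "EQA_id = (\<lambda>(V, R). lid V)"

definition box :: "('k::field, 'v::ab_group_add) eqs \<Rightarrow> ('k, 'w::ab_group_add) eqs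
    \<Rightarrow> ('k, ('k, 'v, 'w) tens) eqs" where
  "box = (\<lambda>(V, R) (W, S).
     (tensor V W,
      inv_into (vecs (tensor (tensor V W) (tensor V W))) (shuffle V W) \<circ>
      (tmap (tensor V V) (tensor W W) (tensor V V) (tensor W W) R (lid (tensor W W)) +
       tmap (tensor V V) (tensor W W) (tensor V V) (tensor W W) (lid (tensor V V)) S) \<circ>
      shuffle V W))"

text \<open>\<open>box_arr A B A' B' k l\<close> is \<open>k \<boxtimes> l\<close> for arrows \<open>k : A \<rightarrow> A'\<close> and \<open>l : B \<rightarrow> B'\<close>.\<close>

definition box_arr :: "('k::field, 'v::ab_group_add) eqs \<Rightarrow> ('k, 'w::ab_group_add) eqs
    \<Rightarrow> ('k, 'v'::ab_group_add) eqs \<Rightarrow> ('k, 'w'::ab_group_add) eqs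
    \<Rightarrow> ('v \<Rightarrow> 'v') \<Rightarrow> ('w \<Rightarrow> 'w') \<Rightarrow> ('k, 'v, 'w) tens \<Rightarrow> ('k, 'v', 'w') tens" where
  "box_arr A B A' B' k l = tmap (fst A) (fst B) (fst A') (fst B') k l"

definition dagger :: "('k::field, 'v::ab_group_add) eqs \<Rightarrow> ('k, 'v \<Rightarrow> 'k) eqs" where
  "dagger = (\<lambda>(V, R). (dual V, - transpose_map V R))"

definition ihom :: "('k::field, 'w::ab_group_add) eqs \<Rightarrow> ('k, 'v::ab_group_add) eqs
    \<Rightarrow> ('k, ('k, 'w \<Rightarrow> 'k, 'v) tens) eqs" where
  "ihom B A = box (dagger B) A"

text \<open>\<open>delta\<close> is the linear extension of \<open>v\<^sub>i \<mapsto> \<Sum>\<^sub>j (w\<^sup>j \<otimes> v\<^sub>i) \<otimes> w\<^sub>j\<close>.\<close>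

definition delta :: "('k::field, 'v::ab_group_add) vspace \<Rightarrow> nat \<Rightarrow> (nat \<Rightarrow> 'v)
    \<Rightarrow> ('k, 'w::ab_group_add) vspace \<Rightarrow> nat \<Rightarrow> (nat \<Rightarrow> 'w)
    \<Rightarrow> 'v \<Rightarrow> ('k, ('k, 'w \<Rightarrow> 'k, 'v) tens, 'w) tens" where
  "delta V n v W m w x =
     (\<Sum>i\<in>{1..n}. ptw (dual_basis V n v i x)
        (\<Sum>j\<in>{1..m}. tens (tensor (dual W) V) W (tens (dual W) V (dual_basis W m w j) (v i)) (w j)))"

section \<open>Tensor algebras and quadratic algebras\<close>

text \<open>
  As for tensor products, the tensor algebra is spanned by evaluations: the word \<open>v\<^sub>1 \<dots> v\<^sub>r\<close> is
  evaluation at the list \<open>[v\<^sub>1, \<dots>, v\<^sub>r]\<close>, viewed as a function on those functions of lists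
  that are multilinear on the lists of each length.  Multiplication is concatenation of words
  (lemma \<open>tmult_word\<close>); theorem \<open>tensor_algebra_universal\<close> is the universal property.
\<close>

definition multilin :: "('k::field, 'v::ab_group_add) vspace \<Rightarrow> ('v list \<Rightarrow> 'k) \<Rightarrow> bool" where
  "multilin V f \<longleftrightarrow>
     (\<forall>us\<in>lists (vecs V). \<forall>ws\<in>lists (vecs V). \<forall>x\<in>vecs V.
        (\<forall>y\<in>vecs V. f (us @ (x + y) # ws) = f (us @ x # ws) + f (us @ y # ws)) \<and>
        (\<forall>c. f (us @ scl V c x # ws) = c * f (us @ x # ws)))"

type_synonym ('k, 'v) talg = "('v list \<Rightarrow> 'k) \<Rightarrow> 'k"

definition word :: "('k::field, 'v::ab_group_add) vspace \<Rightarrow> 'v list \<Rightarrow> ('k, 'v) talg" where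
  "word V vs = (\<lambda>f. if multilin V f then f vs else 0)"

definition talg_space :: "('k::field, 'v::ab_group_add) vspace \<Rightarrow> ('k, ('k, 'v) talg) vspace" where
  "talg_space V = \<lparr>scl = ptw, vecs = Modules.module.span ptw (word V ` lists (vecs V))\<rparr>"

definition tmult :: "('k::field, 'v::ab_group_add) vspace
    \<Rightarrow> ('k, 'v) talg \<Rightarrow> ('k, 'v) talg \<Rightarrow> ('k, 'v) talg" where
  "tmult V x y = (\<lambda>f. if multilin V f then x (\<lambda>us. y (\<lambda>ws. f (us @ ws))) else 0)"

definition tensor_algebra :: "('k::field, 'v::ab_group_add) vspace
    \<Rightarrow> ('k, ('k, 'v) talg) module" where
  "tensor_algebra V = \<lparr>carrier = vecs (talg_space V), mult = tmult V, one = word V [],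
     zero = 0, add = (+), smult = ptw\<rparr>"

text \<open>The inclusion of \<open>V \<otimes> V\<close> into the tensor algebra.\<close>

definition deg2 :: "('k::field, 'v::ab_group_add) vspace \<Rightarrow> ('k, 'v, 'v) tens \<Rightarrow> ('k, 'v) talg" where
  "deg2 V = tlift V V (talg_space V) (\<lambda>v w. word V [v, w])"

definition quot_algebra :: "('k, 'a) module \<Rightarrow> 'a set \<Rightarrow> ('k, 'a set) module" where
  "quot_algebra A I =
     ring.extend (A Quot I) (module.fields (\<lambda>c X. \<Union>x\<in>X. I +>\<^bsub>A\<^esub> (c \<odot>\<^bsub>A\<^esub> x)))"

text \<open>
  \<open>presented V X\<close> is the pair consisting of the generating subspace \<open>V\<close>, as a subspace of the
  quotient, and the quotient of the tensor algebra of \<open>V\<close> by the two-sided ideal generated by \<open>X\<close>.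
\<close>

type_synonym ('k, 'v) qalg = "('k, 'v) talg set set \<times> ('k, ('k, 'v) talg set) module"

definition presented :: "('k::field, 'v::ab_group_add) vspace \<Rightarrow> ('k, 'v) talg set
    \<Rightarrow> ('k, 'v) qalg" where
  "presented V X =
     (let A = tensor_algebra V; I = Idl\<^bsub>A\<^esub> X
      in ((\<lambda>v. I +>\<^bsub>A\<^esub> word V [v]) ` vecs V, quot_algebra A I))"

definition U_obj :: "('k::field, 'v::ab_group_add) eqs \<Rightarrow> ('k, 'v) qalg" where
  "U_obj = (\<lambda>(V, R). presented V (deg2 V ` R ` vecs (tensor V V)))"

section \<open>Quantum matrix algebras\<close>

text \<open>\<open>coeff V n v R i j k l\<close> is \<open>R\<^bsub>ij\<^esub>\<^bsup>kl\<^esup>\<close>, where \<open>R (v\<^sub>i \<otimes> v\<^sub>j) = \<Sum>\<^bsub>k,l\<^esub> R\<^bsub>ij\<^esub>\<^bsup>kl\<^esup> v\<^sub>k \<otimes> v\<^sub>l\<close>.\<close>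

definition coeff :: "('k::field, 'v::ab_group_add) vspace \<Rightarrow> nat \<Rightarrow> (nat \<Rightarrow> 'v)
    \<Rightarrow> (('k, 'v, 'v) tens \<Rightarrow> ('k, 'v, 'v) tens) \<Rightarrow> nat \<Rightarrow> nat \<Rightarrow> nat \<Rightarrow> nat \<Rightarrow> 'k" where
  "coeff V n v R i j k l =
     Modules.module.representation ptw {tens V V (v p) (v q) | p q. p \<in> {1..n} \<and> q \<in> {1..n}}
       (R (tens V V (v i) (v j))) (tens V V (v k) (v l))"

definition qm_gen :: "('k::field, 'v::ab_group_add) vspace \<Rightarrow> (nat \<Rightarrow> 'v)
    \<Rightarrow> ('k, 'w::ab_group_add) vspace \<Rightarrow> nat \<Rightarrow> (nat \<Rightarrow> 'w)
    \<Rightarrow> nat \<Rightarrow> nat \<Rightarrow> ('k, ('k, 'w \<Rightarrow> 'k, 'v) tens) talg" where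
  "qm_gen V v W m w i j =
     word (tensor (dual W) V) [tens (dual W) V (dual_basis W m w j) (v i)]"

definition qm_rel :: "('k::field, 'v::ab_group_add) vspace \<Rightarrow> nat \<Rightarrow> (nat \<Rightarrow> 'v)
    \<Rightarrow> (('k, 'v, 'v) tens \<Rightarrow> ('k, 'v, 'v) tens)
    \<Rightarrow> ('k, 'w::ab_group_add) vspace \<Rightarrow> nat \<Rightarrow> (nat \<Rightarrow> 'w)
    \<Rightarrow> (('k, 'w, 'w) tens \<Rightarrow> ('k, 'w, 'w) tens)
    \<Rightarrow> nat \<Rightarrow> nat \<Rightarrow> nat \<Rightarrow> nat \<Rightarrow> ('k, ('k, 'w \<Rightarrow> 'k, 'v) tens) talg" where
  "qm_rel V n v R W m w S i j p q =
     (let t = qm_gen V v W m w; mul = tmult (tensor (dual W) V)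
      in (\<Sum>k\<in>{1..n}. \<Sum>l\<in>{1..n}. ptw (coeff V n v R i j k l) (mul (t k p) (t l q))) -
         (\<Sum>k\<in>{1..m}. \<Sum>l\<in>{1..m}. ptw (coeff W m w S k l p q) (mul (t i k) (t j l))))"

text \<open>\<open>A(R:S)\<close>, and \<open>A(R) = A(R:R)\<close>.\<close>

definition qmatrix_algebra :: "('k::field, 'v::ab_group_add) vspace \<Rightarrow> nat \<Rightarrow> (nat \<Rightarrow> 'v)
    \<Rightarrow> (('k, 'v, 'v) tens \<Rightarrow> ('k, 'v, 'v) tens)
    \<Rightarrow> ('k, 'w::ab_group_add) vspace \<Rightarrow> nat \<Rightarrow> (nat \<Rightarrow> 'w)
    \<Rightarrow> (('k, 'w, 'w) tens \<Rightarrow> ('k, 'w, 'w) tens)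
    \<Rightarrow> ('k, ('k, 'w \<Rightarrow> 'k, 'v) tens) qalg" where
  "qmatrix_algebra V n v R W m w S =
     presented (tensor (dual W) V)
       {qm_rel V n v R W m w S i j p q | i j p q.
          i \<in> {1..n} \<and> j \<in> {1..n} \<and> p \<in> {1..m} \<and> q \<in> {1..m}}"

definition FRT_algebra :: "('k::field, 'v::ab_group_add) vspace \<Rightarrow> nat \<Rightarrow> (nat \<Rightarrow> 'v)
    \<Rightarrow> (('k, 'v, 'v) tens \<Rightarrow> ('k, 'v, 'v) tens) \<Rightarrow> ('k, ('k, 'v \<Rightarrow> 'k, 'v) tens) qalg" where
  "FRT_algebra V n v R = qmatrix_algebra V n v R V n v R"

section \<open>Universal properties\<close>

lemma vector_space_ptw: "vector_space (ptw :: 'k::field \<Rightarrow> ('a \<Rightarrow> 'k) \<Rightarrow> 'a \<Rightarrow> 'k)"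
  by unfold_locales (auto simp: ptw_def fun_eq_iff algebra_simps)

lemma vector_space_mult: "vector_space ((*) :: 'k::field \<Rightarrow> 'k \<Rightarrow> 'k)"
  by unfold_locales (auto simp: algebra_simps)

lemma separating_functional:
  fixes s :: "'k::field \<Rightarrow> 'u::ab_group_add \<Rightarrow> 'u"
  assumes "vector_space s" "x \<noteq> 0"
  shows "\<exists>\<psi>. Vector_Spaces.linear s (*) \<psi> \<and> \<psi> x \<noteq> 0"
proof -
  interpret vector_space_pair s "(*) :: 'k \<Rightarrow> 'k \<Rightarrow> 'k"
    using assms(1) vector_space_mult by (rule vector_space_pair.intro)
  have "vs1.independent {x}" using assms(2) by (simp add: vs1.dependent_single)
  from linear_independent_extend[OF this, of "\<lambda>_. 1"] show ?thesis by auto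
qed

lemma span_extend:
  fixes s1 :: "'k::field \<Rightarrow> 'x::ab_group_add \<Rightarrow> 'x" and s2 :: "'k \<Rightarrow> 'u::ab_group_add \<Rightarrow> 'u"
  assumes "vector_space s1" "vector_space s2"
    and sep: "\<And>\<psi>. Vector_Spaces.linear s2 (*) \<psi> \<Longrightarrow>
      \<exists>L. Vector_Spaces.linear s1 (*) L \<and> (\<forall>i\<in>J. \<psi> (h i) = L (g i))"
  shows "\<exists>F. Vector_Spaces.linear s1 s2 F \<and> (\<forall>i\<in>J. F (g i) = h i)"
proof -
  interpret vector_space_pair s1 s2
    using assms(1,2) by (rule vector_space_pair.intro)
  interpret k: vector_space_pair s1 "(*) :: 'k \<Rightarrow> 'k \<Rightarrow> 'k"
    using assms(1) vector_space_mult by (rule vector_space_pair.intro)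
  obtain B where B: "B \<subseteq> g ` J" "vs1.independent B" "g ` J \<subseteq> vs1.span B"
    using vs1.maximal_independent_subset by blast
  define c where "c b = (SOME i. i \<in> J \<and> g i = b)" for b
  have c: "c b \<in> J \<and> g (c b) = b" if "b \<in> B" for b
    unfolding c_def by (rule someI_ex) (use that B(1) in auto)
  obtain F where F: "Vector_Spaces.linear s1 s2 F" "\<forall>b\<in>B. F b = h (c b)"
    using linear_independent_extend[OF B(2), of "\<lambda>b. h (c b)"] by auto
  have "F (g i) = h i" if i: "i \<in> J" for i
  proof (rule ccontr)
    assume "F (g i) \<noteq> h i"
    then obtain \<psi> where \<psi>: "Vector_Spaces.linear s2 (*) \<psi>" "\<psi> (F (g i) - h i) \<noteq> 0"
      using separating_functional[OF assms(2), of "F (g i) - h i"] by auto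
    obtain L where L: "Vector_Spaces.linear s1 (*) L" "\<forall>i\<in>J. \<psi> (h i) = L (g i)"
      using sep[OF \<psi>(1)] by blast
    have lin: "Vector_Spaces.linear s1 (*) (\<psi> \<circ> F)"
      using F(1) \<psi>(1) by (rule Vector_Spaces.linear_compose)
    have eq: "(\<psi> \<circ> F) b = L b" if "b \<in> B" for b
      using F(2) L(2) c[OF that] that by force
    have "g i \<in> vs1.span B" using B(3) i by auto
    then have "(\<psi> \<circ> F) (g i) = L (g i)"
      using k.linear_eq_on[OF lin L(1) _ eq] by blast
    then have "\<psi> (F (g i)) = \<psi> (h i)" using L(2) i by simp
    moreover have "\<psi> (F (g i) - h i) = \<psi> (F (g i)) - \<psi> (h i)"
      using \<psi>(1) by (auto simp: Vector_Spaces.linear_def dest: module_hom.diff)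
    ultimately show False using \<psi>(2) by simp
  qed
  with F(1) show ?thesis by blast
qed

lemma linear_evaluation:
  "Vector_Spaces.linear (ptw :: 'k::field \<Rightarrow> ('a \<Rightarrow> 'k) \<Rightarrow> 'a \<Rightarrow> 'k) (*) (\<lambda>x. x b)"
  by (intro Vector_Spaces.linear.intro module_hom.intro module_hom_axioms.intro vector_space_ptw
      vector_space_mult vector_space_ptw[THEN module_iff_vector_space[THEN iffD2]]
      vector_space_mult[THEN module_iff_vector_space[THEN iffD2]])
     (auto simp: ptw_def)

lemma linearD:
  assumes "Vector_Spaces.linear s1 s2 f"
  shows "f (x + y) = f x + f y" and "f (s1 c x) = s2 c (f x)" and "f 0 = 0"
    and "vector_space s1" and "vector_space s2"
proof -
  interpret Vector_Spaces.linear s1 s2 f by (rule assms)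
  show "f (x + y) = f x + f y" "f (s1 c x) = s2 c (f x)" "f 0 = 0"
    by (simp_all add: add scale)
  show "vector_space s1" "vector_space s2" by unfold_locales
qed

lemma is_vspaceD:
  assumes "is_vspace V"
  shows "vector_space (scl V)" and "0 \<in> vecs V"
    and "\<And>x y. x \<in> vecs V \<Longrightarrow> y \<in> vecs V \<Longrightarrow> x + y \<in> vecs V"
    and "\<And>c x. x \<in> vecs V \<Longrightarrow> scl V c x \<in> vecs V"
proof -
  show v: "vector_space (scl V)" using assms by (simp add: is_vspace_def)
  interpret vector_space "scl V" by (rule v)
  show "0 \<in> vecs V" "\<And>x y. x \<in> vecs V \<Longrightarrow> y \<in> vecs V \<Longrightarrow> x + y \<in> vecs V"
    "\<And>c x. x \<in> vecs V \<Longrightarrow> scl V c x \<in> vecs V"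
    using assms by (auto simp: is_vspace_def subspace_def)
qed

lemma is_vspace_span:
  "is_vspace \<lparr>scl = ptw, vecs = Modules.module.span ptw (B :: ('a \<Rightarrow> 'k::field) set)\<rparr>"
proof -
  interpret vector_space "ptw :: 'k \<Rightarrow> ('a \<Rightarrow> 'k) \<Rightarrow> 'a \<Rightarrow> 'k" by (rule vector_space_ptw)
  show ?thesis by (simp add: is_vspace_def vector_space_ptw)
qed

lemma is_vspace_tensor: "is_vspace (tensor V W)"
  and is_vspace_talg: "is_vspace (talg_space V)"
  by (simp_all add: tensor_def talg_space_def is_vspace_span)

text \<open>Extension of maps from a generating family of a span, in the normalised form of \<^const>\<open>lin\<close>.\<close>

lemma lin_extend:
  fixes g :: "'i \<Rightarrow> 'a \<Rightarrow> 'k::field" and U :: "('k, 'u::ab_group_add) vspace"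
  assumes "is_vspace U" and hU: "h ` J \<subseteq> vecs U"
    and sep: "\<And>\<psi>. Vector_Spaces.linear (scl U) (*) \<psi> \<Longrightarrow> \<exists>b. \<forall>i\<in>J. \<psi> (h i) = g i b"
  defines "T \<equiv> \<lparr>scl = ptw, vecs = Modules.module.span ptw (g ` J)\<rparr>"
  shows "\<exists>!f. f \<in> lin T U \<and> (\<forall>i\<in>J. f (g i) = h i)"
proof -
  note U = is_vspaceD[OF assms(1)]
  interpret vector_space_pair "ptw :: 'k \<Rightarrow> ('a \<Rightarrow> 'k) \<Rightarrow> 'a \<Rightarrow> 'k" "scl U"
    using vector_space_ptw U(1) by (rule vector_space_pair.intro)
  have T: "vecs T = vs1.span (g ` J)" "scl T = ptw" by (simp_all add: T_def)
  obtain F where F: "Vector_Spaces.linear ptw (scl U) F" "\<forall>i\<in>J. F (g i) = h i"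
  proof -
    have "\<exists>L. Vector_Spaces.linear ptw (*) L \<and> (\<forall>i\<in>J. \<psi> (h i) = L (g i))"
      if \<psi>: "Vector_Spaces.linear (scl U) (*) \<psi>" for \<psi>
    proof -
      obtain b where b: "\<forall>i\<in>J. \<psi> (h i) = g i b" using sep[OF \<psi>] by (elim exE)
      show ?thesis by (rule exI[of _ "\<lambda>x. x b"], rule conjI[OF linear_evaluation b])
    qed
    then have "\<exists>F. Vector_Spaces.linear ptw (scl U) F \<and> (\<forall>i\<in>J. F (g i) = h i)"
      by (intro span_extend[where h = h and g = g and J = J] vector_space_ptw U(1))
    then show ?thesis by (elim exE conjE) (rule that)
  qed
  note F' = linearD[OF F(1)]
  have FU: "F x \<in> vecs U" if "x \<in> vecs T" for x
    using that unfolding T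
  proof (induction rule: vs1.span_induct_alt)
    case base
    then show ?case using F'(3) U(2) by (simp del: zero_fun_apply)
  next
    case (step c x y)
    then show ?case using F(2) hU by (auto simp: F'(1,2) simp del: plus_fun_apply
        intro!: U(3,4))
  qed
  define f where "f x = (if x \<in> vecs T then F x else 0)" for x
  have gT: "g i \<in> vecs T" if "i \<in> J" for i using that by (auto simp: T intro: vs1.span_base)
  show ?thesis
  proof (rule ex1I[of _ f])
    show "f \<in> lin T U \<and> (\<forall>i\<in>J. f (g i) = h i)"
      using FU F(2) gT
      by (auto simp: lin_def f_def F'(1,2) T vs1.span_add vs1.span_scale simp del: plus_fun_apply)
  next
    fix f' assume f': "f' \<in> lin T U \<and> (\<forall>i\<in>J. f' (g i) = h i)"
    have z: "f' 0 = 0"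
    proof -
      have "\<forall>x\<in>vecs T. \<forall>y\<in>vecs T. f' (x + y) = f' x + f' y" using f' by (simp add: lin_def)
      moreover have "0 \<in> vecs T" unfolding T by (rule vs1.span_zero)
      ultimately have "f' (0 + 0) = f' 0 + f' 0" by blast
      then show ?thesis by (simp only: add_0_left add_cancel_right_right)
    qed
    have fa: "\<forall>x\<in>vecs T. \<forall>y\<in>vecs T. f' (x + y) = f' x + f' y"
      and fs: "\<forall>c. \<forall>x\<in>vecs T. f' (ptw c x) = scl U c (f' x)"
      using f' by (simp_all add: lin_def T(2))
    have "x \<in> vecs T \<and> f' x = F x" if "x \<in> vecs T" for x
      using that unfolding T
    proof (induction rule: vs1.span_induct_alt)
      case base
      then show ?case using z F'(3) by (simp only: vs1.span_zero)
    next
      case (step c x y)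
      then obtain i where i: "i \<in> J" "x = g i" by auto
      have xT: "ptw c x \<in> vecs T" using gT[OF i(1)] i(2) by (simp add: T vs1.span_scale)
      have yT: "y \<in> vecs T" using step by (simp add: T)
      have "f' (ptw c x + y) = scl U c (f' x) + f' y"
        using fa[rule_format, OF xT yT] fs[rule_format, OF gT[OF i(1)], of c] i(2) by (simp only:)
      also have "\<dots> = F (ptw c x + y)"
        using step f' F(2) i by (simp only: F'(1,2))
      finally show ?case using vs1.span_add[OF xT[unfolded T] yT[unfolded T]] by blast
    qed
    then show "f' = f" using f' by (auto simp: f_def lin_def fun_eq_iff)
  qed
qed

lemma bilin_tens:
  fixes V :: "('k::field, 'v::ab_group_add) vspace" and W :: "('k, 'w::ab_group_add) vspace"
  shows "bilin V W (tensor V W) (tens V W)"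
proof -
  interpret vector_space "ptw :: 'k \<Rightarrow> (('v \<Rightarrow> 'w \<Rightarrow> 'k) \<Rightarrow> 'k) \<Rightarrow> ('v \<Rightarrow> 'w \<Rightarrow> 'k) \<Rightarrow> 'k"
    by (rule vector_space_ptw)
  show ?thesis
    unfolding bilin_def
  proof (intro conjI ballI allI)
    fix v w assume "v \<in> vecs V" "w \<in> vecs W"
    then show "tens V W v w \<in> vecs (tensor V W)"
      by (auto simp: tensor_def intro!: span_base)
  qed (auto simp: bilin_def tens_def tensor_def field_space_def ptw_def fun_eq_iff)
qed

theorem tensor_universal:
  fixes V :: "('k::field, 'v::ab_group_add) vspace" and W :: "('k, 'w::ab_group_add) vspace"
    and U :: "('k, 'u::ab_group_add) vspace"
  assumes "is_vspace U" and \<beta>: "bilin V W U \<beta>"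
  shows "\<exists>!f. f \<in> lin (tensor V W) U \<and> (\<forall>v\<in>vecs V. \<forall>w\<in>vecs W. f (tens V W v w) = \<beta> v w)"
proof -
  let ?J = "vecs V \<times> vecs W"
  have T: "tensor V W =
      \<lparr>scl = ptw, vecs = Modules.module.span ptw ((\<lambda>(v, w). tens V W v w) ` ?J)\<rparr>"
    unfolding tensor_def by (auto intro!: arg_cong[of _ _ "Modules.module.span ptw"])
  have "\<exists>!f. f \<in> lin (tensor V W) U \<and> (\<forall>i\<in>?J. f ((\<lambda>(v, w). tens V W v w) i) = (\<lambda>(v, w). \<beta> v w) i)"
    unfolding T
  proof (rule lin_extend[OF assms(1)])
    show "(\<lambda>(v, w). \<beta> v w) ` ?J \<subseteq> vecs U" using \<beta> by (auto simp: bilin_def)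
  next
    fix \<psi> :: "'u \<Rightarrow> 'k" assume "Vector_Spaces.linear (scl U) (*) \<psi>"
    note \<psi> = linearD[OF this]
    have "bilin V W field_space (\<lambda>v w. \<psi> (\<beta> v w))"
      using \<beta> by (simp add: bilin_def field_space_def \<psi>(1,2))
    then have "\<forall>i\<in>?J. \<psi> ((\<lambda>(v, w). \<beta> v w) i) = (\<lambda>(v, w). tens V W v w) i (\<lambda>v w. \<psi> (\<beta> v w))"
      by (auto simp: tens_def)
    then show "\<exists>b. \<forall>i\<in>?J. \<psi> ((\<lambda>(v, w). \<beta> v w) i) = (\<lambda>(v, w). tens V W v w) i b" by blast
  qed
  moreover have "(\<forall>i\<in>?J. f ((\<lambda>(v, w). tens V W v w) i) = (\<lambda>(v, w). \<beta> v w) i) \<longleftrightarrow>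
      (\<forall>v\<in>vecs V. \<forall>w\<in>vecs W. f (tens V W v w) = \<beta> v w)" for f
    by auto
  ultimately show ?thesis by simp
qed

lemma pairing_tens:
  assumes "f \<in> vecs (dual V)" "g \<in> vecs (dual V)" "v \<in> vecs V" "w \<in> vecs V"
  shows "pairing (tens (dual V) (dual V) f g) (tens V V v w) = f v * g w"
proof -
  have 1: "bilin V V field_space (\<lambda>v w. f v * g w)" if "f \<in> vecs (dual V)" "g \<in> vecs (dual V)" for f g
    using that by (auto simp: dual_def lin_def bilin_def field_space_def algebra_simps)
  have 2: "tens V V v w (\<lambda>v w. f v * g w) = f v * g w"
    if "f \<in> vecs (dual V)" "g \<in> vecs (dual V)" for f g
    using 1[OF that] by (simp add: tens_def)
  have D: "f + g \<in> vecs (dual V)" "ptw c f \<in> vecs (dual V)"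
    if "f \<in> vecs (dual V)" "g \<in> vecs (dual V)" for f g c
    using that by (auto simp: dual_def lin_def field_space_def ptw_def algebra_simps)
  have "scl (dual V) = ptw" by (simp add: dual_def)
  then have "bilin (dual V) (dual V) field_space (\<lambda>f g. tens V V v w (\<lambda>v w. f v * g w))"
    unfolding bilin_def
    by (simp add: 2 D del: plus_fun_apply)
       (simp add: field_space_def ptw_def algebra_simps)
  then show ?thesis using assms 2 by (simp add: pairing_def tens_def[of "dual V"])
qed

lemma multilin_append:
  "multilin V f \<Longrightarrow> us \<in> lists (vecs V) \<Longrightarrow> multilin V (\<lambda>ws. f (us @ ws))"
  unfolding multilin_def by (metis append.assoc append_in_lists_conv)

lemma multilin_append_left:
  "multilin V f \<Longrightarrow> ws \<in> lists (vecs V) \<Longrightarrow> multilin V (\<lambda>us. f (us @ ws))"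
  unfolding multilin_def by simp

lemma multilin_cong:
  assumes "is_vspace V" "\<And>us. us \<in> lists (vecs V) \<Longrightarrow> f us = g us"
  shows "multilin V f \<longleftrightarrow> multilin V g"
  unfolding multilin_def using assms(2) is_vspaceD[OF assms(1)] by simp

lemma talg_induct [consumes 1, case_names zero step]:
  fixes V :: "('k::field, 'v::ab_group_add) vspace"
  assumes "x \<in> vecs (talg_space V)" "P 0"
    and "\<And>c us y. us \<in> lists (vecs V) \<Longrightarrow> y \<in> vecs (talg_space V) \<Longrightarrow> P y \<Longrightarrow>
      P (ptw c (word V us) + y)"
  shows "P x"
proof -
  interpret vector_space "ptw :: 'k \<Rightarrow> (('v list \<Rightarrow> 'k) \<Rightarrow> 'k) \<Rightarrow> ('v list \<Rightarrow> 'k) \<Rightarrow> 'k"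
    by (rule vector_space_ptw)
  let ?T = "span (word V ` lists (vecs V))"
  have "x \<in> ?T" using assms(1) by (simp add: talg_space_def)
  then have "x \<in> ?T \<and> P x"
  proof (induction rule: span_induct_alt)
    case base
    then show ?case using assms(2) span_zero by blast
  next
    case (step c x y)
    then have "ptw c x + y \<in> ?T" by (blast intro: span_add span_scale span_base)
    then show ?case using step assms(3) by (auto simp: talg_space_def simp del: plus_fun_apply zero_fun_apply)
  qed
  then show ?thesis by simp
qed

lemma word_in_talg: "us \<in> lists (vecs V) \<Longrightarrow> word V us \<in> vecs (talg_space V)"
proof -
  interpret vector_space "ptw :: 'b \<Rightarrow> (('a list \<Rightarrow> 'b) \<Rightarrow> 'b) \<Rightarrow> ('a list \<Rightarrow> 'b) \<Rightarrow> 'b"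
    by (rule vector_space_ptw)
  assume "us \<in> lists (vecs V)"
  then show ?thesis by (auto simp: talg_space_def intro: span_base)
qed

lemma talg_eval:
  assumes "x \<in> vecs (talg_space V)"
  shows "\<not> multilin V f \<Longrightarrow> x f = 0"
    and "multilin V f \<Longrightarrow> multilin V g \<Longrightarrow> x (\<lambda>us. f us + g us) = x f + x g"
    and "multilin V f \<Longrightarrow> x (\<lambda>us. c * f us) = c * x f"
    and "is_vspace V \<Longrightarrow> (\<And>us. us \<in> lists (vecs V) \<Longrightarrow> f us = g us) \<Longrightarrow> x f = x g"
proof -
  have a: "multilin V f \<Longrightarrow> multilin V g \<Longrightarrow> multilin V (\<lambda>us. f us + g us)"
    and b: "multilin V f \<Longrightarrow> multilin V (\<lambda>us. c * f us)"
    by (simp_all add: multilin_def algebra_simps)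
  show "\<not> multilin V f \<Longrightarrow> x f = 0"
    using assms by (induction rule: talg_induct) (auto simp: word_def ptw_def)
  show "x (\<lambda>us. f us + g us) = x f + x g" if "multilin V f" "multilin V g"
    using assms a[OF that] that
    by (induction rule: talg_induct) (simp_all add: word_def ptw_def algebra_simps)
  show "x (\<lambda>us. c * f us) = c * x f" if "multilin V f"
    using assms b[OF that] that
    by (induction rule: talg_induct) (simp_all add: word_def ptw_def algebra_simps)
  show "x f = x g" if V: "is_vspace V" and eq: "\<And>us. us \<in> lists (vecs V) \<Longrightarrow> f us = g us"
    using assms
  proof (induction rule: talg_induct)
    case (step c us y)
    then show ?case using multilin_cong[OF V eq] eq by (simp add: word_def ptw_def)
  qed simp
qed

lemma multilin_slice:
  assumes V: "is_vspace V" and y: "y \<in> vecs (talg_space V)" and f: "multilin V f"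
  shows "multilin V (\<lambda>us. y (\<lambda>ws. f (us @ ws)))"
  using y
proof (induction rule: talg_induct)
  case zero
  then show ?case by (simp add: multilin_def)
next
  case (step c us y)
  have "multilin V (\<lambda>vs. c * f (vs @ us) + y (\<lambda>ws. f (vs @ ws)))"
    using multilin_append_left[OF f step(1)] step(3) by (simp add: multilin_def algebra_simps)
  moreover have "c * f (vs @ us) + y (\<lambda>ws. f (vs @ ws)) =
      (ptw c (word V us) + y) (\<lambda>ws. f (vs @ ws))" if "vs \<in> lists (vecs V)" for vs
    using multilin_append[OF f that] by (simp add: word_def ptw_def)
  ultimately show ?case using multilin_cong[OF V] by (metis (no_types, lifting))
qed

lemma tmult_word_left:
  assumes "is_vspace V" "us \<in> lists (vecs V)" "y \<in> vecs (talg_space V)"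
  shows "tmult V (word V us) y = (\<lambda>f. if multilin V f then y (\<lambda>ws. f (us @ ws)) else 0)"
  using multilin_slice[OF assms(1,3)] by (auto simp: tmult_def word_def)

lemma tmult_word:
  assumes "is_vspace V" "us \<in> lists (vecs V)" "ws \<in> lists (vecs V)"
  shows "tmult V (word V us) (word V ws) = word V (us @ ws)"
  unfolding tmult_word_left[OF assms(1,2) word_in_talg[OF assms(3)]]
  using multilin_append[OF _ assms(2)] by (auto simp: word_def fun_eq_iff)

lemma tmult_linear_left: "tmult V (ptw c x + y) z = ptw c (tmult V x z) + tmult V y z"
  by (auto simp: tmult_def ptw_def fun_eq_iff)

lemma tmult_linear_right:
  assumes V: "is_vspace V"
    and x: "x \<in> vecs (talg_space V)" and y: "y \<in> vecs (talg_space V)" and z: "z \<in> vecs (talg_space V)"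
  shows "tmult V x (ptw c y + z) = ptw c (tmult V x y) + tmult V x z"
proof
  fix f
  have m: "multilin V (\<lambda>us. c * y (\<lambda>ws. f (us @ ws)))" if "multilin V f"
    using multilin_slice[OF V y that] by (simp add: multilin_def algebra_simps)
  show "tmult V x (ptw c y + z) f = (ptw c (tmult V x y) + tmult V x z) f"
    using talg_eval(2)[OF x m multilin_slice[OF V z]] talg_eval(3)[OF x multilin_slice[OF V y]]
    by (simp add: tmult_def ptw_def)
qed

lemma tmult_closed:
  assumes V: "is_vspace V"
    and x: "x \<in> vecs (talg_space V)" and y: "y \<in> vecs (talg_space V)"
  shows "tmult V x y \<in> vecs (talg_space V)"
proof -
  note T = is_vspaceD[OF is_vspace_talg[of V]]
  have s: "scl (talg_space V) = ptw" by (simp add: talg_space_def)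
  have 1: "tmult V (word V us) y \<in> vecs (talg_space V)" if "us \<in> lists (vecs V)" for us
    using y
  proof (induction rule: talg_induct)
    case zero
    then show ?case using T(2) by (simp add: tmult_def word_def zero_fun_def if_distrib cong: if_cong)
  next
    case (step c ws y)
    have "tmult V (word V us) (ptw c (word V ws) + y) =
        ptw c (word V (us @ ws)) + tmult V (word V us) y"
      using step that by (simp only: tmult_linear_right[OF V] word_in_talg tmult_word[OF V])
    moreover have "us @ ws \<in> lists (vecs V)" using step(1) that by simp
    ultimately show ?case
      using T(3)[OF T(4)[OF word_in_talg] step(3)] by (simp only: s)
  qed
  show ?thesis
    using x
  proof (induction rule: talg_induct)
    case zero
    then show ?case using T(2) by (simp add: tmult_def zero_fun_def)
  next
    case (step c us x)
    then show ?case using 1 T(3,4) by (simp add: tmult_linear_left s del: plus_fun_apply zero_fun_apply)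
  qed
qed

theorem ring_tensor_algebra:
  fixes V :: "('k::field, 'v::ab_group_add) vspace"
  assumes V: "is_vspace V"
  shows "ring (tensor_algebra V)"
proof (rule ringI)
  let ?T = "vecs (talg_space V)"
  note T = is_vspaceD[OF is_vspace_talg[of V]]
  have s: "scl (talg_space V) = ptw" by (simp add: talg_space_def)
  show "abelian_group (tensor_algebra V)"
  proof (rule abelian_groupI)
    fix x assume x: "x \<in> carrier (tensor_algebra V)"
    have "ptw (- 1) x + x = 0" by (simp add: ptw_def fun_eq_iff)
    with T(4)[of x "- 1"] x show "\<exists>y\<in>carrier (tensor_algebra V).
        y \<oplus>\<^bsub>tensor_algebra V\<^esub> x = \<zero>\<^bsub>tensor_algebra V\<^esub>"
      by (auto simp: tensor_algebra_def s)
  qed (use T in \<open>simp_all add: tensor_algebra_def algebra_simps\<close>)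
  show "Group.monoid (tensor_algebra V)"
  proof (rule Group.monoidI)
    fix x y z assume xyz: "x \<in> carrier (tensor_algebra V)" "y \<in> carrier (tensor_algebra V)"
      "z \<in> carrier (tensor_algebra V)"
    then have x: "x \<in> ?T" and y: "y \<in> ?T" and z: "z \<in> ?T"
      by (simp_all add: tensor_algebra_def)
    have "tmult V (tmult V x y) z = tmult V x (tmult V y z)"
    proof
      fix f
      show "tmult V (tmult V x y) z f = tmult V x (tmult V y z) f"
      proof (cases "multilin V f")
        case True
        have "x (\<lambda>us. y (\<lambda>vs. z (\<lambda>ws. f ((us @ vs) @ ws)))) =
            x (\<lambda>us. tmult V y z (\<lambda>vs. f (us @ vs)))"
          using multilin_append[OF True]
          by (intro talg_eval(4)[OF x V]) (simp add: tmult_def)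
        then show ?thesis
          using True multilin_slice[OF V z True] by (simp add: tmult_def)
      qed (simp add: tmult_def)
    qed
    then show "x \<otimes>\<^bsub>tensor_algebra V\<^esub> y \<otimes>\<^bsub>tensor_algebra V\<^esub> z =
        x \<otimes>\<^bsub>tensor_algebra V\<^esub> (y \<otimes>\<^bsub>tensor_algebra V\<^esub> z)"
      by (simp add: tensor_algebra_def)
    have "tmult V (word V []) x = x"
      using talg_eval(1)[OF x] by (auto simp: tmult_word_left[OF V _ x] fun_eq_iff)
    then show "\<one>\<^bsub>tensor_algebra V\<^esub> \<otimes>\<^bsub>tensor_algebra V\<^esub> x = x"
      by (simp add: tensor_algebra_def)
    have "tmult V x (word V []) = x"
    proof
      fix f
      show "tmult V x (word V []) f = x f"
      proof (cases "multilin V f")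
        case True
        have "x (\<lambda>us. word V [] (\<lambda>ws. f (us @ ws))) = x f"
          using multilin_append[OF True]
          by (intro talg_eval(4)[OF x V]) (simp add: word_def)
        then show ?thesis using True by (simp add: tmult_def)
      qed (simp add: tmult_def talg_eval(1)[OF x])
    qed
    then show "x \<otimes>\<^bsub>tensor_algebra V\<^esub> \<one>\<^bsub>tensor_algebra V\<^esub> = x"
      by (simp add: tensor_algebra_def)
  qed (simp_all add: tensor_algebra_def tmult_closed[OF V] word_in_talg)
next
  fix x y z assume "x \<in> carrier (tensor_algebra V)" "y \<in> carrier (tensor_algebra V)"
    "z \<in> carrier (tensor_algebra V)"
  then have xyz: "x \<in> vecs (talg_space V)" "y \<in> vecs (talg_space V)" "z \<in> vecs (talg_space V)"
    by (simp_all add: tensor_algebra_def)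
  have one: "ptw 1 x = x" for x :: "('v list \<Rightarrow> 'k) \<Rightarrow> 'k" by (simp add: ptw_def)
  show "(x \<oplus>\<^bsub>tensor_algebra V\<^esub> y) \<otimes>\<^bsub>tensor_algebra V\<^esub> z =
      x \<otimes>\<^bsub>tensor_algebra V\<^esub> z \<oplus>\<^bsub>tensor_algebra V\<^esub> y \<otimes>\<^bsub>tensor_algebra V\<^esub> z"
    using tmult_linear_left[of V 1 x y z] by (simp add: tensor_algebra_def one)
  show "z \<otimes>\<^bsub>tensor_algebra V\<^esub> (x \<oplus>\<^bsub>tensor_algebra V\<^esub> y) =
      z \<otimes>\<^bsub>tensor_algebra V\<^esub> x \<oplus>\<^bsub>tensor_algebra V\<^esub> z \<otimes>\<^bsub>tensor_algebra V\<^esub> y"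
    using tmult_linear_right[OF assms xyz(3,1,2), of 1] by (simp add: tensor_algebra_def one)
qed

theorem tensor_algebra_universal:
  fixes V :: "('k::field, 'v::ab_group_add) vspace" and s :: "'k \<Rightarrow> 'a::ring_1 \<Rightarrow> 'a"
  assumes V: "is_vspace V" and "vector_space s"
    and s: "\<And>c a b. s c a * b = s c (a * b)" "\<And>c a b. a * s c b = s c (a * b)"
    and h: "h \<in> lin V \<lparr>scl = s, vecs = UNIV\<rparr>"
  shows "\<exists>!F. F \<in> lin (talg_space V) \<lparr>scl = s, vecs = UNIV\<rparr> \<and>
    F (word V []) = 1 \<and>
    (\<forall>x\<in>vecs (talg_space V). \<forall>y\<in>vecs (talg_space V). F (tmult V x y) = F x * F y) \<and>
    (\<forall>v\<in>vecs V. F (word V [v]) = h v)"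
proof -
  let ?U = "\<lparr>scl = s, vecs = UNIV\<rparr> :: ('k, 'a) vspace"
  let ?T = "vecs (talg_space V)"
  let ?L = "lists (vecs V)"
  interpret vector_space s by (rule assms(2))
  have U: "is_vspace ?U" using assms(2) by (simp add: is_vspace_def)
  have ex: "\<exists>!F. F \<in> lin (talg_space V) ?U \<and> (\<forall>us\<in>?L. F (word V us) = prod_list (map h us))"
    unfolding talg_space_def
  proof (rule lin_extend[OF U])
    fix \<psi> :: "'a \<Rightarrow> 'k" assume "Vector_Spaces.linear (scl ?U) (*) \<psi>"
    note \<psi> = linearD[OF this]
    have "multilin V (\<lambda>us. \<psi> (prod_list (map h us)))"
      using h by (simp add: multilin_def lin_def s \<psi>(1) \<psi>(2)[simplified] distrib_left distrib_right)
    then show "\<exists>b. \<forall>us\<in>?L. \<psi> (prod_list (map h us)) = word V us b"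
      by (intro exI[of _ "\<lambda>us. \<psi> (prod_list (map h us))"]) (simp add: word_def)
  qed simp
  then obtain F where F: "F \<in> lin (talg_space V) ?U" "\<forall>us\<in>?L. F (word V us) = prod_list (map h us)"
    by (rule ex1E) blast
  have Fs: "F (ptw c x + y) = s c (F x) + F y" if "x \<in> ?T" "y \<in> ?T" for c x y
    using F(1) that is_vspaceD(4)[OF is_vspace_talg[of V] that(1)]
    by (simp add: lin_def talg_space_def)
  have F0: "F 0 = 0"
  proof -
    have "F (ptw 0 0) = s 0 (F 0)"
      using F(1) is_vspaceD(2)[OF is_vspace_talg[of V]] by (simp add: lin_def talg_space_def)
    moreover have "ptw 0 (0 :: ('v list \<Rightarrow> 'k) \<Rightarrow> 'k) = 0" by (simp add: ptw_def fun_eq_iff)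
    ultimately show ?thesis by simp
  qed
  have z: "tmult V x 0 = 0" "tmult V 0 x = 0" if "x \<in> ?T" for x
    using tmult_linear_right[OF V that is_vspaceD(2)[OF is_vspace_talg[of V]] is_vspaceD(2)[OF is_vspace_talg[of V]], of "- 1"]
    by (auto simp: tmult_def ptw_def fun_eq_iff split: if_splits)
  have Fw: "F (tmult V (word V us) y) = F (word V us) * F y" if us: "us \<in> ?L" and "y \<in> ?T" for us y
    using that(2)
  proof (induction rule: talg_induct)
    case zero
    show ?case by (simp only: z(1)[OF word_in_talg[OF us]] F0 mult_zero_right)
  next
    case (step c ws y)
    then show ?case
      using F(2) us
      by (simp add: tmult_linear_right[OF V] word_in_talg Fs tmult_closed[OF V] s distrib_left tmult_word[OF V]
          del: plus_fun_apply)
  qed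
  have Fm: "F (tmult V x y) = F x * F y" if "x \<in> ?T" and y: "y \<in> ?T" for x y
    using that(1)
  proof (induction rule: talg_induct)
    case zero
    show ?case by (simp only: z(2)[OF y] F0 mult_zero_left)
  next
    case (step c ws x)
    then show ?case
      by (simp add: tmult_linear_left Fs tmult_closed[OF V] word_in_talg y Fw s distrib_right del: plus_fun_apply)
  qed
  show ?thesis
  proof (rule ex1I[of _ F])
    show "F \<in> lin (talg_space V) ?U \<and> F (word V []) = 1 \<and>
        (\<forall>x\<in>?T. \<forall>y\<in>?T. F (tmult V x y) = F x * F y) \<and> (\<forall>v\<in>vecs V. F (word V [v]) = h v)"
      using F Fm by simp
  next
    fix G assume G: "G \<in> lin (talg_space V) ?U \<and> G (word V []) = 1 \<and>
        (\<forall>x\<in>?T. \<forall>y\<in>?T. G (tmult V x y) = G x * G y) \<and> (\<forall>v\<in>vecs V. G (word V [v]) = h v)"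
    have "G (word V us) = prod_list (map h us)" if "us \<in> ?L" for us
      using that
    proof (induction us)
      case (Cons u us)
      then have "G (word V (u # us)) = G (tmult V (word V [u]) (word V us))"
        by (simp add: tmult_word[OF V])
      also have "\<dots> = G (word V [u]) * G (word V us)"
        using G Cons word_in_talg[of "[u]" V] word_in_talg[of us V] by simp
      finally show ?case using G Cons by simp
    qed (use G in simp)
    then have G': "G \<in> lin (talg_space V) ?U \<and> (\<forall>us\<in>?L. G (word V us) = prod_list (map h us))"
      using G by simp
    have F': "F \<in> lin (talg_space V) ?U \<and> (\<forall>us\<in>?L. F (word V us) = prod_list (map h us))"
      using F by simp
    from ex[unfolded Ex1_def] obtain H where
      "\<forall>F. F \<in> lin (talg_space V) ?U \<and> (\<forall>us\<in>?L. F (word V us) = prod_list (map h us)) \<longrightarrow> F = H"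
      by (elim exE conjE)
    note this[rule_format]
    from this[OF F'] this[OF G'] show "G = F" by simp
  qed
qed

end

theory Submission
  imports Defs
begin

text \<open>
  Everything rests on one family of equations.  Let \<open>v\<^sub>i\<close> and \<open>w\<^sub>p\<close> be bases of \<open>V\<close> and \<open>W\<close>, let
  \<open>(H, T)\<close> be an equipped quantum space and let \<open>a\<close> be a matrix of vectors \<open>a p i\<close> of \<open>H\<close>.  The
  exchange relations for \<open>a\<close> say that for all \<open>i, j, p, q\<close>
    \<open>\<Sum> R\<^sub>i\<^sub>j\<^sup>k\<^sup>l (a p k \<otimes> a q l) - \<Sum> S\<^sub>r\<^sub>s\<^sup>p\<^sup>q (a r i \<otimes> a s j) = T (a p i \<otimes> a q j)\<close>;
  the left hand side is called \<open>rtt\<close> below.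

  A linear map \<open>\<phi> : V \<rightarrow> H \<otimes> W\<close> is the same as such a matrix, by \<open>\<phi> v\<^sub>i = \<Sum>\<^sub>p a p i \<otimes> w\<^sub>p\<close>, and \<open>\<phi>\<close> is an
  arrow to \<open>H \<boxtimes> W\<close> if and only if \<open>a\<close> satisfies the exchange relations
  (\<open>coaction_arrow_iff\<close>): compare the coefficients of \<open>w\<^sub>p \<otimes> w\<^sub>q\<close> in the intertwining equation.
  A linear map \<open>\<alpha> : W* \<otimes> V \<rightarrow> H\<close> is also the same as such a matrix, by
  \<open>\<alpha> (w\<^sup>p \<otimes> v\<^sub>i) = a p i\<close>, and \<open>\<alpha>\<close> is an arrow from the internal hom if and only if \<open>a\<close>
  satisfies the very same relations (\<open>ihom_arrow_iff\<close>): the operator of \<open>W\<^sup>\<dagger> \<boxtimes> V\<close> is built from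
  \<open>-S*\<close> and \<open>R\<close>, so its value on two generators \<open>t p i = w\<^sup>p \<otimes> v\<^sub>i\<close> is exactly \<open>rtt\<close> for the matrix \<open>t\<close>
  (\<open>ihom_generators\<close>).  Composing \<open>\<alpha> \<boxtimes> id\<close> with \<open>\<delta>\<close> turns the second description into the
  first one without changing \<open>a\<close>; this gives existence and uniqueness in the universal property,
  and \<open>\<delta>\<close> itself is an arrow because \<open>\<delta>\<close> belongs to the matrix \<open>t\<close>, for which the relations hold by
  \<open>ihom_generators\<close>.

  The same computation of the operator on generators identifies the quadratic algebra: in the
  tensor algebra \<open>rtt\<close> for \<open>t\<close> becomes the defining relation of \<open>A(R:S)\<close>, and the ideal generated by
  the image of a linear map is generated by the images of a basis (\<open>Idl_image\<close>).
\<close>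

section \<open>Linear and bilinear maps on subspaces\<close>

lemma linD:
  assumes "f \<in> lin V W"
  shows "x \<notin> vecs V \<Longrightarrow> f x = 0"
    and "x \<in> vecs V \<Longrightarrow> f x \<in> vecs W"
    and "x \<in> vecs V \<Longrightarrow> y \<in> vecs V \<Longrightarrow> f (x + y) = f x + f y"
    and "x \<in> vecs V \<Longrightarrow> f (scl V c x) = scl W c (f x)"
  using assms by (auto simp: lin_def)

lemma linI:
  assumes "\<And>x. x \<notin> vecs V \<Longrightarrow> f x = 0" "\<And>x. x \<in> vecs V \<Longrightarrow> f x \<in> vecs W"
    "\<And>x y. x \<in> vecs V \<Longrightarrow> y \<in> vecs V \<Longrightarrow> f (x + y) = f x + f y"
    "\<And>c x. x \<in> vecs V \<Longrightarrow> f (scl V c x) = scl W c (f x)"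
  shows "f \<in> lin V W"
  using assms by (auto simp: lin_def)

lemma vspace_simps:
  assumes "is_vspace V"
  shows "scl V c (x + y) = scl V c x + scl V c y" "scl V (a + b) x = scl V a x + scl V b x"
    "scl V a (scl V b x) = scl V (a * b) x" "scl V 1 x = x" "scl V 0 x = 0" "scl V c 0 = 0"
    "scl V c (- x) = - scl V c x" "scl V (- c) x = - scl V c x"
proof -
  interpret vector_space "scl V" by (rule is_vspaceD(1)[OF assms])
  show "scl V c (x + y) = scl V c x + scl V c y" "scl V (a + b) x = scl V a x + scl V b x"
    "scl V a (scl V b x) = scl V (a * b) x" "scl V 1 x = x" "scl V 0 x = 0" "scl V c 0 = 0"
    "scl V c (- x) = - scl V c x" "scl V (- c) x = - scl V c x"
    by (simp_all add: scale_right_distrib scale_left_distrib)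
qed

lemma vspace_scl_sum:
  assumes "is_vspace V"
  shows "scl V c (sum x I) = (\<Sum>i\<in>I. scl V c (x i))"
proof -
  interpret vector_space "scl V" by (rule is_vspaceD(1)[OF assms])
  show ?thesis by (rule scale_sum_right)
qed

lemma vspace_uminus:
  assumes "is_vspace V" "x \<in> vecs V"
  shows "- x \<in> vecs V"
  using is_vspaceD(4)[OF assms, of "- 1"] vspace_simps(4,8)[OF assms(1)] by simp

lemma vspace_sum:
  assumes "is_vspace V" "\<And>i. i \<in> I \<Longrightarrow> x i \<in> vecs V"
  shows "sum x I \<in> vecs V"
  using assms(2) by (induction I rule: infinite_finite_induct) (auto intro: is_vspaceD[OF assms(1)])

lemma vspace_comb:
  assumes "is_vspace V" "\<And>i. i \<in> I \<Longrightarrow> x i \<in> vecs V"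
  shows "(\<Sum>i\<in>I. scl V (c i) (x i)) \<in> vecs V"
  using assms by (intro vspace_sum) (auto intro: is_vspaceD)

lemma lin_zero:
  assumes "is_vspace V" "is_vspace W" "f \<in> lin V W"
  shows "f 0 = 0"
  using linD(4)[OF assms(3) is_vspaceD(2)[OF assms(1)], of 0]
  by (simp add: vspace_simps[OF assms(1)] vspace_simps[OF assms(2)])

lemma lin_sum:
  assumes "is_vspace V" "is_vspace W" "f \<in> lin V W" "\<And>i. i \<in> I \<Longrightarrow> x i \<in> vecs V"
  shows "f (sum x I) = (\<Sum>i\<in>I. f (x i))"
  using assms(4)
proof (induction I rule: infinite_finite_induct)
  case (insert i I)
  then show ?case using linD(3)[OF assms(3)] vspace_sum[OF assms(1), of I x] by simp
qed (auto simp: lin_zero[OF assms(1-3)])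

lemma lin_comb:
  assumes "is_vspace V" "is_vspace W" "f \<in> lin V W" "\<And>i. i \<in> I \<Longrightarrow> x i \<in> vecs V"
  shows "f (\<Sum>i\<in>I. scl V (c i) (x i)) = (\<Sum>i\<in>I. scl W (c i) (f (x i)))"
  using assms by (subst lin_sum[OF assms(1-3)]) (auto intro: is_vspaceD simp: linD(4))

lemma lin_comp:
  assumes "is_vspace V" "is_vspace W" "is_vspace U" "f \<in> lin V W" "g \<in> lin W U"
  shows "g \<circ> f \<in> lin V U"
  using assms by (intro linI) (auto simp: linD lin_zero[OF assms(2,3,5)])

lemma lin_plus:
  assumes "is_vspace W" "f \<in> lin V W" "g \<in> lin V W"
  shows "f + g \<in> lin V W"
  using assms by (intro linI)
    (auto simp: linD[OF assms(2)] linD[OF assms(3)] vspace_simps[OF assms(1)] is_vspaceD algebra_simps)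

lemma lin_uminus:
  assumes "is_vspace W" "f \<in> lin V W"
  shows "- f \<in> lin V W"
  using assms by (intro linI)
    (auto simp: linD[OF assms(2)] vspace_simps[OF assms(1)] vspace_uminus)

lemma lid_lin: "is_vspace V \<Longrightarrow> lid V \<in> lin V V"
  by (intro linI) (auto simp: lid_def is_vspaceD)

lemma bilinD:
  assumes "bilin V W U \<beta>" "v \<in> vecs V" "w \<in> vecs W"
  shows "\<beta> v w \<in> vecs U"
    and "v' \<in> vecs V \<Longrightarrow> \<beta> (v + v') w = \<beta> v w + \<beta> v' w"
    and "w' \<in> vecs W \<Longrightarrow> \<beta> v (w + w') = \<beta> v w + \<beta> v w'"
    and "\<beta> (scl V c v) w = scl U c (\<beta> v w)"
    and "\<beta> v (scl W c w) = scl U c (\<beta> v w)"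
  using assms by (auto simp: bilin_def)

lemma bilinI:
  assumes "\<And>v w. v \<in> vecs V \<Longrightarrow> w \<in> vecs W \<Longrightarrow> \<beta> v w \<in> vecs U"
    and "\<And>v v' w. v \<in> vecs V \<Longrightarrow> v' \<in> vecs V \<Longrightarrow> w \<in> vecs W \<Longrightarrow> \<beta> (v + v') w = \<beta> v w + \<beta> v' w"
    and "\<And>v w w'. v \<in> vecs V \<Longrightarrow> w \<in> vecs W \<Longrightarrow> w' \<in> vecs W \<Longrightarrow> \<beta> v (w + w') = \<beta> v w + \<beta> v w'"
    and "\<And>c v w. v \<in> vecs V \<Longrightarrow> w \<in> vecs W \<Longrightarrow> \<beta> (scl V c v) w = scl U c (\<beta> v w)"
    and "\<And>c v w. v \<in> vecs V \<Longrightarrow> w \<in> vecs W \<Longrightarrow> \<beta> v (scl W c w) = scl U c (\<beta> v w)"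
  shows "bilin V W U \<beta>"
  using assms unfolding bilin_def by blast

lemma bilin_lin_right:
  assumes "bilin V W U \<beta>" "v \<in> vecs V" "is_vspace W"
  shows "(\<lambda>w. if w \<in> vecs W then \<beta> v w else 0) \<in> lin W U"
  using assms by (intro linI) (auto simp: bilinD is_vspaceD)

lemma bilin_lin_left:
  assumes "bilin V W U \<beta>" "w \<in> vecs W" "is_vspace V"
  shows "(\<lambda>v. if v \<in> vecs V then \<beta> v w else 0) \<in> lin V U"
  using assms by (intro linI) (auto simp: bilinD is_vspaceD)

lemma bilin_sum_left:
  assumes "bilin V W U \<beta>" "is_vspace V" "is_vspace U" "w \<in> vecs W" "\<And>i. i \<in> I \<Longrightarrow> x i \<in> vecs V"
  shows "\<beta> (sum x I) w = (\<Sum>i\<in>I. \<beta> (x i) w)"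
  using lin_sum[OF assms(2,3) bilin_lin_left[OF assms(1,4,2)], of I x] assms(5)
    vspace_sum[OF assms(2), of I x] by simp

lemma bilin_sum_right:
  assumes "bilin V W U \<beta>" "is_vspace W" "is_vspace U" "v \<in> vecs V" "\<And>i. i \<in> I \<Longrightarrow> x i \<in> vecs W"
  shows "\<beta> v (sum x I) = (\<Sum>i\<in>I. \<beta> v (x i))"
  using lin_sum[OF assms(2,3) bilin_lin_right[OF assms(1,4,2)], of I x] assms(5)
    vspace_sum[OF assms(2), of I x] by simp

lemma bilin_comb:
  assumes b: "bilin V W U \<beta>" and V: "is_vspace V" and W: "is_vspace W" and U: "is_vspace U"
    and x: "\<And>i. i \<in> I \<Longrightarrow> x i \<in> vecs V" and y: "\<And>j. j \<in> J \<Longrightarrow> y j \<in> vecs W"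
  shows "\<beta> (\<Sum>i\<in>I. scl V (c i) (x i)) (\<Sum>j\<in>J. scl W (d j) (y j)) =
    (\<Sum>i\<in>I. \<Sum>j\<in>J. scl U (c i * d j) (\<beta> (x i) (y j)))"
proof -
  have 1: "scl V (c i) (x i) \<in> vecs V" if "i \<in> I" for i using is_vspaceD(4)[OF V x[OF that]] .
  have 2: "scl W (d j) (y j) \<in> vecs W" if "j \<in> J" for j using is_vspaceD(4)[OF W y[OF that]] .
  show ?thesis
    apply (subst bilin_sum_left[OF b V U vspace_sum[OF W 2] 1], assumption, assumption)
    apply (rule sum.cong[OF refl])
    apply (subst bilin_sum_right[OF b W U 1 2], assumption, assumption)
    apply (rule sum.cong[OF refl])
    apply (simp add: bilinD[OF b] x y 1 2 vspace_simps[OF U] mult.commute)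
    done
qed

section \<open>Coordinate systems\<close>

text \<open>
  A finite basis \<open>e\<close> together with its coordinate functionals \<open>d\<close>.  Carrying the functionals along
  makes the notion pass to tensor products and duals by explicit formulas, and an arbitrary index
  type lets pairs of indices label a basis of a tensor product.
\<close>

definition coords :: "('k::field, 'v::ab_group_add) vspace \<Rightarrow> 'i set \<Rightarrow> ('i \<Rightarrow> 'v) \<Rightarrow> ('i \<Rightarrow> 'v \<Rightarrow> 'k) \<Rightarrow> bool" where
  "coords V I e d \<longleftrightarrow> is_vspace V \<and> finite I \<and> (\<forall>i\<in>I. e i \<in> vecs V \<and> d i \<in> lin V field_space) \<and>
    (\<forall>i\<in>I. \<forall>j\<in>I. d i (e j) = (if i = j then 1 else 0)) \<and>
    (\<forall>x\<in>vecs V. x = (\<Sum>i\<in>I. scl V (d i x) (e i)))"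

lemma coordsI:
  assumes "is_vspace V" "finite I" "\<And>i. i \<in> I \<Longrightarrow> e i \<in> vecs V" "\<And>i. i \<in> I \<Longrightarrow> d i \<in> lin V field_space"
    "\<And>i j. i \<in> I \<Longrightarrow> j \<in> I \<Longrightarrow> d i (e j) = (if i = j then 1 else 0)"
    "\<And>x. x \<in> vecs V \<Longrightarrow> x = (\<Sum>i\<in>I. scl V (d i x) (e i))"
  shows "coords V I e d"
  using assms unfolding coords_def by blast

lemma coordsD:
  assumes "coords V I e d"
  shows "is_vspace V" "finite I" "i \<in> I \<Longrightarrow> e i \<in> vecs V" "i \<in> I \<Longrightarrow> d i \<in> lin V field_space"
    "i \<in> I \<Longrightarrow> j \<in> I \<Longrightarrow> d i (e j) = (if i = j then 1 else 0)"
    "x \<in> vecs V \<Longrightarrow> (\<Sum>i\<in>I. scl V (d i x) (e i)) = x"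
  using assms by (auto simp: coords_def)

lemma is_vspace_field: "is_vspace field_space"
  using vector_space_mult by (auto simp: is_vspace_def field_space_def module_iff_vector_space
    intro!: Modules.module.subspace_UNIV)

lemma field_space_simps [simp]: "scl field_space = (*)" "vecs field_space = UNIV"
  by (simp_all add: field_space_def)

lemma lin_eqI:
  assumes "coords V I e d" "is_vspace W" "f \<in> lin V W" "g \<in> lin V W" "\<And>i. i \<in> I \<Longrightarrow> f (e i) = g (e i)"
  shows "f = g"
proof
  fix x
  note c = coordsD[OF assms(1)]
  show "f x = g x"
  proof (cases "x \<in> vecs V")
    case True
    have "f (\<Sum>i\<in>I. scl V (d i x) (e i)) = g (\<Sum>i\<in>I. scl V (d i x) (e i))"
      using assms(5) by (simp add: lin_comb[OF c(1) assms(2,3)] lin_comb[OF c(1) assms(2,4)] c(3))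
    then show ?thesis using c(6)[OF True] by simp
  qed (use linD(1) assms in metis)
qed

lemma lin_ex:
  assumes "coords V I e d" "is_vspace W" "\<And>i. i \<in> I \<Longrightarrow> u i \<in> vecs W"
  shows "\<exists>f\<in>lin V W. \<forall>i\<in>I. f (e i) = u i"
proof
  note c = coordsD[OF assms(1)]
  let ?f = "\<lambda>x. if x \<in> vecs V then (\<Sum>i\<in>I. scl W (d i x) (u i)) else 0"
  show "?f \<in> lin V W"
    by (intro linI) (auto simp: vspace_comb assms is_vspaceD[OF c(1)] linD(3)[OF c(4)] linD(4)[OF c(4)]
      vspace_simps[OF assms(2)] sum.distrib vspace_scl_sum[OF assms(2)])
  show "\<forall>i\<in>I. ?f (e i) = u i"
  proof
    fix i assume i: "i \<in> I"
    have "(\<Sum>j\<in>I. scl W (d j (e i)) (u j)) = (\<Sum>j\<in>I. if j = i then u j else 0)"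
      using i by (intro sum.cong) (auto simp: c(5) vspace_simps[OF assms(2)])
    then show "?f (e i) = u i" using i c(2,3) by simp
  qed
qed

lemma bilin_eqI:
  assumes "coords V I e d" "coords W J f d'" "is_vspace U" "bilin V W U \<beta>" "bilin V W U \<gamma>"
    "\<And>i j. i \<in> I \<Longrightarrow> j \<in> J \<Longrightarrow> \<beta> (e i) (f j) = \<gamma> (e i) (f j)"
    "x \<in> vecs V" "y \<in> vecs W"
  shows "\<beta> x y = \<gamma> x y"
proof -
  note c = coordsD[OF assms(1)] and c' = coordsD[OF assms(2)]
  have "\<beta> (\<Sum>i\<in>I. scl V (d i x) (e i)) (\<Sum>j\<in>J. scl W (d' j y) (f j)) =
    \<gamma> (\<Sum>i\<in>I. scl V (d i x) (e i)) (\<Sum>j\<in>J. scl W (d' j y) (f j))"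
    using assms(6) by (simp add: bilin_comb[OF assms(4) c(1) c'(1) assms(3)]
      bilin_comb[OF assms(5) c(1) c'(1) assms(3)] c(3) c'(3))
  then show ?thesis using assms c(6) c'(6) by simp
qed

lemma coords_dim: "coords V I e d \<Longrightarrow> fin_dim V"
proof -
  assume a: "coords V I e d"
  note c = coordsD[OF a]
  interpret vector_space "scl V" by (rule is_vspaceD(1)[OF c(1)])
  have s: "subspace (vecs V)" using c(1) by (simp add: is_vspace_def)
  have "span (e ` I) = vecs V"
  proof
    show "span (e ` I) \<subseteq> vecs V" using c(3) s by (intro span_minimal) auto
    show "vecs V \<subseteq> span (e ` I)"
    proof
      fix x assume "x \<in> vecs V"
      then have "x = (\<Sum>i\<in>I. scl V (d i x) (e i))" using c(6) by simp
      also have "\<dots> \<in> span (e ` I)" by (intro span_sum span_scale span_base) auto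
      finally show "x \<in> span (e ` I)" .
    qed
  qed
  then show ?thesis using c(1,2) unfolding fin_dim_def by blast
qed

lemma coords_rep:
  assumes "coords V I e d" "x \<in> vecs V" "i \<in> I"
  shows "Modules.module.representation (scl V) (e ` I) x (e i) = d i x"
proof -
  note c = coordsD[OF assms(1)]
  interpret vector_space "scl V" by (rule is_vspaceD(1)[OF c(1)])
  have inj: "inj_on e I"
  proof (rule inj_onI)
    fix i j assume "i \<in> I" "j \<in> I" "e i = e j"
    then show "i = j" using c(5)[of i i] c(5)[of i j] by (auto split: if_splits)
  qed
  have ind: "independent (e ` I)"
  proof (rule independent_if_scalars_zero)
    show "finite (e ` I)" using c(2) by simp
    fix f y assume s: "(\<Sum>x\<in>e ` I. scl V (f x) x) = 0" and y: "y \<in> e ` I"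
    then obtain j where j: "j \<in> I" "y = e j" by auto
    have "(\<Sum>i\<in>I. scl V (f (e i)) (e i)) = 0" using s by (simp add: sum.reindex[OF inj])
    then have "d j (\<Sum>i\<in>I. scl V (f (e i)) (e i)) = 0"
      using lin_zero[OF c(1) is_vspace_field c(4)[OF j(1)]] by simp
    then have "(\<Sum>i\<in>I. f (e i) * d j (e i)) = 0"
      using lin_comb[OF c(1) is_vspace_field c(4)[OF j(1)], of I e] c(3) by simp
    also have "(\<Sum>i\<in>I. f (e i) * d j (e i)) = (\<Sum>i\<in>I. if i = j then f (e i) else 0)"
      using j by (intro sum.cong) (auto simp: c(5))
    finally show "f y = 0" using j c(2) by simp
  qed
  have "representation (e ` I) x = (\<lambda>b. if b \<in> e ` I then d (inv_into I e b) x else 0)"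
  proof (rule representation_eqI[OF ind])
    show "x \<in> span (e ` I)"
    proof -
      have "x = (\<Sum>i\<in>I. scl V (d i x) (e i))" using c(6) assms by simp
      also have "\<dots> \<in> span (e ` I)" by (intro span_sum span_scale span_base) auto
      finally show "x \<in> span (e ` I)" .
    qed
    show "finite {b. (if b \<in> e ` I then d (inv_into I e b) x else 0) \<noteq> 0}"
      by (rule finite_subset[of _ "e ` I"]) (use c(2) in auto)
    have "(\<Sum>b | (if b \<in> e ` I then d (inv_into I e b) x else 0) \<noteq> 0.
        scl V (if b \<in> e ` I then d (inv_into I e b) x else 0) b) =
      (\<Sum>b\<in>e ` I. scl V (d (inv_into I e b) x) b)"
      using c(2) by (intro sum.mono_neutral_cong_left) (auto split: if_splits)
    also have "\<dots> = (\<Sum>i\<in>I. scl V (d i x) (e i))"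
      by (simp add: sum.reindex[OF inj] inv_into_f_f[OF inj])
    finally show "(\<Sum>b | (if b \<in> e ` I then d (inv_into I e b) x else 0) \<noteq> 0.
        scl V (if b \<in> e ` I then d (inv_into I e b) x else 0) b) = x" using c(6)[OF assms(2)] by simp
  qed (auto split: if_splits)
  then show ?thesis using assms(3) inv_into_f_f[OF inj] by simp
qed

lemma coords_independent:
  assumes V: "is_vspace V" and "finite I" "inj_on e I" and ind: "\<not> Modules.module.dependent (scl V) (e ` I)"
    and span: "Modules.module.span (scl V) (e ` I) = vecs V"
  shows "coords V I e (\<lambda>i x. Modules.module.representation (scl V) (e ` I) x (e i))"
proof -
  interpret vector_space "scl V" by (rule is_vspaceD(1)[OF V])
  have e: "e i \<in> vecs V" if "i \<in> I" for i using that span by (auto intro: span_base)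
  have "(\<Sum>i\<in>I. scl V (representation (e ` I) x (e i)) (e i)) = x" if "x \<in> vecs V" for x
  proof -
    have "(\<Sum>i\<in>I. scl V (representation (e ` I) x (e i)) (e i)) =
      (\<Sum>b\<in>e ` I. scl V (representation (e ` I) x b) b)" by (simp add: sum.reindex[OF assms(3)])
    also have "\<dots> = x"
      using sum_representation_eq[OF ind _ finite_imageI[OF assms(2)] subset_refl] that span by simp
    finally show ?thesis .
  qed
  moreover have "(\<lambda>x. representation (e ` I) x (e i)) \<in> lin V field_space" for i
  proof (rule linI)
    fix x assume "x \<notin> vecs V"
    then show "representation (e ` I) x (e i) = 0" by (simp add: representation_def span)
  qed (simp_all add: representation_add[OF ind] representation_scale[OF ind] span)
  moreover have "representation (e ` I) (e j) (e i) = (if i = j then 1 else 0)" if "i \<in> I" "j \<in> I" for i j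
    using that assms(3) representation_basis[OF ind, of "e j"] by (auto dest: inj_onD)
  ultimately show ?thesis using assms e by (simp add: coords_def)
qed

lemma coords_basis: "is_vspace V \<Longrightarrow> is_basis V n v \<Longrightarrow> coords V {1..n} v (dual_basis V n v)"
  using coords_independent[of V "{1..n}" v] by (simp add: is_basis_def dual_basis_def[abs_def])

lemma coords_exists:
  fixes V :: "('k::field, 'v::ab_group_add) vspace"
  assumes "fin_dim V"
  shows "\<exists>(I :: 'v set) d. coords V I (\<lambda>x. x) d"
proof -
  have V: "is_vspace V" using assms by (simp add: fin_dim_def)
  interpret vector_space "scl V" by (rule is_vspaceD(1)[OF V])
  obtain B where B: "finite B" "span B = vecs V" using assms by (auto simp: fin_dim_def)
  obtain C where C: "C \<subseteq> B" "independent C" "B \<subseteq> span C" using maximal_independent_subset by blast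
  have "span C = vecs V"
    using C B(2) by (metis span_mono span_span subset_antisym)
  moreover have "finite C" using C(1) B(1) finite_subset by blast
  ultimately have "coords V C (\<lambda>x. x) (\<lambda>i x. representation ((\<lambda>x. x) ` C) x i)"
    using C(2) by (intro coords_independent[OF V]) auto
  then show ?thesis by blast
qed

section \<open>Tensor products and duals in coordinates\<close>

lemma scl_simps [simp]: "scl (tensor V W) = ptw" "scl (dual V) = ptw" "scl (talg_space V) = ptw"
  by (simp_all add: tensor_def dual_def talg_space_def)

text \<open>
  The instances for iterated tensor products and duals are listed separately, because there the
  scalar multiplication has already been rewritten to \<^const>\<open>ptw\<close> when the simplifier meets it.
\<close>

lemmas tensD0 = bilinD[OF bilin_tens, unfolded scl_simps]

lemmas tensD = tensD0 tensD0(4)[of _ "tensor A B" for A B, simplified] tensD0(5)[of _ _ _ "tensor A B" for A B, simplified]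
  tensD0(4)[of _ "dual A" for A, simplified] tensD0(5)[of _ _ _ "dual A" for A, simplified]

lemma bilin_coords:
  assumes V: "coords V I e d" and W: "coords W J f d'" and "is_vspace U" "bilin V W U \<beta>"
    and "x \<in> vecs V" "y \<in> vecs W"
  shows "\<beta> x y = (\<Sum>i\<in>I. \<Sum>j\<in>J. scl U (d i x * d' j y) (\<beta> (e i) (f j)))"
  using bilin_comb[OF assms(4) coordsD(1)[OF V] coordsD(1)[OF W] assms(3), of I e J f "\<lambda>i. d i x" "\<lambda>j. d' j y"]
    coordsD(3)[OF V] coordsD(3)[OF W] coordsD(6)[OF V assms(5)] coordsD(6)[OF W assms(6)] by simp

lemma tensor_induct [consumes 1, case_names zero step]:
  fixes V :: "('k::field, 'v::ab_group_add) vspace" and W :: "('k, 'w::ab_group_add) vspace"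
  assumes "t \<in> vecs (tensor V W)" "P 0"
    and "\<And>c v w y. v \<in> vecs V \<Longrightarrow> w \<in> vecs W \<Longrightarrow> y \<in> vecs (tensor V W) \<Longrightarrow> P y \<Longrightarrow>
      P (ptw c (tens V W v w) + y)"
  shows "P t"
proof -
  interpret vector_space "ptw :: 'k \<Rightarrow> (('v \<Rightarrow> 'w \<Rightarrow> 'k) \<Rightarrow> 'k) \<Rightarrow> ('v \<Rightarrow> 'w \<Rightarrow> 'k) \<Rightarrow> 'k"
    by (rule vector_space_ptw)
  let ?S = "{tens V W v w | v w. v \<in> vecs V \<and> w \<in> vecs W}"
  have "t \<in> span ?S" using assms(1) by (simp add: tensor_def)
  then have "t \<in> span ?S \<and> P t"
  proof (induction rule: span_induct_alt)
    case base
    then show ?case using assms(2) span_zero by blast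
  next
    case (step c x y)
    then have "ptw c x + y \<in> span ?S" by (blast intro: span_add span_scale span_base)
    then show ?case using step assms(3) by (auto simp: tensor_def simp del: plus_fun_apply zero_fun_apply)
  qed
  then show ?thesis by simp
qed

lemma tensor_lin_eqI:
  assumes "is_vspace U" "f \<in> lin (tensor V W) U" "g \<in> lin (tensor V W) U"
    "\<And>v w. v \<in> vecs V \<Longrightarrow> w \<in> vecs W \<Longrightarrow> f (tens V W v w) = g (tens V W v w)"
  shows "f = g"
proof
  fix t
  note T = is_vspace_tensor[of V W]
  show "f t = g t"
  proof (cases "t \<in> vecs (tensor V W)")
    case True
    then show ?thesis
    proof (induction rule: tensor_induct)
      case zero
      show ?case by (simp only: lin_zero[OF T assms(1,2)] lin_zero[OF T assms(1,3)])
    next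
      case (step c v w y)
      then show ?case
        using is_vspaceD(4)[OF T tensD(1)[OF step(1,2)], of c]
          linD(4)[OF assms(2) tensD(1)[OF step(1,2)], of c] linD(4)[OF assms(3) tensD(1)[OF step(1,2)], of c]
        by (simp add: linD(3)[OF assms(2)] linD(3)[OF assms(3)] assms(4) del: plus_fun_apply)
    qed
  qed (simp add: linD(1)[OF assms(2)] linD(1)[OF assms(3)])
qed

lemma tensor_eval:
  assumes "t \<in> vecs (tensor V W)"
  shows "bilin V W field_space f \<Longrightarrow> bilin V W field_space g \<Longrightarrow> t (\<lambda>v w. f v w + g v w) = t f + t g"
    and "bilin V W field_space f \<Longrightarrow> t (\<lambda>v w. c * f v w) = c * t f"
proof -
  have a: "bilin V W field_space f \<Longrightarrow> bilin V W field_space g \<Longrightarrow> bilin V W field_space (\<lambda>v w. f v w + g v w)"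
    and b: "bilin V W field_space f \<Longrightarrow> bilin V W field_space (\<lambda>v w. c * f v w)"
    by (simp_all add: bilin_def algebra_simps)
  show "t (\<lambda>v w. f v w + g v w) = t f + t g" if "bilin V W field_space f" "bilin V W field_space g"
    using assms a[OF that] that
    by (induction rule: tensor_induct) (simp_all add: tens_def ptw_def algebra_simps)
  show "t (\<lambda>v w. c * f v w) = c * t f" if "bilin V W field_space f"
    using assms b[OF that] that
    by (induction rule: tensor_induct) (simp_all add: tens_def ptw_def algebra_simps)
qed

text \<open>
  A tensor is a function on bilinear forms, so its coordinate at \<open>(i, j)\<close> is simply its value at the
  form \<open>d\<^sub>i \<cdot> d'\<^sub>j\<close>.  That these coordinates reproduce the tensor needs to be checked on simple tensors only.
\<close>

lemma coords_tensor:
  fixes V :: "('k::field, 'v::ab_group_add) vspace" and W :: "('k, 'w::ab_group_add) vspace"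
  assumes V: "coords V I e d" and W: "coords W J f d'"
  shows "coords (tensor V W) (I \<times> J) (\<lambda>(i, j). tens V W (e i) (f j))
    (\<lambda>(i, j) t. if t \<in> vecs (tensor V W) then t (\<lambda>v w. d i v * d' j w) else 0)"
proof -
  note c = coordsD[OF V] and c' = coordsD[OF W]
  note T = is_vspace_tensor[of V W]
  have b: "bilin V W field_space (\<lambda>v w. d i v * d' j w)" if "i \<in> I" "j \<in> J" for i j
    using linD(3,4)[OF c(4)[OF that(1)]] linD(3,4)[OF c'(4)[OF that(2)]]
    by (simp add: bilin_def algebra_simps)
  have ev: "tens V W x y (\<lambda>v w. d i v * d' j w) = d i x * d' j y" if "i \<in> I" "j \<in> J" for i j x y
    using b[OF that] by (simp add: tens_def)
  have "t = (\<Sum>(i, j)\<in>I \<times> J. ptw (t (\<lambda>v w. d i v * d' j w)) (tens V W (e i) (f j)))"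
    if "t \<in> vecs (tensor V W)" for t
    using that
  proof (induction rule: tensor_induct)
    case zero
    have "ptw (0 :: 'k) z = 0" for z :: "('v \<Rightarrow> 'w \<Rightarrow> 'k) \<Rightarrow> 'k" by (simp add: ptw_def fun_eq_iff)
    then show ?case by (simp add: case_prod_unfold)
  next
    case (step s x y t)
    have "tens V W x y = (\<Sum>(i, j)\<in>I \<times> J. ptw (d i x * d' j y) (tens V W (e i) (f j)))"
      using bilin_coords[OF V W T bilin_tens step(1,2)] by (simp add: sum.cartesian_product)
    then have "ptw s (tens V W x y) = (\<Sum>(i, j)\<in>I \<times> J. ptw (s * (d i x * d' j y)) (tens V W (e i) (f j)))"
      by (simp add: case_prod_unfold vspace_scl_sum[OF T, simplified] vspace_simps(3)[OF T, simplified])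
    then have "ptw s (tens V W x y) + t = (\<Sum>(i, j)\<in>I \<times> J. ptw (s * (d i x * d' j y)) (tens V W (e i) (f j)))
      + (\<Sum>(i, j)\<in>I \<times> J. ptw (t (\<lambda>v w. d i v * d' j w)) (tens V W (e i) (f j)))"
      by (rule arg_cong2[OF _ step(4), where f = "(+)"])
    also have "\<dots> = (\<Sum>(i, j)\<in>I \<times> J. ptw (s * (d i x * d' j y) + t (\<lambda>v w. d i v * d' j w)) (tens V W (e i) (f j)))"
      using vspace_simps(2)[OF T] by (simp add: sum.distrib case_prod_unfold)
    also have "\<dots> = (\<Sum>(i, j)\<in>I \<times> J. ptw ((ptw s (tens V W x y) + t) (\<lambda>v w. d i v * d' j w)) (tens V W (e i) (f j)))"
      by (rule sum.cong) (auto simp: ev ptw_def)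
    finally show ?case .
  qed
  note expand = this
  have lin: "(\<lambda>t. if t \<in> vecs (tensor V W) then t b else 0) \<in> lin (tensor V W) field_space" for b
    using is_vspaceD(3,4)[OF T] by (intro linI) (auto simp: ptw_def)
  show ?thesis
  proof (rule coordsI)
    fix t assume "t \<in> vecs (tensor V W)"
    with expand[OF this] show "t = (\<Sum>p\<in>I \<times> J. scl (tensor V W)
        ((case p of (i, j) \<Rightarrow> \<lambda>t. if t \<in> vecs (tensor V W) then t (\<lambda>v w. d i v * d' j w) else 0) t)
        (case p of (i, j) \<Rightarrow> tens V W (e i) (f j)))"
      by (simp add: case_prod_unfold)
  qed (use c(2) c'(2) in \<open>auto simp: T lin tensD(1) ev c(3,5) c'(3,5) split: if_splits\<close>)
qed

lemma sum_fun: "sum f A x = (\<Sum>i\<in>A. f i x)" for f :: "'a \<Rightarrow> 'b \<Rightarrow> 'c::comm_monoid_add"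
  by (induction A rule: infinite_finite_induct) auto

lemma is_vspace_dual:
  fixes V :: "('k::field, 'v::ab_group_add) vspace"
  assumes "is_vspace V"
  shows "is_vspace (dual V)"
proof -
  interpret vector_space "ptw :: 'k \<Rightarrow> ('v \<Rightarrow> 'k) \<Rightarrow> 'v \<Rightarrow> 'k"
    by (rule vector_space_ptw)
  show ?thesis
    by (auto simp: is_vspace_def vector_space_ptw dual_def subspace_def ptw_def lin_def algebra_simps)
qed

lemma coords_dual:
  assumes "coords V I e d"
  shows "coords (dual V) I d (\<lambda>i \<xi>. if \<xi> \<in> vecs (dual V) then \<xi> (e i) else 0)"
proof -
  note c = coordsD[OF assms]
  note D = is_vspace_dual[OF c(1)]
  have v: "vecs (dual V) = lin V field_space" by (simp add: dual_def)
  have "\<xi> = (\<Sum>i\<in>I. ptw (\<xi> (e i)) (d i))" if "\<xi> \<in> lin V field_space" for \<xi>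
  proof (rule lin_eqI[OF assms is_vspace_field that])
    show "(\<Sum>i\<in>I. ptw (\<xi> (e i)) (d i)) \<in> lin V field_space"
      using vspace_comb[OF D, of I d] c(4) v by simp
    fix j assume j: "j \<in> I"
    have "(\<Sum>i\<in>I. ptw (\<xi> (e i)) (d i)) (e j) = (\<Sum>i\<in>I. if i = j then \<xi> (e i) else 0)"
      using j by (simp add: sum_fun ptw_def c(5)) (intro sum.cong, auto)
    then show "\<xi> (e j) = (\<Sum>i\<in>I. ptw (\<xi> (e i)) (d i)) (e j)" using j c(2) by simp
  qed
  moreover have "(\<lambda>\<xi>. if \<xi> \<in> vecs (dual V) then \<xi> x else 0) \<in> lin (dual V) field_space" for x
    using is_vspaceD(3,4)[OF D] by (intro linI) (auto simp: ptw_def)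
  ultimately show ?thesis unfolding coords_def using c D by (auto simp: v)
qed

lemma tlift:
  assumes "is_vspace U" "bilin V W U \<beta>"
  shows tlift_lin: "tlift V W U \<beta> \<in> lin (tensor V W) U"
    and tlift_tens: "v \<in> vecs V \<Longrightarrow> w \<in> vecs W \<Longrightarrow> tlift V W U \<beta> (tens V W v w) = \<beta> v w"
  using theI'[OF tensor_universal[OF assms]] by (auto simp: tlift_def)

lemma bilin_args:
  assumes "bilin V' W' U \<beta>" "f \<in> lin V V'" "g \<in> lin W W'"
  shows "bilin V W U (\<lambda>v w. \<beta> (f v) (g w))"
  using assms(2,3) by (intro bilinI) (simp_all add: bilinD[OF assms(1)] linD)

lemma bilin_out:
  assumes "bilin V W U \<beta>" "f \<in> lin U X"
  shows "bilin V W X (\<lambda>v w. f (\<beta> v w))"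
  using assms by (intro bilinI) (simp_all add: bilinD[OF assms(1)] linD)

lemma tmap:
  assumes "f \<in> lin V V'" "g \<in> lin W W'"
  shows tmap_lin: "tmap V W V' W' f g \<in> lin (tensor V W) (tensor V' W')"
    and tmap_tens: "v \<in> vecs V \<Longrightarrow> w \<in> vecs W \<Longrightarrow> tmap V W V' W' f g (tens V W v w) = tens V' W' (f v) (g w)"
  unfolding tmap_def
  using tlift[OF is_vspace_tensor bilin_args[OF bilin_tens assms]] by auto

section \<open>Interchanging the middle factors\<close>

text \<open>
  The map is prescribed on the basis vectors of the fourfold product.  It has the right value on
  all simple tensors since both sides are bilinear in the outer pair \<open>(a, c)\<close> for basis vectors
  \<open>b, d\<close>, and then bilinear in \<open>(b, d)\<close> for arbitrary \<open>a, c\<close>.  The four spaces are independent so that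
  the map and its inverse are two instances of the same statement.
\<close>

lemma middle_swap_exists:
  assumes A: "fin_dim A" and B: "fin_dim B" and C: "fin_dim C" and D: "fin_dim D"
  shows "\<exists>f\<in>lin (tensor (tensor A B) (tensor C D)) (tensor (tensor A C) (tensor B D)).
    \<forall>a\<in>vecs A. \<forall>b\<in>vecs B. \<forall>c\<in>vecs C. \<forall>d\<in>vecs D.
      f (tens (tensor A B) (tensor C D) (tens A B a b) (tens C D c d)) =
        tens (tensor A C) (tensor B D) (tens A C a c) (tens B D b d)"
proof -
  obtain I a' where a: "coords A I (\<lambda>x. x) a'" using coords_exists[OF A] by blast
  obtain J b' where b: "coords B J (\<lambda>x. x) b'" using coords_exists[OF B] by blast
  obtain K c' where c: "coords C K (\<lambda>x. x) c'" using coords_exists[OF C] by blast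
  obtain L d' where d: "coords D L (\<lambda>x. x) d'" using coords_exists[OF D] by blast
  note ca = coordsD[OF a] and cb = coordsD[OF b] and cc = coordsD[OF c] and cd = coordsD[OF d]
  let ?E = "tensor (tensor A B) (tensor C D)" and ?F = "tensor (tensor A C) (tensor B D)"
  let ?e = "\<lambda>a b c d. tens (tensor A B) (tensor C D) (tens A B a b) (tens C D c d)"
  let ?g = "\<lambda>a b c d. tens (tensor A C) (tensor B D) (tens A C a c) (tens B D b d)"
  have "\<exists>f\<in>lin ?E ?F. \<forall>i\<in>(I \<times> J) \<times> (K \<times> L).
      f ((\<lambda>(p, q). tens (tensor A B) (tensor C D) ((\<lambda>(a, b). tens A B a b) p) ((\<lambda>(c, d). tens C D c d) q)) i) =
        (\<lambda>((a, b), (c, d)). ?g a b c d) i"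
    by (rule lin_ex[OF coords_tensor[OF coords_tensor[OF a b] coords_tensor[OF c d]] is_vspace_tensor])
      (auto simp: tensD(1) ca(3) cb(3) cc(3) cd(3))
  then obtain f where f1: "f \<in> lin ?E ?F" and f0: "\<forall>i\<in>(I \<times> J) \<times> (K \<times> L).
      f ((\<lambda>(p, q). tens (tensor A B) (tensor C D) ((\<lambda>(a, b). tens A B a b) p) ((\<lambda>(c, d). tens C D c d) q)) i) =
        (\<lambda>((a, b), (c, d)). ?g a b c d) i" by (rule bexE)
  have f2: "f (?e a b c d) = ?g a b c d" if "a \<in> I" "b \<in> J" "c \<in> K" "d \<in> L" for a b c d
    using f0[rule_format, of "((a, b), (c, d))"] that by simp
  note f = f1 f2
  have F: "is_vspace ?F" by (rule is_vspace_tensor)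
  have 1: "f (?e x b y d) = ?g x b y d" if "b \<in> J" "d \<in> L" "x \<in> vecs A" "y \<in> vecs C" for x y b d
  proof (rule bilin_eqI[OF a c F _ _ _ that(3,4), where \<beta> = "\<lambda>x y. f (?e x b y d)"])
    show "bilin A C ?F (\<lambda>x y. f (?e x b y d))"
      using that cb(3) cd(3) by (intro bilin_out[OF _ f(1)] bilinI) (simp_all add: tensD)
    show "bilin A C ?F (\<lambda>x y. ?g x b y d)"
      using that cb(3) cd(3) by (intro bilinI) (simp_all add: tensD)
  qed (use f(2) that in auto)
  have 2: "f (?e x z y w) = ?g x z y w" if "x \<in> vecs A" "y \<in> vecs C" "z \<in> vecs B" "w \<in> vecs D" for x y z w
  proof (rule bilin_eqI[OF b d F _ _ _ that(3,4), where \<beta> = "\<lambda>z w. f (?e x z y w)"])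
    show "bilin B D ?F (\<lambda>z w. f (?e x z y w))"
      using that by (intro bilin_out[OF _ f(1)] bilinI) (simp_all add: tensD)
    show "bilin B D ?F (\<lambda>z w. ?g x z y w)"
      using that by (intro bilinI) (simp_all add: tensD)
  qed (use 1 that in auto)
  show ?thesis using f(1) 2 by blast
qed

lemma tensor4_lin_eqI:
  assumes A: "fin_dim A" and B: "fin_dim B" and C: "fin_dim C" and D: "fin_dim D" and U: "is_vspace U"
    and f: "f \<in> lin (tensor (tensor A B) (tensor C D)) U" and g: "g \<in> lin (tensor (tensor A B) (tensor C D)) U"
    and fg: "\<And>a b c d. a \<in> vecs A \<Longrightarrow> b \<in> vecs B \<Longrightarrow> c \<in> vecs C \<Longrightarrow> d \<in> vecs D \<Longrightarrow>
      f (tens (tensor A B) (tensor C D) (tens A B a b) (tens C D c d)) =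
      g (tens (tensor A B) (tensor C D) (tens A B a b) (tens C D c d))"
  shows "f = g"
proof -
  obtain I a' where a: "coords A I (\<lambda>x. x) a'" using coords_exists[OF A] by blast
  obtain J b' where b: "coords B J (\<lambda>x. x) b'" using coords_exists[OF B] by blast
  obtain K c' where c: "coords C K (\<lambda>x. x) c'" using coords_exists[OF C] by blast
  obtain L d' where d: "coords D L (\<lambda>x. x) d'" using coords_exists[OF D] by blast
  note ca = coordsD[OF a] and cb = coordsD[OF b] and cc = coordsD[OF c] and cd = coordsD[OF d]
  show ?thesis
    by (rule lin_eqI[OF coords_tensor[OF coords_tensor[OF a b] coords_tensor[OF c d]] U f g])
      (use fg ca(3) cb(3) cc(3) cd(3) in auto)
qed

lemma shuffle:
  assumes V: "fin_dim V" and W: "fin_dim W"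
  shows shuffle_lin: "shuffle V W \<in> lin (tensor (tensor V W) (tensor V W)) (tensor (tensor V V) (tensor W W))"
    and shuffle_tens: "v \<in> vecs V \<Longrightarrow> w \<in> vecs W \<Longrightarrow> v' \<in> vecs V \<Longrightarrow> w' \<in> vecs W \<Longrightarrow>
      shuffle V W (tens (tensor V W) (tensor V W) (tens V W v w) (tens V W v' w')) =
        tens (tensor V V) (tensor W W) (tens V V v v') (tens W W w w')"
proof -
  let ?P = "\<lambda>f. f \<in> lin (tensor (tensor V W) (tensor V W)) (tensor (tensor V V) (tensor W W)) \<and>
        (\<forall>v\<in>vecs V. \<forall>w\<in>vecs W. \<forall>v'\<in>vecs V. \<forall>w'\<in>vecs W.
           f (tens (tensor V W) (tensor V W) (tens V W v w) (tens V W v' w')) =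
             tens (tensor V V) (tensor W W) (tens V V v v') (tens W W w w'))"
  have "\<exists>!f. ?P f"
  proof (rule ex_ex1I)
    show "\<exists>f. ?P f" using middle_swap_exists[OF V W V W] by blast
    fix f g assume "?P f" "?P g"
    then show "f = g" by (intro tensor4_lin_eqI[OF V W V W is_vspace_tensor]) auto
  qed
  from theI'[OF this] show "shuffle V W \<in> lin (tensor (tensor V W) (tensor V W)) (tensor (tensor V V) (tensor W W))"
    and "v \<in> vecs V \<Longrightarrow> w \<in> vecs W \<Longrightarrow> v' \<in> vecs V \<Longrightarrow> w' \<in> vecs W \<Longrightarrow>
      shuffle V W (tens (tensor V W) (tensor V W) (tens V W v w) (tens V W v' w')) =
        tens (tensor V V) (tensor W W) (tens V V v v') (tens W W w w')"
    by (simp_all add: shuffle_def)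
qed

lemmas is_vspace_simps [simp] = is_vspace_tensor is_vspace_talg is_vspace_field is_vspace_dual

lemma ptw_simps:
  "ptw c (x + y) = ptw c x + ptw c y" "ptw (a + b) x = ptw a x + ptw b x" "ptw a (ptw b x) = ptw (a * b) x"
  "ptw 1 x = x" "ptw 0 x = 0" "ptw c (0 :: 'a \<Rightarrow> 'k::field) = 0" "ptw c (- x) = - ptw c x"
  "ptw c (x - y) = ptw c x - ptw c y"
  "ptw c (sum f I) = (\<Sum>i\<in>I. ptw c (f i))"
  by (auto simp: ptw_def fun_eq_iff algebra_simps sum_fun sum_distrib_left)

text \<open>
  The inverse image used in \<^const>\<open>box\<close>, normalised to be \<open>0\<close> off the target so that it is an
  element of \<^const>\<open>lin\<close>.
\<close>

definition unshuffle :: "('k::field, 'v::ab_group_add) vspace \<Rightarrow> ('k, 'w::ab_group_add) vspace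
    \<Rightarrow> ('k, ('k, 'v, 'v) tens, ('k, 'w, 'w) tens) tens
    \<Rightarrow> ('k, ('k, 'v, 'w) tens, ('k, 'v, 'w) tens) tens" where
  "unshuffle V W y = (if y \<in> vecs (tensor (tensor V V) (tensor W W))
    then inv_into (vecs (tensor (tensor V W) (tensor V W))) (shuffle V W) y else 0)"

text \<open>
  The preimage of \<open>x \<otimes> y\<close> under the interchange of factors, for tensors \<open>x\<close> and \<open>y\<close> of degree 2 over
  \<open>V\<close> and \<open>W\<close>.  In terms of it the operator of a product obeys a Leibniz rule, \<open>box_weave\<close>.
\<close>

definition weave :: "('k::field, 'v::ab_group_add) vspace \<Rightarrow> ('k, 'w::ab_group_add) vspace
    \<Rightarrow> ('k, 'v, 'v) tens \<Rightarrow> ('k, 'w, 'w) tens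
    \<Rightarrow> ('k, ('k, 'v, 'w) tens, ('k, 'v, 'w) tens) tens" where
  "weave V W x y = unshuffle V W (tens (tensor V V) (tensor W W) x y)"

text \<open>
  The interchange \<open>V, V, W, W\<close> to \<open>V, W, V, W\<close> is inverse to \<^const>\<open>shuffle\<close>, as both composites fix the
  simple tensors; hence the inverse image is a value of a linear map.
\<close>

lemma unshuffle:
  assumes V: "fin_dim V" and W: "fin_dim W"
  shows unshuffle_lin: "unshuffle V W \<in> lin (tensor (tensor V V) (tensor W W)) (tensor (tensor V W) (tensor V W))"
    and shuffle_unshuffle: "y \<in> vecs (tensor (tensor V V) (tensor W W)) \<Longrightarrow> shuffle V W (unshuffle V W y) = y"
    and unshuffle_shuffle: "x \<in> vecs (tensor (tensor V W) (tensor V W)) \<Longrightarrow> unshuffle V W (shuffle V W x) = x"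
proof -
  let ?X = "tensor (tensor V W) (tensor V W)" and ?Y = "tensor (tensor V V) (tensor W W)"
  note s = shuffle_lin[OF V W]
  obtain g where g: "g \<in> lin ?Y ?X" and g_tens: "\<forall>a\<in>vecs V. \<forall>b\<in>vecs V. \<forall>c\<in>vecs W. \<forall>d\<in>vecs W.
      g (tens (tensor V V) (tensor W W) (tens V V a b) (tens W W c d)) =
        tens (tensor V W) (tensor V W) (tens V W a c) (tens V W b d)"
    using middle_swap_exists[OF V V W W] by blast
  have "g \<circ> shuffle V W = lid ?X"
    by (rule tensor4_lin_eqI[OF V W V W is_vspace_tensor lin_comp[OF _ _ _ s g] lid_lin])
      (auto simp: g_tens shuffle_tens[OF V W] lid_def tensD(1))
  then have gs: "g (shuffle V W x) = x" if "x \<in> vecs ?X" for x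
    using that by (simp add: fun_eq_iff lid_def)
  have "shuffle V W \<circ> g = lid ?Y"
    by (rule tensor4_lin_eqI[OF V V W W is_vspace_tensor lin_comp[OF _ _ _ g s] lid_lin])
      (auto simp: g_tens shuffle_tens[OF V W] lid_def tensD(1))
  then have sg: "shuffle V W (g y) = y" if "y \<in> vecs ?Y" for y
    using that by (simp add: fun_eq_iff lid_def)
  have inj: "inj_on (shuffle V W) (vecs ?X)" by (rule inj_on_inverseI[where g = g]) (rule gs)
  have "unshuffle V W y = g y" for y
  proof (cases "y \<in> vecs ?Y")
    case True
    then show ?thesis
      using inv_into_f_f[OF inj linD(2)[OF g True]] by (simp add: unshuffle_def sg)
  qed (simp add: unshuffle_def linD(1)[OF g])
  then have "unshuffle V W = g" by blast
  then show "unshuffle V W \<in> lin ?Y ?X"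
    and "y \<in> vecs ?Y \<Longrightarrow> shuffle V W (unshuffle V W y) = y"
    and "x \<in> vecs ?X \<Longrightarrow> unshuffle V W (shuffle V W x) = x"
    using g gs sg by auto
qed

lemma bilin_weave:
  assumes "fin_dim V" "fin_dim W"
  shows "bilin (tensor V V) (tensor W W) (tensor (tensor V W) (tensor V W)) (weave V W)"
  using bilin_out[OF bilin_tens unshuffle_lin[OF assms]] by (simp add: weave_def[abs_def])

lemma weave_tens:
  assumes "fin_dim V" "fin_dim W" "v \<in> vecs V" "v' \<in> vecs V" "w \<in> vecs W" "w' \<in> vecs W"
  shows "weave V W (tens V V v v') (tens W W w w') = tens (tensor V W) (tensor V W) (tens V W v w) (tens V W v' w')"
  using unshuffle_shuffle[OF assms(1,2), of "tens (tensor V W) (tensor V W) (tens V W v w) (tens V W v' w')"]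
  by (simp add: weave_def shuffle_tens assms tensD(1))

text \<open>
  By the first equation the inverse image is only ever taken at points of the target, so the
  operator of \<^const>\<open>box\<close> is a composite of linear maps.
\<close>

lemma box_eq:
  assumes V: "fin_dim V" and W: "fin_dim W"
    and R: "R \<in> lin (tensor V V) (tensor V V)" and S: "S \<in> lin (tensor W W) (tensor W W)"
  shows "snd (box (V, R) (W, S)) = unshuffle V W \<circ>
      (tmap (tensor V V) (tensor W W) (tensor V V) (tensor W W) R (lid (tensor W W)) +
       tmap (tensor V V) (tensor W W) (tensor V V) (tensor W W) (lid (tensor V V)) S) \<circ> shuffle V W"
    (is "_ = unshuffle V W \<circ> ?T \<circ> _")
    and box_lin: "snd (box (V, R) (W, S)) \<in> lin (tensor (tensor V W) (tensor V W)) (tensor (tensor V W) (tensor V W))"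
    and box_weave: "x \<in> vecs (tensor V V) \<Longrightarrow> y \<in> vecs (tensor W W) \<Longrightarrow>
      snd (box (V, R) (W, S)) (weave V W x y) = weave V W (R x) y + weave V W x (S y)"
proof -
  let ?X = "tensor (tensor V W) (tensor V W)" and ?Y = "tensor (tensor V V) (tensor W W)"
  have T: "?T \<in> lin ?Y ?Y"
    by (intro lin_plus tmap_lin is_vspace_tensor R S lid_lin)
  have "?T (shuffle V W t) \<in> vecs ?Y" for t
    using linD(1,2)[OF shuffle_lin[OF V W], of t] linD(2)[OF T] lin_zero[OF _ _ T] is_vspaceD(2)[OF is_vspace_tensor]
    by (metis is_vspace_tensor)
  then show 1: "snd (box (V, R) (W, S)) = unshuffle V W \<circ> ?T \<circ> shuffle V W"
    by (auto simp: box_def fun_eq_iff unshuffle_def)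
  show "snd (box (V, R) (W, S)) \<in> lin ?X ?X"
    unfolding 1 by (intro lin_comp[OF _ _ _ shuffle_lin[OF V W]] lin_comp[OF _ _ _ T] unshuffle_lin V W is_vspace_tensor)
  assume x: "x \<in> vecs (tensor V V)" and y: "y \<in> vecs (tensor W W)"
  have "?T (tens (tensor V V) (tensor W W) x y) = tens (tensor V V) (tensor W W) (R x) y + tens (tensor V V) (tensor W W) x (S y)"
    using tmap_tens[OF R lid_lin[of "tensor W W"] x y] tmap_tens[OF lid_lin[of "tensor V V"] S x y] x y
    by (simp add: lid_def[of "tensor V V" x] lid_def[of "tensor W W" y])
  then show "snd (box (V, R) (W, S)) (weave V W x y) = weave V W (R x) y + weave V W x (S y)"
    using x y linD(2)[OF R x] linD(2)[OF S y] unfolding 1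
    by (simp add: weave_def shuffle_unshuffle[OF V W] tensD(1) linD(3)[OF unshuffle_lin[OF V W]] del: plus_fun_apply)
qed

lemma tensor_cong:
  assumes "t \<in> vecs (tensor V W)" "is_vspace V" "is_vspace W"
    "\<And>v w. v \<in> vecs V \<Longrightarrow> w \<in> vecs W \<Longrightarrow> f v w = g v w"
  shows "t f = t g"
  using assms(1)
proof (induction rule: tensor_induct)
  case (step c v w y)
  have "bilin V W field_space f \<longleftrightarrow> bilin V W field_space g"
    using assms(4) by (simp add: bilin_def is_vspaceD[OF assms(2)] is_vspaceD[OF assms(3)])
  then show ?case using step assms(4) by (simp add: tens_def ptw_def)
qed simp

section \<open>The transposed operator in coordinates\<close>

lemma bilin_arg_left:
  assumes "bilin V' W U \<beta>" "f \<in> lin V V'"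
  shows "bilin V W U (\<lambda>v w. \<beta> (f v) w)"
  using assms(2) by (intro bilinI) (simp_all add: bilinD[OF assms(1)] linD)

lemma bilin_arg_right:
  assumes "bilin V W' U \<beta>" "g \<in> lin W W'"
  shows "bilin V W U (\<lambda>v w. \<beta> v (g w))"
  using assms(2) by (intro bilinI) (simp_all add: bilinD[OF assms(1)] linD)

lemma bilin_pairing:
  fixes V :: "('k::field, 'v::ab_group_add) vspace"
  shows "bilin (tensor (dual V) (dual V)) (tensor V V) field_space pairing"
proof -
  have v: "vecs (dual V) = lin V field_space" by (simp add: dual_def)
  have 1: "bilin V V field_space (\<lambda>v w. f v * g w)" if "f \<in> vecs (dual V)" "g \<in> vecs (dual V)" for f g
    using that linD(3,4) unfolding v by (intro bilinI) (simp_all add: linD(3,4) algebra_simps)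
  have 2: "bilin (dual V) (dual V) field_space (\<lambda>f g. x (\<lambda>v w. f v * g w))" if x: "x \<in> vecs (tensor V V)" for x
    using tensor_eval[OF x] 1 by (intro bilinI) (simp_all add: ptw_def algebra_simps)
  show ?thesis
  proof (rule bilinI)
    fix \<xi> x x' assume "\<xi> \<in> vecs (tensor (dual V) (dual V))" "x \<in> vecs (tensor V V)" "x' \<in> vecs (tensor V V)"
    then show "pairing \<xi> (x + x') = pairing \<xi> x + pairing \<xi> x'"
      using tensor_eval(1)[of \<xi> "dual V" "dual V", OF _ 2 2] by (simp add: pairing_def)
  next
    fix c \<xi> x assume "\<xi> \<in> vecs (tensor (dual V) (dual V))" "x \<in> vecs (tensor V V)"
    then show "pairing \<xi> (scl (tensor V V) c x) = scl field_space c (pairing \<xi> x)"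
      using tensor_eval(2)[of \<xi> "dual V" "dual V", OF _ 2] by (simp add: pairing_def ptw_def)
  qed (auto simp: pairing_def ptw_def)
qed

text \<open>
  The matrix \<open>c\<close> is a separate argument so that the computations below hold for any index sets;
  \<open>matrix_of_coeff\<close> supplies the instance given by \<^const>\<open>coeff\<close>.
\<close>

definition matrix_of :: "('k::field, 'v::ab_group_add) vspace \<Rightarrow> 'i set \<Rightarrow> ('i \<Rightarrow> 'v) \<Rightarrow> ('i \<Rightarrow> 'v \<Rightarrow> 'k)
    \<Rightarrow> (('k, 'v, 'v) tens \<Rightarrow> ('k, 'v, 'v) tens) \<Rightarrow> ('i \<Rightarrow> 'i \<Rightarrow> 'i \<Rightarrow> 'i \<Rightarrow> 'k) \<Rightarrow> bool" where
  "matrix_of V I e d R c \<longleftrightarrow> coords V I e d \<and> R \<in> lin (tensor V V) (tensor V V) \<and>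
    (\<forall>i\<in>I. \<forall>j\<in>I. R (tens V V (e i) (e j)) = (\<Sum>k\<in>I. \<Sum>l\<in>I. ptw (c i j k l) (tens V V (e k) (e l))))"

lemma matrix_ofD:
  assumes "matrix_of V I e d R c"
  shows "coords V I e d" "R \<in> lin (tensor V V) (tensor V V)"
    "i \<in> I \<Longrightarrow> j \<in> I \<Longrightarrow> R (tens V V (e i) (e j)) = (\<Sum>k\<in>I. \<Sum>l\<in>I. ptw (c i j k l) (tens V V (e k) (e l)))"
  using assms by (auto simp: matrix_of_def)

lemma matrix_of_coeff:
  assumes V: "is_vspace V" "is_basis V n v" "R \<in> lin (tensor V V) (tensor V V)"
  shows "matrix_of V {1..n} v (dual_basis V n v) R (coeff V n v R)"
proof -
  note c = coords_basis[OF V(1,2)]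
  note T = coords_tensor[OF c c]
  have S: "{tens V V (v p) (v q) | p q. p \<in> {1..n} \<and> q \<in> {1..n}} = (\<lambda>(i, j). tens V V (v i) (v j)) ` ({1..n} \<times> {1..n})"
    by (auto simp del: atLeastAtMost_iff)
  have "R (tens V V (v i) (v j)) = (\<Sum>k\<in>{1..n}. \<Sum>l\<in>{1..n}. ptw (coeff V n v R i j k l) (tens V V (v k) (v l)))"
    if ij: "i \<in> {1..n}" "j \<in> {1..n}" for i j
  proof -
    have x: "R (tens V V (v i) (v j)) \<in> vecs (tensor V V)"
      using coordsD(3)[OF c] ij by (intro linD(2)[OF V(3)] tensD(1))
    have "(\<Sum>k\<in>{1..n}. \<Sum>l\<in>{1..n}. ptw (coeff V n v R i j k l) (tens V V (v k) (v l))) =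
      (\<Sum>p\<in>{1..n} \<times> {1..n}. ptw (Modules.module.representation ptw ((\<lambda>(i, j). tens V V (v i) (v j)) ` ({1..n} \<times> {1..n}))
       (R (tens V V (v i) (v j))) ((\<lambda>(i, j). tens V V (v i) (v j)) p)) ((\<lambda>(i, j). tens V V (v i) (v j)) p))"
      unfolding coeff_def S by (simp only: sum.cartesian_product case_prod_unfold)
    also have "\<dots> = R (tens V V (v i) (v j))"
      using coords_rep[OF T x] coordsD(6)[OF T x] by (simp only: scl_simps cong: sum.cong)
    finally show ?thesis by simp
  qed
  then show ?thesis using c V(3) by (simp add: matrix_of_def)
qed

lemma sum_delta2:
  fixes f :: "'i \<Rightarrow> 'j \<Rightarrow> 'k::field"
  assumes "finite I" "finite J" "i \<in> I" "j \<in> J"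
  shows "(\<Sum>r\<in>I. \<Sum>s\<in>J. f r s * ((if r = i then 1 else 0) * (if s = j then 1 else 0))) = f i j"
proof -
  have "(\<Sum>s\<in>J. f r s * ((if r = i then 1 else 0) * (if s = j then 1 else 0))) = (if r = i then f r j else 0)" for r
    using assms by (auto simp: if_distrib cong: if_cong)
  then show ?thesis using assms by simp
qed

lemma lin_comb2:
  assumes "is_vspace V" "is_vspace W" "f \<in> lin V W" "\<And>i j. i \<in> I \<Longrightarrow> j \<in> J \<Longrightarrow> x i j \<in> vecs V"
  shows "f (\<Sum>i\<in>I. \<Sum>j\<in>J. scl V (c i j) (x i j)) = (\<Sum>i\<in>I. \<Sum>j\<in>J. scl W (c i j) (f (x i j)))"
  using assms by (simp add: lin_sum[OF assms(1-3)] vspace_comb lin_comb)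

lemma vspace_comb2:
  assumes "is_vspace V" "\<And>i j. i \<in> I \<Longrightarrow> j \<in> J \<Longrightarrow> x i j \<in> vecs V"
  shows "(\<Sum>i\<in>I. \<Sum>j\<in>J. scl V (c i j) (x i j)) \<in> vecs V"
  using assms by (intro vspace_sum vspace_comb)

text \<open>
  The map with the transposed matrix has the defining property of the transpose, since both sides
  are bilinear and agree on bases.  It is the only one, because the coordinates of an element of
  the tensor square of the dual are its pairings with the basis \<open>w\<^sub>i \<otimes> w\<^sub>j\<close>.
\<close>

lemma transpose_map:
  assumes "matrix_of W J w d S s"
  shows transpose_lin: "transpose_map W S \<in> lin (tensor (dual W) (dual W)) (tensor (dual W) (dual W))"
    and transpose_tens: "p \<in> J \<Longrightarrow> q \<in> J \<Longrightarrow> transpose_map W S (tens (dual W) (dual W) (d p) (d q)) =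
      (\<Sum>r\<in>J. \<Sum>t\<in>J. ptw (s r t p q) (tens (dual W) (dual W) (d r) (d t)))"
proof -
  note m = matrix_ofD[OF assms]
  note c = coordsD[OF m(1)]
  let ?D = "tensor (dual W) (dual W)"
  have v: "vecs (dual W) = lin W field_space" by (simp add: dual_def)
  note cd = coords_dual[OF m(1)]
  note T = coords_tensor[OF m(1) m(1)] and TD = coords_tensor[OF cd cd]
  have dD: "tens (dual W) (dual W) (d r) (d t) \<in> vecs ?D" if "r \<in> J" "t \<in> J" for r t
    using that by (simp add: tensD(1) v c(4))
  have wW: "tens W W (w r) (w t) \<in> vecs (tensor W W)" if "r \<in> J" "t \<in> J" for r t
    using that by (simp add: tensD(1) c(3))
  have pt: "pairing (tens (dual W) (dual W) (d r) (d t)) (tens W W (w i) (w j)) =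
      (if r = i then 1 else 0) * (if t = j then 1 else 0)" if "r \<in> J" "t \<in> J" "i \<in> J" "j \<in> J" for r t i j
    using that by (simp add: pairing_tens v c(3,4,5))
  have "\<exists>f\<in>lin ?D ?D. \<forall>i\<in>J \<times> J. f ((\<lambda>(p, q). tens (dual W) (dual W) (d p) (d q)) i) =
      (\<lambda>(p, q). \<Sum>r\<in>J. \<Sum>t\<in>J. ptw (s r t p q) (tens (dual W) (dual W) (d r) (d t))) i"
    by (rule lin_ex[OF TD]) (auto intro!: vspace_comb2[of ?D, simplified] dD)
  then obtain f where f: "f \<in> lin ?D ?D" and f_tens0: "\<forall>i\<in>J \<times> J. f ((\<lambda>(p, q). tens (dual W) (dual W) (d p) (d q)) i) =
      (\<lambda>(p, q). \<Sum>r\<in>J. \<Sum>t\<in>J. ptw (s r t p q) (tens (dual W) (dual W) (d r) (d t))) i" by (rule bexE)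
  have f_tens: "f (tens (dual W) (dual W) (d p) (d q)) =
      (\<Sum>r\<in>J. \<Sum>t\<in>J. ptw (s r t p q) (tens (dual W) (dual W) (d r) (d t)))" if "p \<in> J" "q \<in> J" for p q
    using f_tens0[rule_format, of "(p, q)"] that by simp
  have 1: "pairing (f \<xi>) x = pairing \<xi> (S x)" if "\<xi> \<in> vecs ?D" "x \<in> vecs (tensor W W)" for \<xi> x
  proof (rule bilin_eqI[OF TD T is_vspace_field _ _ _ that, where \<beta> = "\<lambda>\<xi> x. pairing (f \<xi>) x"])
    show "bilin ?D (tensor W W) field_space (\<lambda>\<xi>. pairing (f \<xi>))"
      by (rule bilin_arg_left[OF bilin_pairing f])
    show "bilin ?D (tensor W W) field_space (\<lambda>\<xi> x. pairing \<xi> (S x))"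
      by (rule bilin_arg_right[OF bilin_pairing m(2)])
    fix a b assume "a \<in> J \<times> J" "b \<in> J \<times> J"
    then obtain p q i j where ab: "a = (p, q)" "b = (i, j)" and J: "p \<in> J" "q \<in> J" "i \<in> J" "j \<in> J" by auto
    have "pairing (f (tens (dual W) (dual W) (d p) (d q))) (tens W W (w i) (w j)) =
        (\<Sum>r\<in>J. \<Sum>t\<in>J. s r t p q * pairing (tens (dual W) (dual W) (d r) (d t)) (tens W W (w i) (w j)))"
      unfolding f_tens[OF J(1,2)]
      using lin_comb2[OF _ _ bilin_lin_left[OF bilin_pairing wW[OF J(3,4)]], of J J "\<lambda>r t. tens (dual W) (dual W) (d r) (d t)" "\<lambda>r t. s r t p q"]
      by (simp add: dD vspace_comb2[of ?D, simplified])
    also have "\<dots> = s i j p q"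
      using J by (simp add: pt sum_delta2[OF c(2) c(2)] cong: sum.cong)
    also have "\<dots> = (\<Sum>k\<in>J. \<Sum>l\<in>J. s i j k l * pairing (tens (dual W) (dual W) (d p) (d q)) (tens W W (w k) (w l)))"
      using J sum_delta2[OF c(2) c(2) J(1,2), of "s i j"] by (simp add: pt eq_commute cong: sum.cong)
    also have "\<dots> = pairing (tens (dual W) (dual W) (d p) (d q)) (S (tens W W (w i) (w j)))"
      unfolding m(3)[OF J(3,4)]
      using lin_comb2[OF _ _ bilin_lin_right[OF bilin_pairing dD[OF J(1,2)]], of J J "\<lambda>r t. tens W W (w r) (w t)" "\<lambda>k l. s i j k l"]
      by (simp add: wW vspace_comb2[of "tensor W W", simplified])
    finally show "pairing (f (case a of (p, q) \<Rightarrow> tens (dual W) (dual W) (d p) (d q))) (case b of (p, q) \<Rightarrow> tens W W (w p) (w q)) =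
      pairing (case a of (p, q) \<Rightarrow> tens (dual W) (dual W) (d p) (d q)) (S (case b of (p, q) \<Rightarrow> tens W W (w p) (w q)))"
      by (simp add: ab)
  qed
  have nondeg: "y = (\<Sum>i\<in>J \<times> J. ptw (pairing y ((\<lambda>(i, j). tens W W (w i) (w j)) i)) ((\<lambda>(p, q). tens (dual W) (dual W) (d p) (d q)) i))"
    if y: "y \<in> vecs ?D" for y
  proof -
    have ev: "y (\<lambda>\<xi> \<eta>. (if \<xi> \<in> vecs (dual W) then \<xi> (w i) else 0) * (if \<eta> \<in> vecs (dual W) then \<eta> (w j) else 0)) =
      pairing y (tens W W (w i) (w j))" if "i \<in> J" "j \<in> J" for i j
      unfolding pairing_def
    proof (rule tensor_cong[OF y is_vspace_dual[OF c(1)] is_vspace_dual[OF c(1)]])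
      fix \<xi> \<eta> assume a: "\<xi> \<in> vecs (dual W)" "\<eta> \<in> vecs (dual W)"
      then have "bilin W W field_space (\<lambda>v w. \<xi> v * \<eta> w)"
        unfolding v by (intro bilinI) (simp_all add: linD(3,4) algebra_simps)
      then show "(if \<xi> \<in> vecs (dual W) then \<xi> (w i) else 0) * (if \<eta> \<in> vecs (dual W) then \<eta> (w j) else 0) =
        tens W W (w i) (w j) (\<lambda>v w. \<xi> v * \<eta> w)" using a by (simp add: tens_def)
    qed
    show ?thesis
      by (rule trans[OF coordsD(6)[OF TD y, symmetric]], rule sum.cong[OF refl]) (use y ev in auto)
  qed
  let ?P = "\<lambda>R'. R' \<in> lin ?D ?D \<and> (\<forall>\<xi>\<in>vecs ?D. \<forall>x\<in>vecs (tensor W W). pairing (R' \<xi>) x = pairing \<xi> (S x))"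
  have "transpose_map W S = f"
    unfolding transpose_map_def
  proof (rule the_equality)
    show "?P f" using f 1 by blast
    fix g assume g: "?P g"
    show "g = f"
    proof
      fix \<xi>
      show "g \<xi> = f \<xi>"
      proof (cases "\<xi> \<in> vecs ?D")
        case True
        have gf: "g \<xi> \<in> vecs ?D" "f \<xi> \<in> vecs ?D" using True g f linD(2) by blast+
        show ?thesis
          apply (subst nondeg[OF gf(1)])
          apply (subst nondeg[OF gf(2)])
          apply (rule sum.cong[OF refl])
          using True g 1 wW by auto
      next
        case False
        then show ?thesis using g f linD(1) by metis
      qed
    qed
  qed
  then show "transpose_map W S \<in> lin ?D ?D" and "p \<in> J \<Longrightarrow> q \<in> J \<Longrightarrow> transpose_map W S (tens (dual W) (dual W) (d p) (d q)) =
      (\<Sum>r\<in>J. \<Sum>t\<in>J. ptw (s r t p q) (tens (dual W) (dual W) (d r) (d t)))"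
    using f f_tens by simp_all
qed

section \<open>The exchange relations\<close>

lemma sum_swap4:
  "(\<Sum>k\<in>A. \<Sum>l\<in>B. \<Sum>p\<in>C. \<Sum>q\<in>D. f k l p q) = (\<Sum>p\<in>C. \<Sum>q\<in>D. \<Sum>k\<in>A. \<Sum>l\<in>B. f k l p q)"
proof -
  have "(\<Sum>k\<in>A. \<Sum>l\<in>B. \<Sum>p\<in>C. \<Sum>q\<in>D. f k l p q) = (\<Sum>k\<in>A. \<Sum>p\<in>C. \<Sum>q\<in>D. \<Sum>l\<in>B. f k l p q)"
    by (intro sum.cong refl) (subst sum.swap, intro sum.cong refl sum.swap)
  also have "\<dots> = (\<Sum>p\<in>C. \<Sum>q\<in>D. \<Sum>k\<in>A. \<Sum>l\<in>B. f k l p q)"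
    by (subst sum.swap) (intro sum.cong refl sum.swap)
  finally show ?thesis .
qed

lemma lin_eq_iff:
  assumes "coords V I e d" "is_vspace W" "f \<in> lin V W" "g \<in> lin V W"
  shows "f = g \<longleftrightarrow> (\<forall>i\<in>I. f (e i) = g (e i))"
  using lin_eqI[OF assms] by blast

lemma bilin_comb2_left:
  assumes "bilin V W U \<beta>" "is_vspace V" "is_vspace U" "y \<in> vecs W" "\<And>i j. i \<in> I \<Longrightarrow> j \<in> J \<Longrightarrow> x i j \<in> vecs V"
  shows "\<beta> (\<Sum>i\<in>I. \<Sum>j\<in>J. scl V (c i j) (x i j)) y = (\<Sum>i\<in>I. \<Sum>j\<in>J. scl U (c i j) (\<beta> (x i j) y))"
  using lin_comb2[OF assms(2,3) bilin_lin_left[OF assms(1,4,2)], of I J x c] assms(5)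
  by (simp add: vspace_comb2[OF assms(2)])

lemma bilin_comb2_right:
  assumes "bilin V W U \<beta>" "is_vspace W" "is_vspace U" "y \<in> vecs V" "\<And>i j. i \<in> I \<Longrightarrow> j \<in> J \<Longrightarrow> x i j \<in> vecs W"
  shows "\<beta> y (\<Sum>i\<in>I. \<Sum>j\<in>J. scl W (c i j) (x i j)) = (\<Sum>i\<in>I. \<Sum>j\<in>J. scl U (c i j) (\<beta> y (x i j)))"
  using lin_comb2[OF assms(2,3) bilin_lin_right[OF assms(1,4,2)], of I J x c] assms(5)
  by (simp add: vspace_comb2[OF assms(2)])

lemma lin_minus:
  assumes "is_vspace V" "is_vspace W" "f \<in> lin V W" "x \<in> vecs V"
  shows "f (- x) = - f x"
  using linD(4)[OF assms(3,4), of "- 1"] by (simp add: vspace_simps[OF assms(1)] vspace_simps[OF assms(2)])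

lemma lin_diff:
  assumes "is_vspace V" "is_vspace W" "f \<in> lin V W" "x \<in> vecs V" "y \<in> vecs V"
  shows "f (x - y) = f x - f y"
  using linD(3)[OF assms(3,4), of "- y"] lin_minus[OF assms(1-3,5)] vspace_uminus[OF assms(1,5)] by simp

text \<open>
  The left hand side of the exchange relations: \<open>R a\<^sub>1 a\<^sub>2 - a\<^sub>1 a\<^sub>2 S\<close> in the usual matrix notation, with
  the product of entries replaced by their tensor product.
\<close>

definition rtt :: "'i set \<Rightarrow> ('i \<Rightarrow> 'i \<Rightarrow> 'i \<Rightarrow> 'i \<Rightarrow> 'k::field) \<Rightarrow> 'j set \<Rightarrow> ('j \<Rightarrow> 'j \<Rightarrow> 'j \<Rightarrow> 'j \<Rightarrow> 'k)
    \<Rightarrow> ('k, 'h::ab_group_add) vspace \<Rightarrow> ('j \<Rightarrow> 'i \<Rightarrow> 'h) \<Rightarrow> 'i \<Rightarrow> 'i \<Rightarrow> 'j \<Rightarrow> 'j \<Rightarrow> ('k, 'h, 'h) tens" where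
  "rtt I R J S H a i j p q = (\<Sum>k\<in>I. \<Sum>l\<in>I. ptw (R i j k l) (tens H H (a p k) (a q l))) -
     (\<Sum>r\<in>J. \<Sum>s\<in>J. ptw (S r s p q) (tens H H (a r i) (a s j)))"

lemma rtt_cong:
  "(\<And>p i. p \<in> J \<Longrightarrow> i \<in> I \<Longrightarrow> a p i = b p i) \<Longrightarrow> i \<in> I \<Longrightarrow> j \<in> I \<Longrightarrow> p \<in> J \<Longrightarrow> q \<in> J \<Longrightarrow>
    rtt I R J S H a i j p q = rtt I R J S H b i j p q"
  by (simp add: rtt_def cong: sum.cong)

lemmas lin_comb2_tensor = lin_comb2[of "tensor A B" for A B, simplified]
lemmas comb2_tensor = vspace_comb2[of "tensor A B" for A B, simplified]

text \<open>
  Stated for any target, since it is applied both to \<open>\<alpha> \<otimes> \<alpha>\<close> and to the inclusion into the tensor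
  algebra.
\<close>

lemma lin_rtt:
  assumes f: "f \<in> lin (tensor U U) X" and X: "is_vspace X" "scl X = ptw"
    and t: "\<And>p i. p \<in> J \<Longrightarrow> i \<in> I \<Longrightarrow> t p i \<in> vecs U"
    and ij: "i \<in> I" "j \<in> I" "p \<in> J" "q \<in> J"
  shows "f (rtt I R J S U t i j p q) = (\<Sum>k\<in>I. \<Sum>l\<in>I. ptw (R i j k l) (f (tens U U (t p k) (t q l)))) -
     (\<Sum>r\<in>J. \<Sum>s\<in>J. ptw (S r s p q) (f (tens U U (t r i) (t s j))))"
  unfolding rtt_def
  using t ij by (simp add: lin_diff[OF is_vspace_tensor X(1) f] comb2_tensor tensD(1) lin_comb2_tensor[OF X(1) f] X(2))

lemma tmap_rtt:
  assumes f: "\<alpha> \<in> lin U H"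
    and t: "\<And>p i. p \<in> J \<Longrightarrow> i \<in> I \<Longrightarrow> t p i \<in> vecs U"
    and ij: "i \<in> I" "j \<in> I" "p \<in> J" "q \<in> J"
  shows "tmap U U H H \<alpha> \<alpha> (rtt I R J S U t i j p q) = rtt I R J S H (\<lambda>p i. \<alpha> (t p i)) i j p q"
  using lin_rtt[OF tmap_lin[OF f f] is_vspace_tensor scl_simps(1) t ij, where R = R and S = S] ij t
  by (simp add: tmap_tens[OF f f] rtt_def cong: sum.cong)

lemma fst_ihom: "fst (ihom (W, S) (V, R)) = tensor (dual W) V"
  by (simp add: ihom_def box_def dagger_def)

lemma ihom_lin:
  assumes V: "matrix_of V I v dv R rc" and W: "matrix_of W J w dw S sc"
  defines "U \<equiv> tensor (dual W) V"
  shows "snd (ihom (W, S) (V, R)) \<in> lin (tensor U U) (tensor U U)"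
  unfolding U_def ihom_def dagger_def prod.case
  by (intro box_lin lin_uminus transpose_lin[OF W] matrix_ofD[OF V] is_vspace_tensor
    coords_dim[OF coords_dual[OF matrix_ofD(1)[OF W]]] coords_dim[OF matrix_ofD(1)[OF V]])

text \<open>
  By the Leibniz rule of the product, \<open>R\<close> acts on the factors \<open>v\<^sub>i \<otimes> v\<^sub>j\<close> and \<open>-S*\<close> on the
  factors \<open>w\<^sup>p \<otimes> w\<^sup>q\<close>; the transposition moves the indices of \<open>S\<close> to where the exchange relations
  have them.
\<close>

lemma ihom_generators:
  assumes V: "matrix_of V I v dv R rc" and W: "matrix_of W J w dw S sc"
    and ij: "i \<in> I" "j \<in> I" "p \<in> J" "q \<in> J"
  defines "U \<equiv> tensor (dual W) V" and "t \<equiv> \<lambda>p i. tens (dual W) V (dw p) (v i)"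
  shows "snd (ihom (W, S) (V, R)) (tens U U (t p i) (t q j)) = rtt I rc J sc U t i j p q"
proof -
  note mv = matrix_ofD[OF V] and mw = matrix_ofD[OF W]
  note cv = coordsD[OF mv(1)] and cw = coordsD[OF mw(1)] and cd = coordsD[OF coords_dual[OF mw(1)]]
  note fv = coords_dim[OF mv(1)] and fd = coords_dim[OF coords_dual[OF mw(1)]]
  note b = bilin_weave[OF fd fv]
  have vv: "tens V V (v i) (v j) \<in> vecs (tensor V V)" if "i \<in> I" "j \<in> I" for i j
    using that by (simp add: tensD(1) cv(3))
  have dd: "tens (dual W) (dual W) (dw p) (dw q) \<in> vecs (tensor (dual W) (dual W))" if "p \<in> J" "q \<in> J" for p q
    using that by (simp add: tensD(1) cd(3))
  have wt: "tens U U (t p i) (t q j) = weave (dual W) V (tens (dual W) (dual W) (dw p) (dw q)) (tens V V (v i) (v j))"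
    if "i \<in> I" "j \<in> I" "p \<in> J" "q \<in> J" for i j p q
    using that by (simp add: weave_tens[OF fd fv] cv(3) cd(3) U_def t_def)
  have op: "snd (ihom (W, S) (V, R)) (tens U U (t p i) (t q j)) =
    weave (dual W) V (- (\<Sum>r\<in>J. \<Sum>s\<in>J. ptw (sc r s p q) (tens (dual W) (dual W) (dw r) (dw s)))) (tens V V (v i) (v j)) +
    weave (dual W) V (tens (dual W) (dual W) (dw p) (dw q)) (\<Sum>k\<in>I. \<Sum>l\<in>I. ptw (rc i j k l) (tens V V (v k) (v l)))"
    unfolding wt[OF ij] ihom_def dagger_def prod.case
    using box_weave[OF fd fv lin_uminus[OF is_vspace_tensor transpose_lin[OF W]] mv(2) dd[OF ij(3,4)] vv[OF ij(1,2)]]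
    by (simp add: mv(3)[OF ij(1,2)] transpose_tens[OF W ij(3,4)])
  have S_part: "weave (dual W) V (- (\<Sum>r\<in>J. \<Sum>s\<in>J. ptw (sc r s p q) (tens (dual W) (dual W) (dw r) (dw s)))) (tens V V (v i) (v j)) =
    - (\<Sum>r\<in>J. \<Sum>s\<in>J. ptw (sc r s p q) (tens U U (t r i) (t s j)))"
    using lin_minus[OF _ _ bilin_lin_left[OF b vv[OF ij(1,2)]], of "\<Sum>r\<in>J. \<Sum>s\<in>J. ptw (sc r s p q) (tens (dual W) (dual W) (dw r) (dw s))"]
      bilin_comb2_left[OF b _ _ vv[OF ij(1,2)], of J J "\<lambda>r s. tens (dual W) (dual W) (dw r) (dw s)" "\<lambda>r s. sc r s p q"] ij
    by (simp add: comb2_tensor dd vspace_uminus wt cong: sum.cong)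
  have R_part: "weave (dual W) V (tens (dual W) (dual W) (dw p) (dw q)) (\<Sum>k\<in>I. \<Sum>l\<in>I. ptw (rc i j k l) (tens V V (v k) (v l))) =
    (\<Sum>k\<in>I. \<Sum>l\<in>I. ptw (rc i j k l) (tens U U (t p k) (t q l)))"
    using bilin_comb2_right[OF b _ _ dd[OF ij(3,4)], of I I "\<lambda>k l. tens V V (v k) (v l)" "\<lambda>k l. rc i j k l"] ij
    by (simp add: vv wt cong: sum.cong)
  show ?thesis unfolding op S_part R_part rtt_def by simp
qed

text \<open>
  On two generators, \<open>(\<alpha> \<otimes> \<alpha>)\<close> after the operator of the internal hom is \<open>rtt\<close> for the matrix
  \<open>\<alpha> (t p i)\<close>, so the intertwining equation on a basis is the exchange relations.
\<close>

lemma ihom_arrow_iff: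
  assumes V: "matrix_of V I v dv R rc" and W: "matrix_of W J w dw S sc" and H: "EQA_obj (H, T)"
  defines "U \<equiv> tensor (dual W) V" and "t \<equiv> \<lambda>p i. tens (dual W) V (dw p) (v i)"
  assumes \<alpha>: "\<alpha> \<in> lin U H"
  shows "EQA_arr (ihom (W, S) (V, R)) (H, T) \<alpha> \<longleftrightarrow> (\<forall>i\<in>I. \<forall>j\<in>I. \<forall>p\<in>J. \<forall>q\<in>J.
    rtt I rc J sc H (\<lambda>p i. \<alpha> (t p i)) i j p q = T (tens H H (\<alpha> (t p i)) (\<alpha> (t q j))))"
proof -
  let ?B = "snd (ihom (W, S) (V, R))"
  note cU = coords_tensor[OF coords_dual[OF matrix_ofD(1)[OF W]] matrix_ofD(1)[OF V], folded U_def]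
  have t_in: "t p i \<in> vecs U" if "p \<in> J" "i \<in> I" for p i
    using coordsD(3)[OF cU, of "(p, i)"] that by (simp add: t_def)
  have gen: "?B (tens U U (t p i) (t q j)) = rtt I rc J sc U t i j p q"
    if "i \<in> I" "j \<in> I" "p \<in> J" "q \<in> J" for i j p q
    using ihom_generators[OF V W that] by (simp add: U_def t_def)
  note B = ihom_lin[OF V W, folded U_def]
  have T: "T \<in> lin (tensor H H) (tensor H H)" using H by (simp add: EQA_obj_def)
  note aa = tmap_lin[OF \<alpha> \<alpha>]
  have B_eq: "ihom (W, S) (V, R) = (U, ?B)" by (rule prod_eqI) (simp_all add: fst_ihom U_def)
  have "EQA_arr (ihom (W, S) (V, R)) (H, T) \<alpha> \<longleftrightarrow> tmap U U H H \<alpha> \<alpha> \<circ> ?B = T \<circ> tmap U U H H \<alpha> \<alpha>"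
    using \<alpha> by (subst B_eq) (simp add: EQA_arr_def)
  also have "\<dots> \<longleftrightarrow> (\<forall>b\<in>(J \<times> I) \<times> (J \<times> I).
      (tmap U U H H \<alpha> \<alpha> \<circ> ?B) ((\<lambda>(x, y). tens U U (case x of (p, i) \<Rightarrow> t p i) (case y of (p, i) \<Rightarrow> t p i)) b) =
      (T \<circ> tmap U U H H \<alpha> \<alpha>) ((\<lambda>(x, y). tens U U (case x of (p, i) \<Rightarrow> t p i) (case y of (p, i) \<Rightarrow> t p i)) b))"
    unfolding t_def
    by (rule lin_eq_iff[OF coords_tensor[OF cU cU] is_vspace_tensor lin_comp[OF _ _ _ B aa] lin_comp[OF _ _ _ aa T]])
      (rule is_vspace_tensor)+
  also have "\<dots> \<longleftrightarrow> (\<forall>i\<in>I. \<forall>j\<in>I. \<forall>p\<in>J. \<forall>q\<in>J.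
      tmap U U H H \<alpha> \<alpha> (?B (tens U U (t p i) (t q j))) = T (tmap U U H H \<alpha> \<alpha> (tens U U (t p i) (t q j))))"
    by (auto simp: Ball_def)
  also have "\<dots> \<longleftrightarrow> (\<forall>i\<in>I. \<forall>j\<in>I. \<forall>p\<in>J. \<forall>q\<in>J.
    rtt I rc J sc H (\<lambda>p i. \<alpha> (t p i)) i j p q = T (tens H H (\<alpha> (t p i)) (\<alpha> (t q j))))"
    by (intro ball_cong refl) (simp add: gen tmap_rtt[OF \<alpha>, of J I t, OF t_in] tmap_tens[OF \<alpha> \<alpha>] t_in)
  finally show ?thesis .
qed

text \<open>
  Contraction of the second factor with the functional \<open>d\<^sub>p\<close> extracts the coefficient of \<open>w\<^sub>p\<close>, which
  shows that coefficients in \<open>H\<close> with respect to a basis of \<open>W\<close> are unique.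
\<close>

lemma contraction:
  assumes H: "is_vspace H" and W: "coords W J w d" and p: "p \<in> J"
  defines "c \<equiv> tlift H W H (\<lambda>h x. scl H (d p x) h)"
  shows contraction_lin: "c \<in> lin (tensor H W) H"
    and contraction_tens: "h \<in> vecs H \<Longrightarrow> r \<in> J \<Longrightarrow> c (tens H W h (w r)) = (if p = r then h else 0)"
proof -
  have b: "bilin H W H (\<lambda>h x. scl H (d p x) h)"
    using coordsD(4)[OF W p] by (intro bilinI)
      (simp_all add: is_vspaceD[OF H] vspace_simps[OF H] linD mult.commute)
  show "c \<in> lin (tensor H W) H" unfolding c_def by (rule tlift_lin[OF H b])
  show "h \<in> vecs H \<Longrightarrow> r \<in> J \<Longrightarrow> c (tens H W h (w r)) = (if p = r then h else 0)"
    unfolding c_def using p by (simp add: tlift_tens[OF H b] coordsD(3,5)[OF W] vspace_simps[OF H])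
qed

lemma tensor_expand:
  assumes H: "is_vspace H" and W: "coords W J w d" and "z \<in> vecs (tensor H W)"
  shows "\<exists>a. (\<forall>p\<in>J. a p \<in> vecs H) \<and> z = (\<Sum>p\<in>J. tens H W (a p) (w p))"
  using assms(3)
proof (induction rule: tensor_induct)
  case zero
  have "tens H W 0 (w p) = 0" if "p \<in> J" for p
    using tensD(4)[of 0 H "w p" W 0] coordsD(3)[OF W that] is_vspaceD(2)[OF H] 
    by (simp add: vspace_simps[OF H] ptw_simps)
  then show ?case using is_vspaceD(2)[OF H] by (intro exI[of _ "\<lambda>_. 0"]) simp
next
  case (step c h x y)
  then obtain a where a: "\<forall>p\<in>J. a p \<in> vecs H" "y = (\<Sum>p\<in>J. tens H W (a p) (w p))" by blast
  have "tens H W h (\<Sum>p\<in>J. scl W (d p x) (w p)) = (\<Sum>p\<in>J. tens H W h (scl W (d p x) (w p)))"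
    using step(1) by (intro bilin_sum_right[OF bilin_tens coordsD(1)[OF W]])
      (auto intro: is_vspaceD[OF coordsD(1)[OF W]] coordsD(3)[OF W])
  then have e: "tens H W h x = (\<Sum>p\<in>J. tens H W (scl H (d p x) h) (w p))"
    using step(1) by (simp add: coordsD(6)[OF W step(2)] tensD coordsD(3)[OF W])
  have "ptw c (tens H W h x) + y = (\<Sum>p\<in>J. tens H W (scl H c (scl H (d p x) h) + a p) (w p))"
    using step(1) a(1) by (simp add: e a(2) tensD coordsD(3)[OF W] is_vspaceD[OF H] ptw_simps sum.distrib)
  then show ?case using a(1) step(1) is_vspaceD[OF H]
    by (intro exI[of _ "\<lambda>p. scl H c (scl H (d p x) h) + a p"]) auto
qed

lemma tensor_coeff:
  assumes H: "is_vspace H" and W: "coords W J w d"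
    and a: "\<And>p. p \<in> J \<Longrightarrow> a p \<in> vecs H" and b: "\<And>p. p \<in> J \<Longrightarrow> b p \<in> vecs H"
    and eq: "(\<Sum>p\<in>J. tens H W (a p) (w p)) = (\<Sum>p\<in>J. tens H W (b p) (w p))" and p: "p \<in> J"
  shows "a p = b p"
proof -
  let ?c = "tlift H W H (\<lambda>h x. scl H (d p x) h)"
  note c = contraction[OF H W p]
  have 1: "?c (\<Sum>r\<in>J. tens H W (x r) (w r)) = x p" if "\<And>r. r \<in> J \<Longrightarrow> x r \<in> vecs H" for x
    using that p by (simp add: lin_sum[OF is_vspace_tensor H c(1)] tensD(1) coordsD(2,3)[OF W] c(2) sum.delta' cong: sum.cong)
  show ?thesis using 1[of a] 1[of b] a b eq by simp
qed

text \<open>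
  The same uniqueness of coefficients in the square of \<open>H \<otimes> W\<close>, by contracting both copies of \<open>W\<close>.
\<close>

lemma weave_coeff:
  assumes H: "fin_dim H" and W: "coords W J w d"
    and a: "\<And>p q. p \<in> J \<Longrightarrow> q \<in> J \<Longrightarrow> X p q \<in> vecs (tensor H H)"
    and b: "\<And>p q. p \<in> J \<Longrightarrow> q \<in> J \<Longrightarrow> Y p q \<in> vecs (tensor H H)"
    and eq: "(\<Sum>p\<in>J. \<Sum>q\<in>J. weave H W (X p q) (tens W W (w p) (w q))) =
      (\<Sum>p\<in>J. \<Sum>q\<in>J. weave H W (Y p q) (tens W W (w p) (w q)))" and p: "p \<in> J" and q: "q \<in> J"
  shows "X p q = Y p q"
proof -
  have Hv: "is_vspace H" using H by (simp add: fin_dim_def)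
  note fW = coords_dim[OF W] and fin = coordsD(2)[OF W]
  note bw = bilin_weave[OF H fW]
  let ?c = "\<lambda>p. tlift H W H (\<lambda>h x. scl H (d p x) h)"
  let ?\<pi> = "tmap (tensor H W) (tensor H W) H H (?c p) (?c q)"
  note c = contraction[OF Hv W p] and c' = contraction[OF Hv W q]
  note \<pi> = tmap_lin[OF c(1) c'(1)]
  have ww: "tens W W (w r) (w s) \<in> vecs (tensor W W)" if "r \<in> J" "s \<in> J" for r s
    using that by (simp add: tensD(1) coordsD(3)[OF W])
  have z: "tens H H x 0 = 0" "tens H H 0 x = 0" if "x \<in> vecs H" for x
    using tensD(4)[of 0 H x H 0] tensD(5)[of x H 0 H 0] that is_vspaceD(2)[OF Hv] by (simp_all add: vspace_simps[OF Hv] ptw_simps)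
  have 1: "?\<pi> (weave H W x (tens W W (w r) (w s))) = (if p = r \<and> q = s then x else 0)"
    if x: "x \<in> vecs (tensor H H)" and rs: "r \<in> J" "s \<in> J" for x r s
  proof -
    have "(\<lambda>x. if x \<in> vecs (tensor H H) then ?\<pi> (weave H W x (tens W W (w r) (w s))) else 0) =
      (\<lambda>x. if p = r \<and> q = s then lid (tensor H H) x else 0)" (is "?f = ?g")
    proof (rule tensor_lin_eqI[OF is_vspace_tensor])
      show "?f \<in> lin (tensor H H) (tensor H H)"
        by (rule bilin_lin_left[OF bilin_out[OF bw \<pi>] ww[OF rs] is_vspace_tensor])
      show "?g \<in> lin (tensor H H) (tensor H H)"
        using lid_lin[OF is_vspace_tensor, of H H] is_vspaceD(2)[OF is_vspace_tensor, of H H] 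
        by (cases "p = r \<and> q = s") (auto simp: lin_def ptw_simps)
      fix h h' assume "h \<in> vecs H" "h' \<in> vecs H"
      then show "?f (tens H H h h') = ?g (tens H H h h')"
        using rs by (auto simp: weave_tens[OF H fW] coordsD(3)[OF W] tmap_tens[OF c(1) c'(1)] tensD(1) c(2) c'(2) z lid_def is_vspaceD(2)[OF Hv])
    qed
    from fun_cong[OF this, of x] x show ?thesis by (simp add: lid_def)
  qed
  have 2: "?\<pi> (\<Sum>r\<in>J. \<Sum>s\<in>J. weave H W (x r s) (tens W W (w r) (w s))) = x p q"
    if x: "\<And>r s. r \<in> J \<Longrightarrow> s \<in> J \<Longrightarrow> x r s \<in> vecs (tensor H H)" for x
  proof -
    have "?\<pi> (\<Sum>r\<in>J. \<Sum>s\<in>J. weave H W (x r s) (tens W W (w r) (w s))) = (\<Sum>r\<in>J. \<Sum>s\<in>J. if p = r \<and> q = s then x r s else 0)"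
      using x ww by (simp add: lin_sum[OF is_vspace_tensor is_vspace_tensor \<pi>] vspace_sum bilinD(1)[OF bw] 1)
    also have "\<dots> = (\<Sum>r\<in>J. if p = r then x r q else 0)"
      using q fin by (intro sum.cong refl) (auto simp: sum.delta')
    also have "\<dots> = x p q" using p fin by (simp add: sum.delta')
    finally show ?thesis .
  qed
  show ?thesis using 2[of X] 2[of Y] a b eq by simp
qed

text \<open>
  Both sides of the intertwining equation on \<open>v\<^sub>i \<otimes> v\<^sub>j\<close> are expanded with coefficients in \<open>H \<otimes> H\<close>
  along \<open>w\<^sub>p \<otimes> w\<^sub>q\<close>.  The left side contributes the \<open>R\<close>-sum.  The right side contributes \<open>T\<close> and,
  after renaming the summation indices, the \<open>S\<close>-sum with coefficient \<open>S\<^sub>r\<^sub>s\<^sup>p\<^sup>q\<close>.  Uniqueness of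
  coefficients makes the comparison an equivalence.
\<close>

lemma coaction_arrow_iff:
  assumes V: "matrix_of V I v dv R rc" and W: "matrix_of W J w dw S sc" and H: "EQA_obj (H, T)"
    and \<phi>: "\<phi> \<in> lin V (tensor H W)"
    and a: "\<And>p i. p \<in> J \<Longrightarrow> i \<in> I \<Longrightarrow> a p i \<in> vecs H"
    and \<phi>_v: "\<And>i. i \<in> I \<Longrightarrow> \<phi> (v i) = (\<Sum>p\<in>J. tens H W (a p i) (w p))"
  shows "EQA_arr (V, R) (box (H, T) (W, S)) \<phi> \<longleftrightarrow> (\<forall>i\<in>I. \<forall>j\<in>I. \<forall>p\<in>J. \<forall>q\<in>J.
    rtt I rc J sc H a i j p q = T (tens H H (a p i) (a q j)))"
proof -
  let ?X = "tensor H W" and ?B = "snd (box (H, T) (W, S))"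
  note mv = matrix_ofD[OF V] and mw = matrix_ofD[OF W]
  note cv = coordsD[OF mv(1)] and cw = coordsD[OF mw(1)]
  have fH: "fin_dim H" and T: "T \<in> lin (tensor H H) (tensor H H)" using H by (auto simp: EQA_obj_def)
  note fW = coords_dim[OF mw(1)]
  note bw = bilin_weave[OF fH fW]
  note B = box_lin[OF fH fW T mw(2)]
  note pp = tmap_lin[OF \<phi> \<phi>]
  let ?w = "\<lambda>p q. tens W W (w p) (w q)"
  have ww: "?w r s \<in> vecs (tensor W W)" if "r \<in> J" "s \<in> J" for r s
    using that by (simp add: tensD(1) cw(3))
  have vv: "tens V V (v i) (v j) \<in> vecs (tensor V V)" if "i \<in> I" "j \<in> I" for i j
    using that by (simp add: tensD(1) cv(3))
  have aa: "tens H H (a p i) (a q j) \<in> vecs (tensor H H)" if "p \<in> J" "i \<in> I" "q \<in> J" "j \<in> I" for p i q j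
    using that by (simp add: tensD(1) a)
  have hw: "tens H W (a p i) (w p) \<in> vecs ?X" if "p \<in> J" "i \<in> I" for p i
    using that by (simp add: tensD(1) a cw(3))
  have pv: "tmap V V ?X ?X \<phi> \<phi> (tens V V (v i) (v j)) = (\<Sum>p\<in>J. \<Sum>q\<in>J. weave H W (tens H H (a p i) (a q j)) (?w p q))"
    if ij: "i \<in> I" "j \<in> I" for i j
  proof -
    have "tmap V V ?X ?X \<phi> \<phi> (tens V V (v i) (v j)) = tens ?X ?X (\<Sum>p\<in>J. tens H W (a p i) (w p)) (\<Sum>q\<in>J. tens H W (a q j) (w q))"
      using ij by (simp add: tmap_tens[OF \<phi> \<phi>] cv(3) \<phi>_v)
    also have "\<dots> = (\<Sum>p\<in>J. \<Sum>q\<in>J. tens ?X ?X (tens H W (a p i) (w p)) (tens H W (a q j) (w q)))"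
      using ij by (simp add: bilin_sum_left[OF bilin_tens] bilin_sum_right[OF bilin_tens] hw vspace_sum) (rule sum.swap)
    finally show ?thesis using ij by (simp add: weave_tens[OF fH fW] a cw(3))
  qed
  let ?L = "\<lambda>i j p q. \<Sum>k\<in>I. \<Sum>l\<in>I. ptw (rc i j k l) (tens H H (a p k) (a q l))"
  let ?S = "\<lambda>i j p q. \<Sum>r\<in>J. \<Sum>s\<in>J. ptw (sc r s p q) (tens H H (a r i) (a s j))"
  have L: "?L i j p q \<in> vecs (tensor H H)" if "i \<in> I" "j \<in> I" "p \<in> J" "q \<in> J" for i j p q
    using that by (intro comb2_tensor) (auto intro: aa)
  have S: "?S i j p q \<in> vecs (tensor H H)" if "i \<in> I" "j \<in> I" "p \<in> J" "q \<in> J" for i j p q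
    using that by (intro comb2_tensor) (auto intro: aa)
  have TT: "T (tens H H (a p i) (a q j)) \<in> vecs (tensor H H)" if "i \<in> I" "j \<in> I" "p \<in> J" "q \<in> J" for i j p q
    using that by (intro linD(2)[OF T] aa)
  have left: "tmap V V ?X ?X \<phi> \<phi> (R (tens V V (v i) (v j))) = (\<Sum>p\<in>J. \<Sum>q\<in>J. weave H W (?L i j p q) (?w p q))"
    if ij: "i \<in> I" "j \<in> I" for i j
  proof -
    have "tmap V V ?X ?X \<phi> \<phi> (R (tens V V (v i) (v j))) =
      (\<Sum>k\<in>I. \<Sum>l\<in>I. ptw (rc i j k l) (\<Sum>p\<in>J. \<Sum>q\<in>J. weave H W (tens H H (a p k) (a q l)) (?w p q)))"
      using ij by (simp add: mv(3) lin_comb2_tensor[OF is_vspace_tensor pp] vv pv)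
    also have "\<dots> = (\<Sum>k\<in>I. \<Sum>l\<in>I. \<Sum>p\<in>J. \<Sum>q\<in>J. ptw (rc i j k l) (weave H W (tens H H (a p k) (a q l)) (?w p q)))"
      by (simp add: ptw_simps)
    also have "\<dots> = (\<Sum>p\<in>J. \<Sum>q\<in>J. \<Sum>k\<in>I. \<Sum>l\<in>I. ptw (rc i j k l) (weave H W (tens H H (a p k) (a q l)) (?w p q)))"
      by (rule sum_swap4)
    also have "\<dots> = (\<Sum>p\<in>J. \<Sum>q\<in>J. weave H W (?L i j p q) (?w p q))"
      using ij by (intro sum.cong refl) (simp add: bilin_comb2_left[OF bw _ _ ww, simplified] aa)
    finally show ?thesis .
  qed
  have right: "?B (tmap V V ?X ?X \<phi> \<phi> (tens V V (v i) (v j))) =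
      (\<Sum>p\<in>J. \<Sum>q\<in>J. weave H W (T (tens H H (a p i) (a q j)) + ?S i j p q) (?w p q))"
    if ij: "i \<in> I" "j \<in> I" for i j
  proof -
    have "(\<Sum>p\<in>J. \<Sum>q\<in>J. weave H W (tens H H (a p i) (a q j)) (S (?w p q))) =
      (\<Sum>p\<in>J. \<Sum>q\<in>J. \<Sum>r\<in>J. \<Sum>s\<in>J. ptw (sc p q r s) (weave H W (tens H H (a p i) (a q j)) (?w r s)))"
      using ij by (intro sum.cong refl) (simp add: mw(3) bilin_comb2_right[OF bw _ _ aa, simplified] ww)
    also have "\<dots> = (\<Sum>r\<in>J. \<Sum>s\<in>J. \<Sum>p\<in>J. \<Sum>q\<in>J. ptw (sc p q r s) (weave H W (tens H H (a p i) (a q j)) (?w r s)))"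
      by (rule sum_swap4)
    also have "\<dots> = (\<Sum>p\<in>J. \<Sum>q\<in>J. weave H W (?S i j p q) (?w p q))"
      using ij by (intro sum.cong refl) (simp add: bilin_comb2_left[OF bw _ _ ww, simplified] aa)
    finally have S_part: "(\<Sum>p\<in>J. \<Sum>q\<in>J. weave H W (tens H H (a p i) (a q j)) (S (?w p q))) =
      (\<Sum>p\<in>J. \<Sum>q\<in>J. weave H W (?S i j p q) (?w p q))" .
    have "?B (tmap V V ?X ?X \<phi> \<phi> (tens V V (v i) (v j))) =
      (\<Sum>p\<in>J. \<Sum>q\<in>J. ?B (weave H W (tens H H (a p i) (a q j)) (?w p q)))"
      using ij by (simp add: pv lin_sum[OF is_vspace_tensor is_vspace_tensor B] vspace_sum bilinD(1)[OF bw] aa ww)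
    also have "\<dots> = (\<Sum>p\<in>J. \<Sum>q\<in>J. weave H W (T (tens H H (a p i) (a q j))) (?w p q)) +
        (\<Sum>p\<in>J. \<Sum>q\<in>J. weave H W (tens H H (a p i) (a q j)) (S (?w p q)))"
      using ij by (simp add: box_weave[OF fH fW T mw(2)] aa ww sum.distrib)
    finally show ?thesis
      using ij unfolding S_part by (simp add: sum.distrib[symmetric] bilinD(2)[OF bw] TT S ww)
  qed
  have "EQA_arr (V, R) (box (H, T) (W, S)) \<phi> \<longleftrightarrow> tmap V V ?X ?X \<phi> \<phi> \<circ> R = ?B \<circ> tmap V V ?X ?X \<phi> \<phi>"
    using \<phi> by (simp add: EQA_arr_def box_def)
  also have "\<dots> \<longleftrightarrow> (\<forall>b\<in>I \<times> I. (tmap V V ?X ?X \<phi> \<phi> \<circ> R) ((\<lambda>(i, j). tens V V (v i) (v j)) b) =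
      (?B \<circ> tmap V V ?X ?X \<phi> \<phi>) ((\<lambda>(i, j). tens V V (v i) (v j)) b))"
    by (rule lin_eq_iff[OF coords_tensor[OF mv(1) mv(1)] is_vspace_tensor lin_comp[OF _ _ _ mv(2) pp] lin_comp[OF _ _ _ pp B]])
      (rule is_vspace_tensor)+
  also have "\<dots> \<longleftrightarrow> (\<forall>i\<in>I. \<forall>j\<in>I. (\<Sum>p\<in>J. \<Sum>q\<in>J. weave H W (?L i j p q) (?w p q)) =
      (\<Sum>p\<in>J. \<Sum>q\<in>J. weave H W (T (tens H H (a p i) (a q j)) + ?S i j p q) (?w p q)))"
    by (auto simp: left right)
  also have "\<dots> \<longleftrightarrow> (\<forall>i\<in>I. \<forall>j\<in>I. \<forall>p\<in>J. \<forall>q\<in>J. ?L i j p q = T (tens H H (a p i) (a q j)) + ?S i j p q)"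
  proof (intro ball_cong refl iffI ballI)
    fix i j p q assume ij: "i \<in> I" "j \<in> I" and pq: "p \<in> J" "q \<in> J"
      and eq: "(\<Sum>p\<in>J. \<Sum>q\<in>J. weave H W (?L i j p q) (?w p q)) =
      (\<Sum>p\<in>J. \<Sum>q\<in>J. weave H W (T (tens H H (a p i) (a q j)) + ?S i j p q) (?w p q))"
    show "?L i j p q = T (tens H H (a p i) (a q j)) + ?S i j p q"
      by (rule weave_coeff[OF fH mw(1) _ _ eq pq]) (intro L ij is_vspaceD(3)[OF is_vspace_tensor] TT S; assumption)+
  qed (simp cong: sum.cong)
  finally show ?thesis by (simp only: rtt_def diff_eq_eq)
qed

section \<open>The quadratic algebra of the internal hom\<close>

text \<open>
  A ring ideal is stable under scalars because scalars are multiples of the unit of the algebra.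
\<close>

lemma ideal_ptw:
  fixes U :: "('k::field, 'u::ab_group_add) vspace"
  assumes U: "is_vspace U" and K: "ideal K (tensor_algebra U)" and x: "x \<in> K"
  shows "ptw c x \<in> K"
proof -
  interpret ideal K "tensor_algebra U" by (rule K)
  have xc: "x \<in> vecs (talg_space U)" using a_subset x by (auto simp: tensor_algebra_def)
  have one: "word U [] \<in> vecs (talg_space U)" by (rule word_in_talg) simp
  have z: "tmult U 0 x = 0" by (simp add: tmult_def zero_fun_def)
  have "tmult U (word U []) x = x"
    using l_one[of x] xc by (simp add: tensor_algebra_def)
  then have "tmult U (ptw c (word U []) + 0) x = ptw c x"
    using tmult_linear_left[of U c "word U []" 0 x] z by simp
  moreover have "ptw c (word U []) + 0 \<in> vecs (talg_space U)"
    using is_vspaceD(4)[OF is_vspace_talg one] by simp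
  ultimately show ?thesis using I_l_closed[OF x, of "ptw c (word U []) + 0"] by (simp add: tensor_algebra_def)
qed

text \<open>
  The image of the operator is a whole subspace, while \<open>A(R:S)\<close> has only finitely many relations; both
  sets generate the same ideal because ideals are closed under linear combinations.
\<close>

lemma Idl_image:
  fixes U :: "('k::field, 'u::ab_group_add) vspace"
  assumes U: "is_vspace U" and Z: "coords Z B e d" and f: "f \<in> lin Z (talg_space U)"
  shows "Idl\<^bsub>tensor_algebra U\<^esub> (f ` vecs Z) = Idl\<^bsub>tensor_algebra U\<^esub> ((\<lambda>b. f (e b)) ` B)"
proof -
  interpret A: ring "tensor_algebra U" by (rule ring_tensor_algebra[OF U])
  note z = coordsD[OF Z]
  let ?X = "f ` vecs Z" and ?Y = "(\<lambda>b. f (e b)) ` B"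
  have X: "?X \<subseteq> carrier (tensor_algebra U)" using linD(2)[OF f] by (auto simp: tensor_algebra_def)
  have YX: "?Y \<subseteq> ?X" using z(3) by auto
  let ?K = "Idl\<^bsub>tensor_algebra U\<^esub> ?Y"
  have K: "ideal ?K (tensor_algebra U)" using X YX by (intro A.genideal_ideal) blast
  interpret K: ideal ?K "tensor_algebra U" by (rule K)
  have Y: "?Y \<subseteq> ?K" using X YX by (intro A.genideal_self) blast
  have sum: "sum g C \<in> ?K" if "\<And>b. b \<in> C \<Longrightarrow> g b \<in> ?K" for g and C :: "'c set"
    using that
  proof (induction C rule: infinite_finite_induct)
    case (insert b C)
    have "g b \<oplus>\<^bsub>tensor_algebra U\<^esub> sum g C \<in> ?K" using insert by (intro K.a_closed) simp_all
    also have "g b \<oplus>\<^bsub>tensor_algebra U\<^esub> sum g C = sum g (insert b C)"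
      using insert(1,2) by (simp add: tensor_algebra_def)
    finally show ?case .
  qed (use K.zero_closed in \<open>simp_all add: tensor_algebra_def\<close>)
  have "f x \<in> ?K" if "x \<in> vecs Z" for x
  proof -
    have "f x = f (\<Sum>b\<in>B. scl Z (d b x) (e b))" using z(6)[OF that] by simp
    also have "\<dots> = (\<Sum>b\<in>B. ptw (d b x) (f (e b)))"
      using lin_comb[OF z(1) is_vspace_talg f, of B e] z(3) by simp
    also have "\<dots> \<in> ?K" using Y by (intro sum ideal_ptw[OF U K]) auto
    finally show ?thesis .
  qed
  then have "Idl\<^bsub>tensor_algebra U\<^esub> ?X \<subseteq> ?K" using K by (intro A.genideal_minimal) auto
  moreover have "?K \<subseteq> Idl\<^bsub>tensor_algebra U\<^esub> ?X"
    using A.genideal_self[OF X] YX by (intro A.genideal_minimal A.genideal_ideal[OF X]) blast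
  ultimately show ?thesis by blast
qed

lemma deg2:
  fixes U :: "('k::field, 'u::ab_group_add) vspace"
  assumes U: "is_vspace U"
  shows deg2_lin: "deg2 U \<in> lin (tensor U U) (talg_space U)"
    and deg2_tens: "x \<in> vecs U \<Longrightarrow> y \<in> vecs U \<Longrightarrow> deg2 U (tens U U x y) = tmult U (word U [x]) (word U [y])"
proof -
  have b: "bilin U U (talg_space U) (\<lambda>v w. word U [v, w])"
  proof (rule bilinI)
    fix v v' w assume "v \<in> vecs U" "v' \<in> vecs U" "w \<in> vecs U"
    then have "f ([] @ (v + v') # [w]) = f ([] @ v # [w]) + f ([] @ v' # [w])" if "multilin U f" for f
      using that unfolding multilin_def by (metis Cons_in_lists_iff lists.Nil)
    then show "word U [v + v', w] = word U [v, w] + word U [v', w]" by (auto simp: word_def fun_eq_iff)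
  next
    fix v w w' assume "v \<in> vecs U" "w \<in> vecs U" "w' \<in> vecs U"
    then have "f ([v] @ (w + w') # []) = f ([v] @ w # []) + f ([v] @ w' # [])" if "multilin U f" for f
      using that unfolding multilin_def by (metis Cons_in_lists_iff lists.Nil)
    then show "word U [v, w + w'] = word U [v, w] + word U [v, w']" by (auto simp: word_def fun_eq_iff)
  next
    fix c v w assume "v \<in> vecs U" "w \<in> vecs U"
    then have "f ([] @ scl U c v # [w]) = c * f ([] @ v # [w])" if "multilin U f" for f
      using that unfolding multilin_def by (metis Cons_in_lists_iff lists.Nil)
    then show "word U [scl U c v, w] = scl (talg_space U) c (word U [v, w])" by (auto simp: word_def fun_eq_iff ptw_def)
  next
    fix c v w assume "v \<in> vecs U" "w \<in> vecs U"
    then have "f ([v] @ scl U c w # []) = c * f ([v] @ w # [])" if "multilin U f" for f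
      using that unfolding multilin_def by (metis Cons_in_lists_iff lists.Nil)
    then show "word U [v, scl U c w] = scl (talg_space U) c (word U [v, w])" by (auto simp: word_def fun_eq_iff ptw_def)
  qed (simp add: word_in_talg)
  show "deg2 U \<in> lin (tensor U U) (talg_space U)" unfolding deg2_def by (rule tlift_lin[OF is_vspace_talg b])
  show "x \<in> vecs U \<Longrightarrow> y \<in> vecs U \<Longrightarrow> deg2 U (tens U U x y) = tmult U (word U [x]) (word U [y])"
    by (simp add: deg2_def tlift_tens[OF is_vspace_talg b] tmult_word[OF U])
qed

text \<open>
  In the tensor algebra, the operator of the internal hom sends each pair of generators to one
  defining relation of \<open>A(R:S)\<close>, and every defining relation arises in this way.
\<close>

lemma U_obj_ihom:
  fixes V :: "('k::field, 'v::ab_group_add) vspace" and W :: "('k, 'w::ab_group_add) vspace"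
  assumes V: "EQA_obj (V, R)" "is_basis V n v" and W: "EQA_obj (W, S)" "is_basis W m w"
  shows "U_obj (ihom (W, S) (V, R)) = qmatrix_algebra V n v R W m w S"
proof -
  have vs: "is_vspace V" "is_vspace W" using V W by (simp_all add: EQA_obj_def fin_dim_def)
  have mV: "matrix_of V {1..n} v (dual_basis V n v) R (coeff V n v R)"
    using V vs by (intro matrix_of_coeff) (auto simp: EQA_obj_def)
  have mW: "matrix_of W {1..m} w (dual_basis W m w) S (coeff W m w S)"
    using W vs by (intro matrix_of_coeff) (auto simp: EQA_obj_def)
  define U where "U = tensor (dual W) V"
  define t where "t = (\<lambda>p i. tens (dual W) V (dual_basis W m w p) (v i))"
  define B where "B = snd (ihom (W, S) (V, R))"
  have hom: "ihom (W, S) (V, R) = (U, B)" by (rule prod_eqI) (simp_all add: fst_ihom U_def B_def)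
  have U: "is_vspace U" by (simp add: U_def)
  note cU = coords_tensor[OF coords_dual[OF matrix_ofD(1)[OF mW]] matrix_ofD(1)[OF mV], folded U_def]
  note f = lin_comp[OF is_vspace_tensor is_vspace_tensor is_vspace_talg ihom_lin[OF mV mW, folded U_def B_def] deg2_lin[OF U]]
  have t_in: "t p i \<in> vecs U" if "p \<in> {1..m}" "i \<in> {1..n}" for p i
    using coordsD(3)[OF cU, of "(p, i)"] that by (simp add: t_def)
  have gens: "deg2 U (tens U U (t p i) (t q j)) =
      tmult (tensor (dual W) V) (qm_gen V v W m w i p) (qm_gen V v W m w j q)"
    if "i \<in> {1..n}" "j \<in> {1..n}" "p \<in> {1..m}" "q \<in> {1..m}" for i j p q
    using deg2_tens[OF U t_in[OF that(3,1)] t_in[OF that(4,2)]] by (simp add: qm_gen_def t_def U_def)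
  have rel: "(deg2 U \<circ> B) (tens U U (t p i) (t q j)) = qm_rel V n v R W m w S i j p q"
    if ij: "i \<in> {1..n}" "j \<in> {1..n}" "p \<in> {1..m}" "q \<in> {1..m}" for i j p q
  proof -
    have "(deg2 U \<circ> B) (tens U U (t p i) (t q j)) =
        deg2 U (rtt {1..n} (coeff V n v R) {1..m} (coeff W m w S) U t i j p q)"
      using ihom_generators[OF mV mW ij] by (simp add: U_def t_def B_def)
    also have "\<dots> = qm_rel V n v R W m w S i j p q"
      unfolding qm_rel_def Let_def
      by (subst lin_rtt[OF deg2_lin[OF U] is_vspace_talg scl_simps(3) _ ij], rule t_in, assumption, assumption,
          intro arg_cong2[where f = "(-)"] sum.cong refl arg_cong[where f = "ptw _"])
        (use ij in \<open>simp_all only: gens\<close>)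
    finally show ?thesis .
  qed
  have "(\<lambda>b. (deg2 U \<circ> B) ((\<lambda>(x, y). tens U U ((\<lambda>(p, i). t p i) x) ((\<lambda>(p, i). t p i) y)) b)) `
      (({1..m} \<times> {1..n}) \<times> ({1..m} \<times> {1..n})) =
    {qm_rel V n v R W m w S i j p q | i j p q. i \<in> {1..n} \<and> j \<in> {1..n} \<and> p \<in> {1..m} \<and> q \<in> {1..m}}" (is "?L = ?Q")
  proof
    show "?L \<subseteq> ?Q" by (rule image_subsetI, elim SigmaE) (simp only: prod.case rel, blast)
    show "?Q \<subseteq> ?L"
    proof
      fix x assume "x \<in> ?Q"
      then obtain i j p q where x: "x = qm_rel V n v R W m w S i j p q"
        and ij: "i \<in> {1..n}" "j \<in> {1..n}" "p \<in> {1..m}" "q \<in> {1..m}" by blast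
      show "x \<in> ?L"
        by (rule image_eqI[of _ _ "((p, i), (q, j))"]) (use x rel[OF ij] ij in simp_all)
    qed
  qed
  then have "Idl\<^bsub>tensor_algebra U\<^esub> ((deg2 U \<circ> B) ` vecs (tensor U U)) = Idl\<^bsub>tensor_algebra U\<^esub> ?Q"
    using Idl_image[OF U coords_tensor[OF cU cU] f] by (simp add: t_def)
  moreover have "U_obj (ihom (W, S) (V, R)) = presented U (deg2 U ` B ` vecs (tensor U U))"
    by (simp add: U_obj_def hom)
  ultimately show ?thesis
    by (simp add: qmatrix_algebra_def presented_def image_comp U_def)
qed

section \<open>The internal coHom object\<close>

lemma delta_basis:
  assumes V: "coords V {1..n} v (dual_basis V n v)" and W: "coords W {1..m} w (dual_basis W m w)"
  shows delta_lin: "delta V n v W m w \<in> lin V (tensor (tensor (dual W) V) W)"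
    and delta_v: "i \<in> {1..n} \<Longrightarrow> delta V n v W m w (v i) =
      (\<Sum>p\<in>{1..m}. tens (tensor (dual W) V) W (tens (dual W) V (dual_basis W m w p) (v i)) (w p))"
proof -
  let ?X = "tensor (tensor (dual W) V) W"
  let ?u = "\<lambda>i. \<Sum>p\<in>{1..m}. tens (tensor (dual W) V) W (tens (dual W) V (dual_basis W m w p) (v i)) (w p)"
  note cv = coordsD[OF V] and cw = coordsD[OF W] and cd = coordsD[OF coords_dual[OF W]]
  have u: "?u i \<in> vecs ?X" if "i \<in> {1..n}" for i
    using that cv(3) cw(3) cd(3) by (intro vspace_sum is_vspace_tensor tensD(1)) auto
  have lin: "delta V n v W m w x = (\<Sum>i\<in>{1..n}. scl ?X (dual_basis V n v i x) (?u i))" for x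
    by (simp add: delta_def)
  show "delta V n v W m w \<in> lin V ?X"
  proof (rule linI)
    fix x assume "x \<notin> vecs V"
    then show "delta V n v W m w x = 0"
      using linD(1)[OF cv(4)] by (simp add: delta_def ptw_simps)
  next
    fix x assume "x \<in> vecs V"
    show "delta V n v W m w x \<in> vecs ?X" unfolding lin by (intro vspace_comb is_vspace_tensor u)
  next
    fix x y assume "x \<in> vecs V" "y \<in> vecs V"
    then show "delta V n v W m w (x + y) = delta V n v W m w x + delta V n v W m w y"
      using linD(3)[OF cv(4)] by (simp add: delta_def ptw_simps sum.distrib)
  next
    fix c x assume "x \<in> vecs V"
    then show "delta V n v W m w (scl V c x) = scl ?X c (delta V n v W m w x)"
      using linD(4)[OF cv(4)] by (simp add: delta_def ptw_simps)
  qed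
  assume i: "i \<in> {1..n}"
  have "delta V n v W m w (v i) = (\<Sum>j\<in>{1..n}. if j = i then ?u j else 0)"
    unfolding delta_def using i by (intro sum.cong refl) (auto simp: cv(5) ptw_simps simp del: atLeastAtMost_iff)
  then show "delta V n v W m w (v i) = ?u i" using i by simp
qed

theorem mainTheorem6:
  fixes V :: "('k::real_or_complex, 'v::ab_group_add) vspace"
    and W :: "('k, 'w::ab_group_add) vspace"
    and R :: "('k, 'v, 'v) tens \<Rightarrow> ('k, 'v, 'v) tens"
    and S :: "('k, 'w, 'w) tens \<Rightarrow> ('k, 'w, 'w) tens"
    and v :: "nat \<Rightarrow> 'v" and w :: "nat \<Rightarrow> 'w"
    and n m :: nat
  assumes "EQA_obj (V, R)" and "EQA_obj (W, S)"
    and "is_basis V n v" and "is_basis W m w"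
  shows "EQA_obj (ihom (W, S) (V, R))
    \<and> EQA_arr (V, R) (box (ihom (W, S) (V, R)) (W, S)) (delta V n v W m w)
    \<and> (\<forall>(H :: ('k, 'h::ab_group_add) eqs) \<phi>.
         EQA_obj H \<longrightarrow> EQA_arr (V, R) (box H (W, S)) \<phi> \<longrightarrow>
         (\<exists>!\<alpha>. EQA_arr (ihom (W, S) (V, R)) H \<alpha> \<and>
            \<phi> = box_arr (ihom (W, S) (V, R)) (W, S) H (W, S) \<alpha> (EQA_id (W, S))
                  \<circ> delta V n v W m w))
    \<and> U_obj (ihom (W, S) (V, R)) = qmatrix_algebra V n v R W m w S
    \<and> U_obj (ihom (V, R) (V, R)) = FRT_algebra V n v R"
proof -
  let ?I = "{1..n}" and ?J = "{1..m}"
  let ?rc = "coeff V n v R" and ?sc = "coeff W m w S"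
  have vs: "is_vspace V" "is_vspace W" using assms by (simp_all add: EQA_obj_def fin_dim_def)
  have mV: "matrix_of V ?I v (dual_basis V n v) R ?rc"
    using assms vs by (intro matrix_of_coeff) (auto simp: EQA_obj_def)
  have mW: "matrix_of W ?J w (dual_basis W m w) S ?sc"
    using assms vs by (intro matrix_of_coeff) (auto simp: EQA_obj_def)
  note cV = matrix_ofD(1)[OF mV] and cW = matrix_ofD(1)[OF mW]
  define U where "U = tensor (dual W) V"
  define t where "t = (\<lambda>p i. tens (dual W) V (dual_basis W m w p) (v i))"
  define B where "B = snd (ihom (W, S) (V, R))"
  have hom: "ihom (W, S) (V, R) = (U, B)" by (rule prod_eqI) (simp_all add: fst_ihom U_def B_def)
  note cU = coords_tensor[OF coords_dual[OF cW] cV, folded U_def]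
  have t_in: "t p i \<in> vecs U" if "p \<in> ?J" "i \<in> ?I" for p i
    using coordsD(3)[OF cU, of "(p, i)"] that by (simp add: t_def)
  have B: "B \<in> lin (tensor U U) (tensor U U)" using ihom_lin[OF mV mW] by (simp add: U_def B_def)
  have hom_obj: "EQA_obj (U, B)" using coords_dim[OF cU] B by (simp add: EQA_obj_def)
  have U: "is_vspace U" by (simp add: U_def)
  have d_lin: "delta V n v W m w \<in> lin V (tensor U W)" using delta_lin[OF cV cW] by (simp add: U_def)
  have d_v: "delta V n v W m w (v i) = (\<Sum>p\<in>?J. tens U W (t p i) (w p))" if "i \<in> ?I" for i
    using delta_v[OF cV cW that] by (simp add: U_def t_def)
  have gen: "rtt ?I ?rc ?J ?sc U t i j p q = B (tens U U (t p i) (t q j))"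
    if "i \<in> ?I" "j \<in> ?I" "p \<in> ?J" "q \<in> ?J" for i j p q
    using ihom_generators[OF mV mW that] by (simp add: U_def t_def B_def)
  have delta_arr: "EQA_arr (V, R) (box (U, B) (W, S)) (delta V n v W m w)"
    using coaction_arrow_iff[OF mV mW hom_obj d_lin t_in d_v] gen by blast
  have univ: "\<exists>!\<alpha>. EQA_arr (U, B) (H, T) \<alpha> \<and> \<phi> = tmap U W H W \<alpha> (lid W) \<circ> delta V n v W m w"
    if H: "EQA_obj (H, T)" and arr: "EQA_arr (V, R) (box (H, T) (W, S)) \<phi>"
    for H :: "('k, 'h) vspace" and T \<phi>
  proof -
    have Hv: "is_vspace H" using H by (simp add: EQA_obj_def fin_dim_def)
    have \<phi>: "\<phi> \<in> lin V (tensor H W)" using arr by (simp add: EQA_arr_def box_def)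
    have "\<forall>i\<in>?I. \<exists>a. (\<forall>p\<in>?J. a p \<in> vecs H) \<and> \<phi> (v i) = (\<Sum>p\<in>?J. tens H W (a p) (w p))"
      using coordsD(3)[OF cV] by (intro ballI tensor_expand[OF Hv cW] linD(2)[OF \<phi>])
    then obtain a' where a': "\<forall>i\<in>?I. (\<forall>p\<in>?J. a' i p \<in> vecs H) \<and> \<phi> (v i) = (\<Sum>p\<in>?J. tens H W (a' i p) (w p))"
      by (rule bchoice[THEN exE])
    define a where "a p i = a' i p" for p i
    have a: "a p i \<in> vecs H" if "p \<in> ?J" "i \<in> ?I" for p i using a' that by (simp add: a_def)
    have \<phi>_v: "\<phi> (v i) = (\<Sum>p\<in>?J. tens H W (a p i) (w p))" if "i \<in> ?I" for i using a' that by (simp add: a_def)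
    have rel: "\<forall>i\<in>?I. \<forall>j\<in>?I. \<forall>p\<in>?J. \<forall>q\<in>?J. rtt ?I ?rc ?J ?sc H a i j p q = T (tens H H (a p i) (a q j))"
      using coaction_arrow_iff[OF mV mW H \<phi> a \<phi>_v] arr by blast
    have comp_v: "(tmap U W H W \<alpha> (lid W) \<circ> delta V n v W m w) (v i) = (\<Sum>p\<in>?J. tens H W (\<alpha> (t p i)) (w p))"
      if \<alpha>: "\<alpha> \<in> lin U H" and i: "i \<in> ?I" for \<alpha> i
    proof -
      have tw: "tens U W (t p i) (w p) \<in> vecs (tensor U W)" if "p \<in> ?J" for p
        using that i by (intro tensD(1) t_in coordsD(3)[OF cW])
      note l = tmap_lin[OF \<alpha> lid_lin[OF vs(2)]]
      have "(tmap U W H W \<alpha> (lid W) \<circ> delta V n v W m w) (v i) = (\<Sum>p\<in>?J. tmap U W H W \<alpha> (lid W) (tens U W (t p i) (w p)))"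
        using lin_sum[OF _ _ l, of ?J "\<lambda>p. tens U W (t p i) (w p)"] tw by (simp add: d_v[OF i])
      also have "\<dots> = (\<Sum>p\<in>?J. tens H W (\<alpha> (t p i)) (w p))"
        using i t_in coordsD(3)[OF cW] by (intro sum.cong refl) (simp add: tmap_tens[OF \<alpha> lid_lin[OF vs(2)]] lid_def)
      finally show ?thesis .
    qed
    \<comment> \<open>Composing with \<open>\<delta>\<close> keeps the matrix, so a factorisation of \<open>\<phi>\<close> is a linear map with prescribed
      values on the basis \<open>t p i\<close>.\<close>
    have factors: "\<phi> = tmap U W H W \<alpha> (lid W) \<circ> delta V n v W m w \<longleftrightarrow> (\<forall>p\<in>?J. \<forall>i\<in>?I. \<alpha> (t p i) = a p i)"
      if \<alpha>: "\<alpha> \<in> lin U H" for \<alpha>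
    proof -
      have "\<phi> = tmap U W H W \<alpha> (lid W) \<circ> delta V n v W m w \<longleftrightarrow>
          (\<forall>i\<in>?I. \<phi> (v i) = (tmap U W H W \<alpha> (lid W) \<circ> delta V n v W m w) (v i))"
        by (rule lin_eq_iff[OF cV is_vspace_tensor \<phi>])
          (intro lin_comp[OF vs(1) _ _ d_lin tmap_lin[OF \<alpha> lid_lin[OF vs(2)]]] is_vspace_tensor)
      also have "\<dots> \<longleftrightarrow> (\<forall>i\<in>?I. (\<Sum>p\<in>?J. tens H W (a p i) (w p)) = (\<Sum>p\<in>?J. tens H W (\<alpha> (t p i)) (w p)))"
        by (intro ball_cong refl) (simp only: \<phi>_v comp_v[OF \<alpha>])
      also have "\<dots> \<longleftrightarrow> (\<forall>p\<in>?J. \<forall>i\<in>?I. \<alpha> (t p i) = a p i)"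
      proof (intro iffI ballI)
        fix p i assume eq: "\<forall>i\<in>?I. (\<Sum>p\<in>?J. tens H W (a p i) (w p)) = (\<Sum>p\<in>?J. tens H W (\<alpha> (t p i)) (w p))"
          and p: "p \<in> ?J" and i: "i \<in> ?I"
        have "a p i = \<alpha> (t p i)"
          using i eq by (intro tensor_coeff[where a = "\<lambda>p. a p i" and b = "\<lambda>p. \<alpha> (t p i)", OF Hv cW _ _ _ p] a linD(2)[OF \<alpha>] t_in) blast+
        then show "\<alpha> (t p i) = a p i" by simp
      next
        fix i assume h: "\<forall>p\<in>?J. \<forall>i\<in>?I. \<alpha> (t p i) = a p i" and i: "i \<in> ?I"
        show "(\<Sum>p\<in>?J. tens H W (a p i) (w p)) = (\<Sum>p\<in>?J. tens H W (\<alpha> (t p i)) (w p))"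
          by (rule sum.cong[OF refl]) (simp only: h[rule_format, OF _ i])
      qed
      finally show ?thesis .
    qed
    show ?thesis
    proof (rule ex_ex1I)
      have "\<exists>\<alpha>\<in>lin U H. \<forall>b\<in>?J \<times> ?I. \<alpha> ((\<lambda>(p, i). t p i) b) = (\<lambda>(p, i). a p i) b"
        unfolding t_def by (rule lin_ex[OF cU Hv]) (use a in auto)
      then obtain \<alpha> where \<alpha>: "\<alpha> \<in> lin U H" and \<alpha>_t0: "\<forall>b\<in>?J \<times> ?I. \<alpha> ((\<lambda>(p, i). t p i) b) = (\<lambda>(p, i). a p i) b" by (rule bexE)
      have \<alpha>_t: "\<alpha> (t p i) = a p i" if "p \<in> ?J" "i \<in> ?I" for p i
        using \<alpha>_t0[rule_format, of "(p, i)"] that by simp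
      have "rtt ?I ?rc ?J ?sc H (\<lambda>p i. \<alpha> (t p i)) i j p q = T (tens H H (\<alpha> (t p i)) (\<alpha> (t q j)))"
        if "i \<in> ?I" "j \<in> ?I" "p \<in> ?J" "q \<in> ?J" for i j p q
        unfolding \<alpha>_t[OF that(3,1)] \<alpha>_t[OF that(4,2)] rel[rule_format, OF that, symmetric]
        by (rule rtt_cong[OF \<alpha>_t that])
      then have "EQA_arr (U, B) (H, T) \<alpha>"
        using ihom_arrow_iff[OF mV mW H \<alpha>[unfolded U_def]] unfolding t_def hom by blast
      then show "\<exists>\<alpha>. EQA_arr (U, B) (H, T) \<alpha> \<and> \<phi> = tmap U W H W \<alpha> (lid W) \<circ> delta V n v W m w"
        using factors[OF \<alpha>] \<alpha>_t by blast
    next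
      fix \<alpha> \<beta> assume 1: "EQA_arr (U, B) (H, T) \<alpha> \<and> \<phi> = tmap U W H W \<alpha> (lid W) \<circ> delta V n v W m w"
        and 2: "EQA_arr (U, B) (H, T) \<beta> \<and> \<phi> = tmap U W H W \<beta> (lid W) \<circ> delta V n v W m w"
      have l: "\<alpha> \<in> lin U H" "\<beta> \<in> lin U H" using 1 2 by (simp_all add: EQA_arr_def)
      show "\<alpha> = \<beta>"
      proof (rule lin_eqI[OF cU Hv l])
        fix b assume "b \<in> ?J \<times> ?I"
        then show "\<alpha> (case b of (p, i) \<Rightarrow> tens (dual W) V (dual_basis W m w p) (v i)) =
            \<beta> (case b of (p, i) \<Rightarrow> tens (dual W) V (dual_basis W m w p) (v i))"
          using factors[OF l(1)] factors[OF l(2)] 1 2 by (auto simp: t_def simp del: atLeastAtMost_iff)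
      qed
    qed
  qed
  have "\<forall>(H :: ('k, 'h) eqs) \<phi>.
         EQA_obj H \<longrightarrow> EQA_arr (V, R) (box H (W, S)) \<phi> \<longrightarrow>
         (\<exists>!\<alpha>. EQA_arr (ihom (W, S) (V, R)) H \<alpha> \<and>
            \<phi> = box_arr (ihom (W, S) (V, R)) (W, S) H (W, S) \<alpha> (EQA_id (W, S))
                  \<circ> delta V n v W m w)"
  proof (intro allI impI)
    fix H :: "('k, 'h) eqs" and \<phi>
    assume H: "EQA_obj H" "EQA_arr (V, R) (box H (W, S)) \<phi>"
    obtain H' T where HT: "H = (H', T)" by (rule prod.exhaust)
    show "\<exists>!\<alpha>. EQA_arr (ihom (W, S) (V, R)) H \<alpha> \<and>
        \<phi> = box_arr (ihom (W, S) (V, R)) (W, S) H (W, S) \<alpha> (EQA_id (W, S)) \<circ> delta V n v W m w"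
      using univ[OF H[unfolded HT]] by (simp only: HT hom box_arr_def EQA_id_def fst_conv prod.case)
  qed
  moreover have "U_obj (ihom (V, R) (V, R)) = FRT_algebra V n v R"
    unfolding FRT_algebra_def by (rule U_obj_ihom[OF assms(1,3,1,3)])
  moreover have "EQA_obj (ihom (W, S) (V, R))" unfolding hom by (rule hom_obj)
  moreover have "EQA_arr (V, R) (box (ihom (W, S) (V, R)) (W, S)) (delta V n v W m w)"
    unfolding hom by (rule delta_arr)
  ultimately show ?thesis using U_obj_ihom[OF assms(1,3,2,4)] by (intro conjI)
qed

end
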